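(* Let $W$ be a $d$-dimensional Brownian motion, $p\in(2,3)$, and let $\mathcal{P}^n_U=\{0=t^n_0<t^n_1<\cdots<t^n_n=T\}$, $n\in\mathbb{N}$, with $t^n_i=\frac{iT}{n}$, be the sequence of equidistant partitions with width $\frac Tn$ of the interval $[0,T]$. Let $y_0\in\mathbb{R}^k$, $b\in C^2_b(\mathbb{R}^{k+1};\mathbb{R}^k)$, $\sigma\in C^3_b(\mathbb{R}^{k+1};\mathcal{L}(\mathbb{R}^d;\mathbb{R}^k))$. Let $Y$ be the solution of the Itô SDE $$Y_t=y_0+\int_0^tb(s,Y_s)\,\mathrm{d}s+\int_0^t\sigma(s,Y_s)\,\mathrm{d}W_s,\qquad t\in[0,T],$$ and let $Y^n$ be the corresponding Euler approximation along $\mathcal{P}^n_U$, $$Y^n_t=y_0+\sum_{i:\,t^n_{i+1}\le t}b(t^n_i,Y^n_{t^n_i})(t^n_{i+1}-t^n_i)+\sum_{i:\,t^n_{i+1}\le t}\sigma(t^n_i,Y^n_{t^n_i})(W_{t^n_{i+1}}-W_{t^n_i}),\qquad t\in[0,T].$$ For any $p'\in(p,3)$, $q\in(1,2)$ and $\beta\in(1-\frac1p,\frac2p)$ such that $\frac1{p'}+\frac1q>1$, there exists a random variable $C$, which does not depend on $n$, such that $$\|Y^n-Y\|_{p'}\le C\big(n^{-(1-\frac1q)}+n^{-(\frac2p-\beta)(1-\frac p{p'})}\big),\qquad n\in\mathbb{N}.$$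
   Context: $T>0$ is a fixed time horizon; $W$ is a Brownian motion on a filtered probability space satisfying the usual conditions (the SDE has a unique strong solution). For a path $Z$ on $[0,T]$, $\|Z\|_{p'}=(\sup_{\mathcal{P}}\sum_{[u,v]\in\mathcal{P}}|Z_v-Z_u|^{p'})^{1/p'}$ is the $p'$-variation, with supremum over all partitions $\mathcal{P}$ of $[0,T]$. $C^j_b$ denotes $j$-times differentiable functions which, together with their derivatives up to order $j$, are bounded and continuous. The random variable $C$ is finite and the pathwise inequality is understood to hold almost surely. *)

theory Defs
  imports "HOL-Probability.Probability"
begin

subsection \<open>Filtered probability spaces and Brownian motion\<close>

text \<open>Time is the interval \<open>[0, T]\<close>; the values of \<open>F\<close> (and of all processes) outside it are
  irrelevant. The assumptions \<open>complete\<close>, \<open>null_sets_F\<close> and \<open>right_continuous_F\<close> are the usual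
  conditions.\<close>

locale usual_filtered_prob_space = prob_space M + complete_measure M
  for M :: "'w measure" +
  fixes F :: "real \<Rightarrow> 'w measure" and T :: real
  assumes subalgebra_F: "t \<in> {0..T} \<Longrightarrow> subalgebra M (F t)"
    and sets_F_mono: "0 \<le> s \<Longrightarrow> s \<le> t \<Longrightarrow> t \<le> T \<Longrightarrow> sets (F s) \<subseteq> sets (F t)"
    and null_sets_F: "null_sets M \<subseteq> sets (F 0)"
    and right_continuous_F: "t \<in> {0..<T} \<Longrightarrow> sets (F t) = (\<Inter>s\<in>{t<..T}. sets (F s))"

definition adapted :: "(real \<Rightarrow> 'w measure) \<Rightarrow> real \<Rightarrow> (real \<Rightarrow> 'w \<Rightarrow> 'b::topological_space) \<Rightarrow> bool" where
  "adapted F T X \<longleftrightarrow> (\<forall>t\<in>{0..T}. X t \<in> borel_measurable (F t))"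

definition progressive :: "(real \<Rightarrow> 'w measure) \<Rightarrow> real \<Rightarrow> (real \<Rightarrow> 'w \<Rightarrow> 'b::topological_space) \<Rightarrow> bool" where
  "progressive F T H \<longleftrightarrow>
    (\<forall>t\<in>{0..T}. (\<lambda>(s, \<omega>). H s \<omega>) \<in> borel_measurable (restrict_space borel {0..t} \<Otimes>\<^sub>M F t))"

definition AE_continuous :: "'w measure \<Rightarrow> real \<Rightarrow> (real \<Rightarrow> 'w \<Rightarrow> 'b::topological_space) \<Rightarrow> bool" where
  "AE_continuous M T X \<longleftrightarrow> (AE \<omega> in M. continuous_on {0..T} (\<lambda>t. X t \<omega>))"

text \<open>The increment over \<open>[s, t]\<close> has law \<open>N(0, (t - s) I)\<close>: its coordinates are independent and
  each is \<open>N(0, t - s)\<close>-distributed.\<close>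

locale brownian_motion = usual_filtered_prob_space M F T
  for M :: "'w measure" and F T +
  fixes W :: "real \<Rightarrow> 'w \<Rightarrow> real ^ 'd"
  assumes W_zero: "AE \<omega> in M. W 0 \<omega> = 0"
    and W_adapted: "adapted F T W"
    and W_continuous: "AE_continuous M T W"
    and W_indep: "0 \<le> s \<Longrightarrow> s < t \<Longrightarrow> t \<le> T \<Longrightarrow>
      indep_set (sets (F s)) {(\<lambda>\<omega>. W t \<omega> - W s \<omega>) -` A \<inter> space M | A. A \<in> sets borel}"
    and W_indep_coords: "0 \<le> s \<Longrightarrow> s < t \<Longrightarrow> t \<le> T \<Longrightarrow>
      indep_vars (\<lambda>_. borel) (\<lambda>i \<omega>. (W t \<omega> - W s \<omega>) $ i) UNIV"
    and W_normal: "0 \<le> s \<Longrightarrow> s < t \<Longrightarrow> t \<le> T \<Longrightarrow>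
      distributed M lborel (\<lambda>\<omega>. (W t \<omega> - W s \<omega>) $ i) (normal_density 0 (sqrt (t - s)))"


subsection \<open>The Ito integral\<close>

text \<open>A simple integrand is \<open>\<Sum>i<N. \<xi> i \<cdot> 1\<^bsub>(\<tau> i, \<tau> (i + 1)]\<^esub>\<close> with \<open>\<xi> i\<close> bounded and
  \<open>F (\<tau> i)\<close>-measurable.\<close>

definition simple_integrand ::
  "'w measure \<Rightarrow> (real \<Rightarrow> 'w measure) \<Rightarrow> real \<Rightarrow> nat \<Rightarrow> (nat \<Rightarrow> real) \<Rightarrow> (nat \<Rightarrow> 'w \<Rightarrow> 'b::real_normed_vector) \<Rightarrow> bool"
where
  "simple_integrand M F T N \<tau> \<xi> \<longleftrightarrow>
    (\<forall>i\<le>N. \<tau> i \<in> {0..T}) \<and>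
    (\<forall>i<N. \<tau> i < \<tau> (Suc i) \<and> \<xi> i \<in> borel_measurable (F (\<tau> i)) \<and> bounded (\<xi> i ` space M))"

definition simple_process ::
  "nat \<Rightarrow> (nat \<Rightarrow> real) \<Rightarrow> (nat \<Rightarrow> 'w \<Rightarrow> 'b::real_normed_vector) \<Rightarrow> real \<Rightarrow> 'w \<Rightarrow> 'b" where
  "simple_process N \<tau> \<xi> t \<omega> = (\<Sum>i<N. indicator {\<tau> i<..\<tau> (Suc i)} t *\<^sub>R \<xi> i \<omega>)"

definition simple_integral ::
  "(real \<Rightarrow> 'w \<Rightarrow> 'a::real_normed_vector) \<Rightarrow> nat \<Rightarrow> (nat \<Rightarrow> real) \<Rightarrow> (nat \<Rightarrow> 'w \<Rightarrow> 'a \<Rightarrow>\<^sub>L 'b::real_normed_vector)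
    \<Rightarrow> real \<Rightarrow> 'w \<Rightarrow> 'b"
where
  "simple_integral W N \<tau> \<xi> t \<omega> =
    (\<Sum>i<N. blinfun_apply (\<xi> i \<omega>) (W (min (\<tau> (Suc i)) t) \<omega> - W (min (\<tau> i) t) \<omega>))"

text \<open>\<open>X\<close> is (a version of) the process \<open>(\<integral>\<^sub>0\<^sup>t H\<^sub>s dW\<^sub>s)\<close> for \<open>t \<in> [0, T]\<close>: the continuous adapted process
  whose value at each \<open>t\<close> is the limit in probability of the integrals of simple integrands \<open>H\<^sup>m\<close>
  such that \<open>\<integral>\<^sub>0\<^sup>T |H\<^sup>m\<^sub>s - H\<^sub>s|\<^sup>2 ds\<close> tends to 0 in probability. For a Brownian motion \<open>W\<close> it exists
  iff the progressive process \<open>H\<close> satisfies \<open>\<integral>\<^sub>0\<^sup>T |H\<^sub>s|\<^sup>2 ds < \<infinity>\<close> almost surely, and it is then unique up to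
  indistinguishability.\<close>

definition is_ito_integral ::
  "'w measure \<Rightarrow> (real \<Rightarrow> 'w measure) \<Rightarrow> real \<Rightarrow> (real \<Rightarrow> 'w \<Rightarrow> real ^ 'd)
    \<Rightarrow> (real \<Rightarrow> 'w \<Rightarrow> (real ^ 'd) \<Rightarrow>\<^sub>L (real ^ 'k)) \<Rightarrow> (real \<Rightarrow> 'w \<Rightarrow> real ^ 'k) \<Rightarrow> bool"
where
  "is_ito_integral M F T W H X \<longleftrightarrow>
    progressive F T H \<and> adapted F T X \<and> AE_continuous M T X \<and>
    (\<exists>N \<tau> \<xi>.
      (\<forall>m::nat. simple_integrand M F T (N m) (\<tau> m) (\<xi> m)) \<and>
      (\<forall>\<epsilon>>0. (\<lambda>m. measure M {\<omega> \<in> space M.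
          (\<integral>\<^sup>+s\<in>{0..T}. ennreal ((norm (simple_process (N m) (\<tau> m) (\<xi> m) s \<omega> - H s \<omega>))\<^sup>2) \<partial>lborel)
            > ennreal \<epsilon>}) \<longlonglongrightarrow> 0) \<and>
      (\<forall>t\<in>{0..T}. \<forall>\<epsilon>>0. (\<lambda>m. measure M {\<omega> \<in> space M.
          norm (simple_integral W (N m) (\<tau> m) (\<xi> m) t \<omega> - X t \<omega>) > \<epsilon>}) \<longlonglongrightarrow> 0))"


subsection \<open>The SDE and its Euler approximation\<close>

text \<open>Points of \<open>\<real>\<^bsup>k+1\<^esup>\<close> are pairs of a time and a state.\<close>

definition is_sde_solution ::
  "'w measure \<Rightarrow> (real \<Rightarrow> 'w measure) \<Rightarrow> real \<Rightarrow> (real \<Rightarrow> 'w \<Rightarrow> real ^ 'd) \<Rightarrow> real ^ 'k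
    \<Rightarrow> (real \<times> (real ^ 'k) \<Rightarrow> real ^ 'k) \<Rightarrow> (real \<times> (real ^ 'k) \<Rightarrow> (real ^ 'd) \<Rightarrow>\<^sub>L (real ^ 'k))
    \<Rightarrow> (real \<Rightarrow> 'w \<Rightarrow> real ^ 'k) \<Rightarrow> bool"
where
  "is_sde_solution M F T W y0 b \<sigma> Y \<longleftrightarrow>
    adapted F T Y \<and> AE_continuous M T Y \<and>
    (\<exists>X. is_ito_integral M F T W (\<lambda>s \<omega>. \<sigma> (s, Y s \<omega>)) X \<and>
      (AE \<omega> in M. \<forall>t\<in>{0..T}. Y t \<omega> = y0 + (LINT s:{0..t}|lborel. b (s, Y s \<omega>)) + X t \<omega>))"

definition grid :: "real \<Rightarrow> nat \<Rightarrow> nat \<Rightarrow> real" where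
  "grid T n i = real i * T / real n"

text \<open>The right-hand side at time \<open>t\<close> only involves \<open>Z\<close> at grid points before \<open>t\<close>, so this equation
  determines \<open>Z\<close> on \<open>[0, T]\<close> recursively.\<close>

definition is_euler_approximation ::
  "'w measure \<Rightarrow> real \<Rightarrow> (real \<Rightarrow> 'w \<Rightarrow> real ^ 'd) \<Rightarrow> real ^ 'k
    \<Rightarrow> (real \<times> (real ^ 'k) \<Rightarrow> real ^ 'k) \<Rightarrow> (real \<times> (real ^ 'k) \<Rightarrow> (real ^ 'd) \<Rightarrow>\<^sub>L (real ^ 'k))
    \<Rightarrow> nat \<Rightarrow> (real \<Rightarrow> 'w \<Rightarrow> real ^ 'k) \<Rightarrow> bool"
where
  "is_euler_approximation M T W y0 b \<sigma> n Z \<longleftrightarrow>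
    (\<forall>\<omega>\<in>space M. \<forall>t\<in>{0..T}. Z t \<omega> = y0
      + (\<Sum>i | i < n \<and> grid T n (Suc i) \<le> t.
          (grid T n (Suc i) - grid T n i) *\<^sub>R b (grid T n i, Z (grid T n i) \<omega>))
      + (\<Sum>i | i < n \<and> grid T n (Suc i) \<le> t.
          blinfun_apply (\<sigma> (grid T n i, Z (grid T n i) \<omega>))
            (W (grid T n (Suc i)) \<omega> - W (grid T n i) \<omega>)))"


subsection \<open>The function classes \<open>C\<^sup>j\<^sub>b\<close>\<close>

text \<open>Successive Frechet derivatives live in different types, so the recursion over \<open>j\<close> is unrolled
  into polymorphic definitions.\<close>

definition C0b :: "('a::real_normed_vector \<Rightarrow> 'b::real_normed_vector) \<Rightarrow> bool" where
  "C0b f \<longleftrightarrow> continuous_on UNIV f \<and> bounded (range f)"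

definition C1b :: "('a::real_normed_vector \<Rightarrow> 'b::real_normed_vector) \<Rightarrow> bool" where
  "C1b f \<longleftrightarrow> C0b f \<and>
    (\<exists>f' :: 'a \<Rightarrow> 'a \<Rightarrow>\<^sub>L 'b. (\<forall>x. (f has_derivative blinfun_apply (f' x)) (at x)) \<and> C0b f')"

definition C2b :: "('a::real_normed_vector \<Rightarrow> 'b::real_normed_vector) \<Rightarrow> bool" where
  "C2b f \<longleftrightarrow> C0b f \<and>
    (\<exists>f' :: 'a \<Rightarrow> 'a \<Rightarrow>\<^sub>L 'b. (\<forall>x. (f has_derivative blinfun_apply (f' x)) (at x)) \<and> C1b f')"

definition C3b :: "('a::real_normed_vector \<Rightarrow> 'b::real_normed_vector) \<Rightarrow> bool" where
  "C3b f \<longleftrightarrow> C0b f \<and>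
    (\<exists>f' :: 'a \<Rightarrow> 'a \<Rightarrow>\<^sub>L 'b. (\<forall>x. (f has_derivative blinfun_apply (f' x)) (at x)) \<and> C2b f')"


subsection \<open>\<open>r\<close>-variation\<close>

definition ennreal_powr :: "ennreal \<Rightarrow> real \<Rightarrow> ennreal" where
  "ennreal_powr x a = (if x = \<infinity> then \<infinity> else ennreal (enn2real x powr a))"

definition partition_points :: "real \<Rightarrow> nat \<Rightarrow> (nat \<Rightarrow> real) \<Rightarrow> bool" where
  "partition_points T N u \<longleftrightarrow> u 0 = 0 \<and> u N = T \<and> (\<forall>i<N. u i < u (Suc i))"

text \<open>Valued in \<open>[0, \<infinity>]\<close>, so that a finite upper bound includes finiteness of the supremum.\<close>

definition variation_norm :: "real \<Rightarrow> real \<Rightarrow> (real \<Rightarrow> 'b::real_normed_vector) \<Rightarrow> ennreal" where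
  "variation_norm r T Z = ennreal_powr
    (SUP (N, u) \<in> {(N, u). partition_points T N u}.
      ennreal (\<Sum>i<N. norm (Z (u (Suc i)) - Z (u i)) powr r)) (1 / r)"

end

theory Submission
  imports Defs
begin

text \<open>The rate is obtained by interpolation. Let \<open>e = Y\<^sup>n - Y\<close> and \<open>p < p'\<close>. Over any partition,
  \<open>\<Sum> |e\<^sub>v - e\<^sub>u|\<^bsup>p'\<^esup> \<le> (2 sup |e|)\<^bsup>p' - p\<^esup> \<Sum> |e\<^sub>v - e\<^sub>u|\<^bsup>p\<^esup>\<close>,
  so a uniform bound \<open>sup |e| \<le> C n\<^bsup>-a\<^esup>\<close> together with a bound on the \<open>p\<close>-variation of \<open>e\<close> that is uniform
  in \<open>n\<close> gives the rate \<open>n\<^bsup>-a(1 - p/p')\<^esup>\<close> (\<open>variation_interpolation\<close>). Since \<open>\<beta> > 1 - 1/p\<close> and \<open>p > 2\<close>, both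
  \<open>2/p - \<beta> < 3/p - 1\<close> and \<open>1/p\<close> are below \<open>1/2\<close>. Hence there is \<open>a < 1/2\<close> with \<open>a \<ge> 2/p - \<beta>\<close> and
  \<open>a p \<ge> 1\<close>, and the rate obtained for it is at most the second term of the asserted bound.

  For such an \<open>a\<close> the two ingredients reduce to one. The solution \<open>Y\<close> is \<open>a\<close>-Hoelder, and two different grid
  points are at least \<open>T/n\<close> apart. If the error at the grid points is at most \<open>C n\<^bsup>-a\<^esup>\<close>, then the increments
  of \<open>Y\<^sup>n\<close> between grid points inherit the Hoelder bound of \<open>Y\<close> with a constant independent of \<open>n\<close>, and as
  \<open>a p \<ge> 1\<close> the \<open>p\<close>-variation stays bounded. What remains is the almost sure strong rate: for every \<open>a < 1/2\<close>
  there is a random constant \<open>C\<close> with \<open>|e| \<le> C n\<^bsup>-a\<^esup>\<close> at all grid points and for all \<open>n\<close> at once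
  (\<open>error_bound\<close>).

  All probabilistic input consists of exponential inequalities. For an Ito integral \<open>X = \<integral> H dW\<close> and adapted
  \<open>l\<^sub>j\<close>, \<open>S\<^sub>j\<close>, the exponential of
  \<open>\<Sum>\<^sub>j l\<^sub>j \<bullet> (X(t\<^sub>j\<^sub>+\<^sub>1) - X(t\<^sub>j) - S\<^sub>j (W(t\<^sub>j\<^sub>+\<^sub>1) - W(t\<^sub>j))) - |l\<^sub>j|\<^sup>2 \<integral> |S\<^sub>j - H\<^sub>r|\<^sup>2 dr\<close>
  has expectation at most 1 (\<open>exponential_ito_grid\<close>). For Brownian motion this is the Gaussian moment
  generating function (\<open>exponential_step\<close>); it passes to simple integrals by refining the partition and to Ito
  integrals by Fatou's lemma. If countably many exponents \<open>Z\<^sub>n\<^sub>,\<^sub>i\<close>, \<open>i \<le> n\<close>, satisfy such an inequality, then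
  \<open>\<Sum> n\<^sup>-\<^sup>3 exp Z\<^sub>n\<^sub>,\<^sub>i\<close> is integrable, hence almost surely \<open>Z\<^sub>n\<^sub>,\<^sub>i \<le> S + 3 ln n\<close> with a random constant \<open>S\<close>
  (\<open>exponential_union_bound\<close>). The logarithm is beaten by every power of \<open>n\<close>. This yields Hoelder paths by
  dyadic chaining, a bound \<open>\<Sum> |\<Delta>W|\<^sup>2 \<le> S + \<kappa> ln n\<close> with \<open>\<kappa>\<close> arbitrarily small, and one-step remainders of size
  almost \<open>n\<^sup>-\<^sup>1\<close>.

  The Gronwall step works with \<open>ln (|e\<^sub>j|\<^sup>2 + \<delta>\<^sup>2)\<close> for a level \<open>\<delta> = n\<^bsup>-b\<^esup>\<close> with \<open>a < b < 1/2\<close>. Dividing by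
  \<open>|e\<^sub>j|\<^sup>2 + \<delta>\<^sup>2\<close> turns the Lipschitz coefficients into bounded ones, so the martingale part of the logarithm is
  subject to the exponential inequality and costs at most a random constant plus a small multiple of \<open>ln n\<close>.
  Exponentiating, \<open>|e\<^sub>j| \<le> C n\<^bsup>b - a\<^esup> \<delta> = C n\<^bsup>-a\<^esup>\<close> (\<open>stochastic_log_gronwall\<close>).

  The constant in the theorem has to be measurable although it is built from pathwise estimates. The notion
  \<open>random_bound\<close> takes care of this: once the basic constants are measurable, they may be rounded up to natural
  numbers, and any function of a natural number is measurable.\<close>

section \<open>Monotone sequences and operator-valued maps\<close>

lemma increasing_le:
  fixes w :: "nat \<Rightarrow> 'a::preorder"
  assumes "\<And>i. i < N \<Longrightarrow> w i \<le> w (Suc i)" "i \<le> j" "j \<le> N"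
  shows "w i \<le> w j"
  using assms(2,3) by (induction rule: dec_induct) (auto intro: order_trans[OF _ assms(1)])

text \<open>The operator norm is a supremum over a countable dense set of arguments. Measurability of the values
  \<open>A \<omega> x\<close>, unlike Borel measurability of \<open>A\<close>, passes to sums and differences of operator-valued maps without any
  countability assumption on the space of operators.\<close>

lemma borel_measurable_norm_blinfun:
  fixes A :: "'w \<Rightarrow> 'a::euclidean_space \<Rightarrow>\<^sub>L 'b::{euclidean_space}"
  assumes meas: "\<And>x. (\<lambda>\<omega>. blinfun_apply (A \<omega>) x) \<in> borel_measurable N"
  shows "(\<lambda>\<omega>. norm (A \<omega>)) \<in> borel_measurable N"
proof -
  obtain D :: "'a set" where D: "countable D" "\<And>X. open X \<Longrightarrow> X \<noteq> {} \<Longrightarrow> \<exists>d\<in>D. d \<in> X"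
    using countable_dense_exists by blast
  have cl: "closure D = UNIV"
    using D(2)[of "- closure D"] closure_subset[of D] by fastforce
  have iff: "norm (A \<omega>) \<le> a \<longleftrightarrow> 0 \<le> a \<and> (\<forall>x\<in>D. norm (A \<omega> x) \<le> a * norm x)" for \<omega> a
  proof safe
    fix x
    show "norm (A \<omega> x) \<le> a * norm x" if "norm (A \<omega>) \<le> a"
      using norm_blinfun[of "A \<omega>" x] mult_right_mono[OF that, of "norm x"] by simp
    show "0 \<le> a" if "norm (A \<omega>) \<le> a" using that norm_ge_zero order_trans by blast
  next
    assume a: "0 \<le> a" and le: "\<forall>x\<in>D. norm (A \<omega> x) \<le> a * norm x"
    have "closed {x. norm (A \<omega> x) \<le> a * norm x}"
      by (intro closed_Collect_le continuous_intros)
    then have "closure D \<subseteq> {x. norm (A \<omega> x) \<le> a * norm x}"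
      using le by (intro closure_minimal) auto
    then have "norm (A \<omega> x) \<le> a * norm x" for x using cl by auto
    then show "norm (A \<omega>) \<le> a" using a by (intro norm_blinfun_bound)
  qed
  have "{\<omega>\<in>space N. norm (A \<omega>) \<le> a} \<in> sets N" for a
  proof -
    have ne: "D \<noteq> {}" using D(2)[of UNIV] by auto
    have "(\<Inter>x\<in>D. {\<omega>\<in>space N. norm (A \<omega> x) \<le> a * norm x}) \<in> sets N"
    proof (rule sets.countable_INT'[OF D(1) ne], safe)
      fix x assume "x \<in> D"
      show "{\<omega>\<in>space N. norm (A \<omega> x) \<le> a * norm x} \<in> sets N"
        using meas[of x] by measurable
    qed
    moreover have "(\<Inter>x\<in>D. {\<omega>\<in>space N. norm (A \<omega> x) \<le> a * norm x}) = {\<omega>\<in>space N. \<forall>x\<in>D. norm (A \<omega> x) \<le> a * norm x}"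
      using ne by auto
    ultimately have "{\<omega>\<in>space N. \<forall>x\<in>D. norm (A \<omega> x) \<le> a * norm x} \<in> sets N"
      by simp
    then show ?thesis unfolding iff by (cases "0 \<le> a") auto
  qed
  then show ?thesis by (subst borel_measurable_iff_le) auto
qed

lemma borel_measurable_blinfun_apply_const:
  fixes A :: "'w \<Rightarrow> 'a::real_normed_vector \<Rightarrow>\<^sub>L 'b::real_normed_vector"
  assumes "A \<in> borel_measurable N"
  shows "(\<lambda>\<omega>. blinfun_apply (A \<omega>) x) \<in> borel_measurable N"
proof -
  have "continuous_on UNIV (\<lambda>B. blinfun_apply B x :: 'b)" by (intro continuous_intros)
  then show ?thesis
    using borel_measurable_continuous_onI assms measurable_compose by blast
qed

section \<open>Exponential martingales of Brownian motion\<close>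

text \<open>Completing the square: tilting the density of \<open>N(0, s\<^sup>2)\<close> by \<open>exp (a x)\<close> gives the density of
  \<open>N(a s\<^sup>2, s\<^sup>2)\<close> up to the factor on the right.\<close>

lemma normal_mgf:
  assumes "0 < s"
  shows "(\<integral>\<^sup>+x. ennreal (normal_density 0 s x) * ennreal (exp (a * x)) \<partial>lborel) = ennreal (exp (a\<^sup>2 * s\<^sup>2 / 2))"
proof -
  have eq: "normal_density 0 s x * exp (a * x) = exp (a\<^sup>2 * s\<^sup>2 / 2) * normal_density (a * s\<^sup>2) s x" for x
  proof -
    have "- x\<^sup>2 / (2 * s\<^sup>2) + a * x = a\<^sup>2 * s\<^sup>2 / 2 + - (x - a * s\<^sup>2)\<^sup>2 / (2 * s\<^sup>2)"
      using assms by (simp add: field_simps power2_eq_square)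
    then have "exp (- x\<^sup>2 / (2 * s\<^sup>2)) * exp (a * x) = exp (a\<^sup>2 * s\<^sup>2 / 2) * exp (- (x - a * s\<^sup>2)\<^sup>2 / (2 * s\<^sup>2))"
      unfolding exp_add[symmetric] by simp
    then show ?thesis by (simp add: normal_density_def)
  qed
  interpret N: prob_space "density lborel (normal_density (a * s\<^sup>2) s)"
    by (rule prob_space_normal_density[OF assms])
  have one: "(\<integral>\<^sup>+x. ennreal (normal_density (a * s\<^sup>2) s x) \<partial>lborel) = 1"
    using N.emeasure_space_1 by (simp add: emeasure_density)
  have "(\<integral>\<^sup>+x. ennreal (normal_density 0 s x) * ennreal (exp (a * x)) \<partial>lborel)
      = (\<integral>\<^sup>+x. ennreal (exp (a\<^sup>2 * s\<^sup>2 / 2)) * ennreal (normal_density (a * s\<^sup>2) s x) \<partial>lborel)"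
    by (intro nn_integral_cong) (simp add: ennreal_mult[symmetric] eq)
  also have "\<dots> = ennreal (exp (a\<^sup>2 * s\<^sup>2 / 2))"
    by (subst nn_integral_cmult) (auto simp: one)
  finally show ?thesis .
qed

context usual_filtered_prob_space
begin

lemma measurable_F_M:
  assumes "f \<in> measurable (F s) N" "0 \<le> s" "s \<le> T"
  shows "f \<in> measurable M N"
  using measurable_from_subalg[OF subalgebra_F assms(1)] assms(2,3) by simp

lemma space_F: "0 \<le> s \<Longrightarrow> s \<le> T \<Longrightarrow> space (F s) = space M"
  using subalgebra_F[of s] unfolding subalgebra_def by simp

lemma measurable_F_mono:
  assumes "f \<in> measurable (F s) N" "0 \<le> s" "s \<le> t" "t \<le> T"
  shows "f \<in> measurable (F t) N"
proof (rule measurable_from_subalg[OF _ assms(1)])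
  show "subalgebra (F t) (F s)"
    unfolding subalgebra_def using sets_F_mono[of s t] space_F assms by auto
qed

end

context brownian_motion
begin

lemma W_meas_F: "0 \<le> s \<Longrightarrow> s \<le> T \<Longrightarrow> W s \<in> borel_measurable (F s)"
  using W_adapted unfolding adapted_def by simp

lemma W_meas: "0 \<le> s \<Longrightarrow> s \<le> T \<Longrightarrow> W s \<in> borel_measurable M"
  using W_meas_F measurable_F_M by blast

lemma mgf_increment:
  assumes "0 \<le> s" "s < t" "t \<le> T"
  shows "(\<integral>\<^sup>+\<omega>. ennreal (exp (g \<bullet> (W t \<omega> - W s \<omega>))) \<partial>M) = ennreal (exp ((norm g)\<^sup>2 * (t - s) / 2))"
proof -
  let ?X = "\<lambda>i \<omega>. (W t \<omega> - W s \<omega>) $ i"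
  have ind: "indep_vars (\<lambda>_. borel) (\<lambda>i. (\<lambda>x. ennreal (exp (g $ i * x))) \<circ> ?X i) UNIV"
    by (rule indep_vars_compose[OF W_indep_coords[OF assms]]) simp
  have "(\<integral>\<^sup>+\<omega>. ennreal (exp (g \<bullet> (W t \<omega> - W s \<omega>))) \<partial>M)
      = (\<integral>\<^sup>+\<omega>. (\<Prod>i\<in>UNIV. ((\<lambda>x. ennreal (exp (g $ i * x))) \<circ> ?X i) \<omega>) \<partial>M)"
    by (intro nn_integral_cong) (simp add: inner_vec_def exp_sum prod_ennreal)
  also have "\<dots> = (\<Prod>i\<in>UNIV. \<integral>\<^sup>+\<omega>. ((\<lambda>x. ennreal (exp (g $ i * x))) \<circ> ?X i) \<omega> \<partial>M)"
    by (rule indep_vars_nn_integral[OF _ ind]) auto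
  also have "\<dots> = (\<Prod>i\<in>UNIV. ennreal (exp ((g $ i)\<^sup>2 * (t - s) / 2)))"
  proof (rule prod.cong[OF refl])
    fix i
    have "(\<integral>\<^sup>+\<omega>. ennreal (exp (g $ i * ?X i \<omega>)) \<partial>M)
      = (\<integral>\<^sup>+x. ennreal (normal_density 0 (sqrt (t - s)) x) * ennreal (exp (g $ i * x)) \<partial>lborel)"
      by (rule distributed_nn_integral[OF W_normal[OF assms], symmetric]) simp
    also have "\<dots> = ennreal (exp ((g $ i)\<^sup>2 * (t - s) / 2))"
      using normal_mgf[of "sqrt (t - s)" "g $ i"] assms by simp
    finally show "(\<integral>\<^sup>+\<omega>. ((\<lambda>x. ennreal (exp (g $ i * x))) \<circ> ?X i) \<omega> \<partial>M) = ennreal (exp ((g $ i)\<^sup>2 * (t - s) / 2))"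
      by (simp add: comp_def)
  qed
  also have "\<dots> = ennreal (exp ((norm g)\<^sup>2 * (t - s) / 2))"
  proof -
    have "(norm g)\<^sup>2 = (\<Sum>i\<in>UNIV. (g $ i)\<^sup>2)"
      unfolding power2_norm_eq_inner inner_vec_def by (simp add: power2_eq_square)
    then have "(norm g)\<^sup>2 * (t - s) / 2 = (\<Sum>i\<in>UNIV. (g $ i)\<^sup>2 * (t - s) / 2)"
      by (simp add: sum_distrib_right sum_divide_distrib)
    then show ?thesis by (simp add: prod_ennreal exp_sum)
  qed
  finally show ?thesis .
qed

text \<open>The increment is independent of the past, so conditionally on \<open>g\<close> the Gaussian moment generating
  function compensates the exponential exactly. The past enters through an arbitrary weight \<open>U\<close>, which makes it
  possible to iterate the identity without conditional expectations; with values in \<open>[0, \<infinity>]\<close> no integrability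
  has to be checked along the way.\<close>

lemma exponential_step:
  assumes st: "0 \<le> s" "s \<le> t" "t \<le> T"
    and U: "U \<in> borel_measurable (F s)" and g: "g \<in> borel_measurable (F s)"
  shows "(\<integral>\<^sup>+\<omega>. U \<omega> * ennreal (exp (g \<omega> \<bullet> (W t \<omega> - W s \<omega>) - (norm (g \<omega>))\<^sup>2 * (t - s) / 2)) \<partial>M)
    = (\<integral>\<^sup>+\<omega>. U \<omega> \<partial>M)"
proof (cases "s = t")
  case True
  then show ?thesis by simp
next
  case False
  with st have lt: "s < t" by simp
  let ?D = "\<lambda>\<omega>. W t \<omega> - W s \<omega>"
  let ?X = "\<lambda>\<omega>. (U \<omega>, g \<omega>)" and ?Y = "\<lambda>\<omega>. (0 :: ennreal, ?D \<omega>)"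
  let ?B = "borel \<Otimes>\<^sub>M borel :: (ennreal \<times> (real^'d)) measure"
  have [measurable]: "U \<in> borel_measurable M" "g \<in> borel_measurable M"
    using measurable_F_M[OF U] measurable_F_M[OF g] st by auto
  have [measurable]: "?D \<in> borel_measurable M"
    using W_meas st lt by (intro borel_measurable_diff) auto
  have XF: "?X \<in> measurable (F s) ?B" using U g by measurable
  have ind0: "indep_set {?X -` A \<inter> space M | A. A \<in> sets ?B} {?Y -` A \<inter> space M | A. A \<in> sets ?B}"
    using W_indep[OF st(1) lt st(3)] unfolding indep_set_def
  proof (rule indep_sets_mono_sets)
    have "?X -` A \<inter> space M \<in> sets (F s)" if "A \<in> sets ?B" for A
      using measurable_sets[OF XF that] st space_F[of s] by auto
    moreover have "\<exists>A'. ?Y -` A \<inter> space M = ?D -` A' \<inter> space M \<and> A' \<in> sets borel" if "A \<in> sets ?B" for A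
      by (rule exI[of _ "Pair 0 -` A"]) (use sets_Pair1[OF that, of 0] in auto)
    ultimately show "(case i of True \<Rightarrow> {?X -` A \<inter> space M | A. A \<in> sets ?B} | False \<Rightarrow> {?Y -` A \<inter> space M | A. A \<in> sets ?B})
        \<subseteq> (case i of True \<Rightarrow> sets (F s) | False \<Rightarrow> {?D -` A \<inter> space M | A. A \<in> sets borel})" for i
      by (cases i) auto
  qed
  have stable: "Int_stable {h -` A \<inter> space M |A. A \<in> sets ?B}" for h
  proof (rule Int_stableI, safe)
    fix A B assume "A \<in> sets ?B" "B \<in> sets ?B"
    then show "\<exists>C. h -` A \<inter> space M \<inter> (h -` B \<inter> space M) = h -` C \<inter> space M \<and> C \<in> sets ?B"
      by (intro exI[of _ "A \<inter> B"]) auto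
  qed
  have ind: "indep_var ?B ?X ?B ?Y"
    unfolding indep_var_eq using indep_set_sigma_sets[OF ind0 stable stable] by simp
  let ?f = "\<lambda>(z :: ennreal \<times> (real^'d), y :: ennreal \<times> (real^'d)).
      fst z * ennreal (exp (snd z \<bullet> snd y - (norm (snd z))\<^sup>2 * (t - s) / 2)) :: ennreal"
  interpret PD: prob_space "distr M ?B ?Y" by (rule prob_space_distr) simp
  have "(\<integral>\<^sup>+\<omega>. U \<omega> * ennreal (exp (g \<omega> \<bullet> ?D \<omega> - (norm (g \<omega>))\<^sup>2 * (t - s) / 2)) \<partial>M)
     = (\<integral>\<^sup>+y. ?f y \<partial>distr M (?B \<Otimes>\<^sub>M ?B) (\<lambda>\<omega>. (?X \<omega>, ?Y \<omega>)))"
    by (subst nn_integral_distr) (auto simp: case_prod_beta')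
  also have "\<dots> = (\<integral>\<^sup>+y. ?f y \<partial>(distr M ?B ?X \<Otimes>\<^sub>M distr M ?B ?Y))"
    using ind[unfolded indep_var_distribution_eq] by simp
  also have "\<dots> = (\<integral>\<^sup>+z. \<integral>\<^sup>+y. ?f (z, y) \<partial>distr M ?B ?Y \<partial>distr M ?B ?X)"
    by (rule PD.nn_integral_fst[symmetric]) (simp add: case_prod_beta')
  also have "\<dots> = (\<integral>\<^sup>+z. fst z \<partial>distr M ?B ?X)"
  proof (rule nn_integral_cong)
    fix z :: "ennreal \<times> (real^'d)"
    let ?v = "snd z"
    let ?a = "exp (- ((norm ?v)\<^sup>2 * (t - s) / 2))"
    have "(\<integral>\<^sup>+y. ?f (z, y) \<partial>distr M ?B ?Y)
      = (\<integral>\<^sup>+y. (fst z * ennreal ?a) * ennreal (exp (?v \<bullet> snd y)) \<partial>distr M ?B ?Y)"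
    proof (rule nn_integral_cong)
      fix y :: "ennreal \<times> (real^'d)"
      have "exp (?v \<bullet> snd y - (norm ?v)\<^sup>2 * (t - s) / 2) = ?a * exp (?v \<bullet> snd y)"
        unfolding exp_add[symmetric] by simp
      then show "?f (z, y) = (fst z * ennreal ?a) * ennreal (exp (?v \<bullet> snd y))"
        by (simp add: ennreal_mult mult.assoc)
    qed
    also have "\<dots> = (fst z * ennreal ?a) * ennreal (exp ((norm ?v)\<^sup>2 * (t - s) / 2))"
      using mgf_increment[OF st(1) lt st(3), of ?v] by (simp add: nn_integral_cmult nn_integral_distr)
    also have "\<dots> = fst z"
      unfolding mult.assoc ennreal_mult[OF exp_ge_zero exp_ge_zero, symmetric] exp_add[symmetric] by simp
    finally show "(\<integral>\<^sup>+y. ?f (z, y) \<partial>distr M ?B ?Y) = fst z" .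
  qed
  also have "\<dots> = (\<integral>\<^sup>+\<omega>. U \<omega> \<partial>M)"
    by (subst nn_integral_distr) auto
  finally show ?thesis .
qed

lemma exponential_chain:
  fixes c :: "nat \<Rightarrow> real"
  assumes c: "0 \<le> c 0" "\<And>i. i < N \<Longrightarrow> c i \<le> c (Suc i)" "c N \<le> T"
    and U: "U \<in> borel_measurable (F (c 0))"
    and g: "\<And>i. i < N \<Longrightarrow> g i \<in> borel_measurable (F (c i))"
  shows "(\<integral>\<^sup>+\<omega>. U \<omega> * ennreal (exp (\<Sum>i<N. g i \<omega> \<bullet> (W (c (Suc i)) \<omega> - W (c i) \<omega>)
      - (norm (g i \<omega>))\<^sup>2 * (c (Suc i) - c i) / 2)) \<partial>M) = (\<integral>\<^sup>+\<omega>. U \<omega> \<partial>M)"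
proof -
  let ?S = "\<lambda>n \<omega>. \<Sum>i<n. g i \<omega> \<bullet> (W (c (Suc i)) \<omega> - W (c i) \<omega>)
      - (norm (g i \<omega>))\<^sup>2 * (c (Suc i) - c i) / 2"
  have mono: "i \<le> j \<Longrightarrow> j \<le> N \<Longrightarrow> c i \<le> c j" for i j
    by (rule increasing_le[of N c, OF c(2)])
  have "n \<le> N \<Longrightarrow> (\<integral>\<^sup>+\<omega>. U \<omega> * ennreal (exp (?S n \<omega>)) \<partial>M) = (\<integral>\<^sup>+\<omega>. U \<omega> \<partial>M)" for n
  proof (induction n)
    case (Suc n)
    then have n: "n < N" by simp
    have cn: "0 \<le> c n" "c n \<le> c (Suc n)" "c (Suc n) \<le> T"
      using mono[of 0 n] mono[of "Suc n" N] c n by auto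
    have c0: "0 \<le> c i" "c i \<le> c n" if "i \<le> n" for i
      using mono[of 0 i] mono[of i n] c(1) that n by linarith+
    have cT: "c n \<le> T" using cn by linarith
    have gm: "g i \<in> borel_measurable (F (c n))" if "i \<le> n" for i
      by (rule measurable_F_mono[OF g c0[OF that] cT]) (use that n in linarith)
    have Wm: "W (c i) \<in> borel_measurable (F (c n))" if "i \<le> n" for i
      by (rule measurable_F_mono[OF W_meas_F c0[OF that] cT]) (use c0[OF that] cT in linarith)+
    have Um: "U \<in> borel_measurable (F (c n))"
      by (rule measurable_F_mono[OF U c0[of 0] cT]) simp_all
    have "(\<lambda>\<omega>. g i \<omega> \<bullet> (W (c (Suc i)) \<omega> - W (c i) \<omega>) - (norm (g i \<omega>))\<^sup>2 * (c (Suc i) - c i) / 2)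
        \<in> borel_measurable (F (c n))" if "i < n" for i
    proof -
      have [measurable]: "g i \<in> borel_measurable (F (c n))" "W (c i) \<in> borel_measurable (F (c n))"
        "W (c (Suc i)) \<in> borel_measurable (F (c n))" using gm Wm that by auto
      show ?thesis by measurable
    qed
    then have "?S n \<in> borel_measurable (F (c n))"
      by (intro borel_measurable_sum) auto
    then have US: "(\<lambda>\<omega>. U \<omega> * ennreal (exp (?S n \<omega>))) \<in> borel_measurable (F (c n))"
      using Um by measurable
    have "(\<integral>\<^sup>+\<omega>. U \<omega> * ennreal (exp (?S (Suc n) \<omega>)) \<partial>M)
        = (\<integral>\<^sup>+\<omega>. (U \<omega> * ennreal (exp (?S n \<omega>))) *
            ennreal (exp (g n \<omega> \<bullet> (W (c (Suc n)) \<omega> - W (c n) \<omega>) - (norm (g n \<omega>))\<^sup>2 * (c (Suc n) - c n) / 2)) \<partial>M)"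
      by (intro nn_integral_cong) (simp only: sum.lessThan_Suc exp_add ennreal_mult exp_ge_zero mult.assoc)
    also have "\<dots> = (\<integral>\<^sup>+\<omega>. U \<omega> * ennreal (exp (?S n \<omega>)) \<partial>M)"
      by (rule exponential_step[OF cn US gm]) simp
    finally show ?case using Suc by simp
  qed simp
  from this[of N] show ?thesis by simp
qed

end

section \<open>Exponential inequality for Ito integrals\<close>

text \<open>The squared \<open>L\<^sup>2\<close>-distance on \<open>[s, t]\<close> between the integrand \<open>H\<close> and an integrand \<open>S\<close> that is constant
  in time. As \<open>enn2real \<infinity> = 0\<close>, it is meaningful only when the integral is finite, for instance for bounded \<open>H\<close>.\<close>

definition energy :: "(real \<Rightarrow> 'w \<Rightarrow> 'b::real_normed_vector) \<Rightarrow> ('w \<Rightarrow> 'b) \<Rightarrow> real \<Rightarrow> real \<Rightarrow> 'w \<Rightarrow> real" where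
  "energy H S s t \<omega> = enn2real (\<integral>\<^sup>+r\<in>{s..t}. ennreal ((norm (S \<omega> - H r \<omega>))\<^sup>2) \<partial>lborel)"

lemma borel_measurable_blinfun_apply:
  fixes A :: "'w \<Rightarrow> 'a::euclidean_space \<Rightarrow>\<^sub>L 'b::euclidean_space"
  assumes A: "\<And>x. (\<lambda>\<omega>. blinfun_apply (A \<omega>) x) \<in> borel_measurable N"
    and V: "V \<in> borel_measurable N"
  shows "(\<lambda>\<omega>. blinfun_apply (A \<omega>) (V \<omega>)) \<in> borel_measurable N"
proof -
  have "(\<lambda>\<omega>. blinfun_apply (A \<omega>) (V \<omega>)) = (\<lambda>\<omega>. \<Sum>b\<in>Basis. (V \<omega> \<bullet> b) *\<^sub>R blinfun_apply (A \<omega>) b)"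
  proof
    fix \<omega>
    have "blinfun_apply (A \<omega>) (V \<omega>) = blinfun_apply (A \<omega>) (\<Sum>b\<in>Basis. (V \<omega> \<bullet> b) *\<^sub>R b)"
      by (simp add: euclidean_representation)
    then show "blinfun_apply (A \<omega>) (V \<omega>) = (\<Sum>b\<in>Basis. (V \<omega> \<bullet> b) *\<^sub>R blinfun_apply (A \<omega>) b)"
      by (simp add: blinfun.sum_right blinfun.scaleR_right)
  qed
  then show ?thesis using A V by simp
qed

text \<open>The sum is the adjoint of \<open>A\<close> applied to \<open>l\<close>, written in coordinates because in this form it is measurable
  in a parameter.\<close>

lemma blinfun_adjoint:
  fixes A :: "'a::euclidean_space \<Rightarrow>\<^sub>L 'b::real_inner"
  defines "g \<equiv> \<lambda>l. \<Sum>b\<in>Basis. (l \<bullet> blinfun_apply A b) *\<^sub>R b"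
  shows "g l \<bullet> x = l \<bullet> blinfun_apply A x" "norm (g l) \<le> norm l * norm A"
proof -
  have adj: "g l \<bullet> x = l \<bullet> blinfun_apply A x" for x
  proof -
    have "blinfun_apply A x = blinfun_apply A (\<Sum>b\<in>Basis. (x \<bullet> b) *\<^sub>R b)"
      by (simp add: euclidean_representation)
    then show ?thesis unfolding g_def
      by (simp add: blinfun.sum_right blinfun.scaleR_right inner_sum_left inner_sum_right inner_commute mult.commute)
  qed
  show "g l \<bullet> x = l \<bullet> blinfun_apply A x" by (rule adj)
  have "norm (g l) * norm (g l) = l \<bullet> blinfun_apply A (g l)"
    using adj[of "g l"] by (simp add: power2_norm_eq_inner[symmetric] power2_eq_square)
  also have "\<dots> \<le> norm l * norm (blinfun_apply A (g l))" by (rule norm_cauchy_schwarz)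
  also have "\<dots> \<le> norm l * (norm A * norm (g l))"
    by (intro mult_left_mono norm_blinfun) simp
  finally have "norm (g l) * norm (g l) \<le> (norm l * norm A) * norm (g l)" by (simp add: mult.assoc)
  then show "norm (g l) \<le> norm l * norm A"
    by (cases "g l = 0") auto
qed

text \<open>Tonelli's theorem, for integrands that are jointly measurable only up to time \<open>t\<close>, as progressive processes
  are.\<close>

lemma nn_integral_interval_measurable:
  assumes f: "(\<lambda>(r, \<omega>). f r \<omega>) \<in> borel_measurable (restrict_space borel {0..t} \<Otimes>\<^sub>M N)" and s: "0 \<le> (s::real)"
  shows "(\<lambda>\<omega>. \<integral>\<^sup>+r\<in>{s..t}. f r \<omega> \<partial>lborel) \<in> borel_measurable N"
proof -
  let ?L = "restrict_space lborel {0..t}"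
  interpret L: finite_measure ?L
    by (rule finite_measureI) (simp add: emeasure_restrict_space emeasure_lborel_Icc_eq)
  have sL: "sets ?L = sets (restrict_space borel {0..t})" by (simp add: sets_restrict_space)
  have m: "(\<lambda>(\<omega>, r). f r \<omega> * indicator {s..t} r) \<in> borel_measurable (N \<Otimes>\<^sub>M ?L)"
  proof -
    have fm: "(\<lambda>p. f (fst p) (snd p)) \<in> borel_measurable (?L \<Otimes>\<^sub>M N)"
      using f by (subst measurable_cong_sets[OF sets_pair_measure_cong[OF sL refl] refl]) (simp add: case_prod_beta')
    have "(\<lambda>p. f (snd p) (fst p)) \<in> borel_measurable (N \<Otimes>\<^sub>M ?L)"
      using measurable_compose[OF measurable_pair_swap' fm] by (simp add: case_prod_beta')
    moreover have "(\<lambda>p. indicator {s..t} (snd p) :: ennreal) \<in> borel_measurable (N \<Otimes>\<^sub>M ?L)"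
    proof (rule measurable_compose[OF measurable_snd])
      show "indicator {s..t} \<in> borel_measurable ?L" by (intro measurable_restrict_space1) simp
    qed
    ultimately show ?thesis by (simp add: case_prod_beta')
  qed
  have "(\<lambda>\<omega>. \<integral>\<^sup>+r. f r \<omega> * indicator {s..t} r \<partial>?L) \<in> borel_measurable N"
    using L.borel_measurable_nn_integral[OF m] by simp
  moreover have "(\<integral>\<^sup>+r. f r \<omega> * indicator {s..t} r \<partial>?L) = (\<integral>\<^sup>+r\<in>{s..t}. f r \<omega> \<partial>lborel)" for \<omega>
    using s by (subst nn_integral_restrict_space) (auto intro!: nn_integral_cong split: split_indicator)
  ultimately show ?thesis by simp
qed

lemma progressive_norm_diff_measurable:
  fixes H :: "real \<Rightarrow> 'w \<Rightarrow> 'a::euclidean_space \<Rightarrow>\<^sub>L 'b::euclidean_space"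
  assumes H: "(\<lambda>(r, \<omega>). H r \<omega>) \<in> borel_measurable (R \<Otimes>\<^sub>M N)"
    and G: "\<And>x. (\<lambda>(r, \<omega>). blinfun_apply (G r \<omega>) x) \<in> borel_measurable (R \<Otimes>\<^sub>M N)"
  shows "(\<lambda>(r, \<omega>). ennreal ((norm (G r \<omega> - H r \<omega>))\<^sup>2)) \<in> borel_measurable (R \<Otimes>\<^sub>M N)"
proof -
  have "(\<lambda>p. norm (G (fst p) (snd p) - H (fst p) (snd p))) \<in> borel_measurable (R \<Otimes>\<^sub>M N)"
  proof (rule borel_measurable_norm_blinfun)
    fix x
    have "(\<lambda>p. blinfun_apply (H (fst p) (snd p)) x) \<in> borel_measurable (R \<Otimes>\<^sub>M N)"
      using H by (intro borel_measurable_blinfun_apply_const) (simp add: case_prod_beta')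
    then show "(\<lambda>p. blinfun_apply (G (fst p) (snd p) - H (fst p) (snd p)) x) \<in> borel_measurable (R \<Otimes>\<^sub>M N)"
      using G[of x] by (simp add: blinfun.diff_left case_prod_beta')
  qed
  then show ?thesis by (simp add: case_prod_beta')
qed

lemma simple_process_measurable:
  fixes \<xi> :: "nat \<Rightarrow> 'w \<Rightarrow> 'a::euclidean_space \<Rightarrow>\<^sub>L 'b::euclidean_space"
  assumes "\<And>i. i < N \<Longrightarrow> \<xi> i \<in> borel_measurable M"
  shows "(\<lambda>(r, \<omega>). blinfun_apply (simple_process N \<tau> \<xi> r \<omega>) x) \<in> borel_measurable (restrict_space borel A \<Otimes>\<^sub>M M)"
proof -
  have "(\<lambda>p. (indicator {\<tau> i<..\<tau> (Suc i)} (fst p) :: real) *\<^sub>R blinfun_apply (\<xi> i (snd p)) x)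
      \<in> borel_measurable (restrict_space borel A \<Otimes>\<^sub>M M)" if "i < N" for i
  proof (rule borel_measurable_scaleR)
    show "(\<lambda>p. indicator {\<tau> i<..\<tau> (Suc i)} (fst p) :: real) \<in> borel_measurable (restrict_space borel A \<Otimes>\<^sub>M M)"
      by (rule measurable_compose[OF measurable_fst]) (intro measurable_restrict_space1, simp)
    show "(\<lambda>p. blinfun_apply (\<xi> i (snd p)) x) \<in> borel_measurable (restrict_space borel A \<Otimes>\<^sub>M M)"
      by (rule measurable_compose[OF measurable_snd borel_measurable_blinfun_apply_const[OF assms[OF that]]])
  qed
  then have "(\<lambda>p. \<Sum>i<N. (indicator {\<tau> i<..\<tau> (Suc i)} (fst p) :: real) *\<^sub>R blinfun_apply (\<xi> i (snd p)) x)
      \<in> borel_measurable (restrict_space borel A \<Otimes>\<^sub>M M)"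
    by (intro borel_measurable_sum) auto
  then show ?thesis
    unfolding simple_process_def case_prod_beta' blinfun.sum_left blinfun.scaleR_left .
qed

lemma simple_process_eq:
  assumes mono: "\<And>i. i < N \<Longrightarrow> \<tau> i < \<tau> (Suc i)" and j: "j < N" and r: "\<tau> j < r" "r \<le> \<tau> (Suc j)"
  shows "simple_process N \<tau> \<xi> r \<omega> = \<xi> j \<omega>"
proof -
  have le: "a \<le> b \<Longrightarrow> b \<le> N \<Longrightarrow> \<tau> a \<le> \<tau> b" for a b
    by (rule increasing_le[of N \<tau>, OF less_imp_le[OF mono]])
  have "indicator {\<tau> i<..\<tau> (Suc i)} r *\<^sub>R \<xi> i \<omega> = (if i = j then \<xi> j \<omega> else 0)" if "i < N" for i
  proof -
    consider "i = j" | "Suc i \<le> j" | "Suc j \<le> i" by linarith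
    then show ?thesis
      using le[of "Suc i" j] le[of "Suc j" i] j r that by cases auto
  qed
  then have "simple_process N \<tau> \<xi> r \<omega> = (\<Sum>i<N. if i = j then \<xi> j \<omega> else 0)"
    unfolding simple_process_def by (intro sum.cong) auto
  then show ?thesis using j by simp
qed

lemma simple_process_eq_0:
  assumes mono: "\<And>i. i < N \<Longrightarrow> \<tau> i < \<tau> (Suc i)" and r: "r \<le> \<tau> 0 \<or> \<tau> N < r"
  shows "simple_process N \<tau> \<xi> r \<omega> = 0"
proof -
  have le: "a \<le> b \<Longrightarrow> b \<le> N \<Longrightarrow> \<tau> a \<le> \<tau> b" for a b
    by (rule increasing_le[of N \<tau>, OF less_imp_le[OF mono]])
  have "indicator {\<tau> i<..\<tau> (Suc i)} r *\<^sub>R \<xi> i \<omega> = 0" if "i < N" for i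
    using le[of 0 i] le[of "Suc i" N] r that by auto
  then show ?thesis unfolding simple_process_def by (intro sum.neutral) auto
qed

lemma energy_le:
  assumes "s \<le> t" "0 \<le> B" "\<And>r. r \<in> {s..t} \<Longrightarrow> norm (S \<omega> - H r \<omega>) \<le> B"
  shows "energy H S s t \<omega> \<le> B\<^sup>2 * (t - s)"
proof -
  have "(\<integral>\<^sup>+r\<in>{s..t}. ennreal ((norm (S \<omega> - H r \<omega>))\<^sup>2) \<partial>lborel) \<le> (\<integral>\<^sup>+r\<in>{s..t}. ennreal (B\<^sup>2) \<partial>lborel)"
    using assms(3) by (intro nn_integral_mono) (auto split: split_indicator intro!: ennreal_leI power_mono)
  also have "\<dots> = ennreal (B\<^sup>2 * (t - s))"
    using assms(1) by (simp add: nn_integral_cmult_indicator ennreal_mult)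
  finally show ?thesis
    unfolding energy_def using assms by (intro enn2real_leI) auto
qed

text \<open>Convergence in probability of finitely many sequences gives almost sure convergence along one common
  subsequence, by the Borel-Cantelli lemma.\<close>

lemma (in prob_space) AE_fast_subsequence:
  fixes f :: "'i \<Rightarrow> nat \<Rightarrow> 'a \<Rightarrow> ennreal"
  assumes I: "finite I" and f: "\<And>i m. i \<in> I \<Longrightarrow> f i m \<in> borel_measurable M"
    and lim: "\<And>i \<delta>. i \<in> I \<Longrightarrow> 0 < \<delta> \<Longrightarrow> (\<lambda>m. measure M {\<omega>\<in>space M. f i m \<omega> > ennreal \<delta>}) \<longlonglongrightarrow> 0"
  obtains r :: "nat \<Rightarrow> nat" where "AE \<omega> in M. eventually (\<lambda>k. \<forall>i\<in>I. f i (r k) \<omega> \<le> ennreal ((1/2)^k)) sequentially"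
proof -
  define bad where "bad m \<delta> = (\<Union>i\<in>I. {\<omega>\<in>space M. f i m \<omega> > ennreal \<delta>})" for m \<delta>
  have sets_f: "{\<omega>\<in>space M. f i m \<omega> > ennreal \<delta>} \<in> sets M" if "i \<in> I" for i m \<delta>
    using f[OF that, of m] by measurable
  have sets_bad: "bad m \<delta> \<in> sets M" for m \<delta>
    unfolding bad_def using I sets_f by (intro sets.finite_UN) auto
  have "\<exists>m. measure M (bad m \<delta>) \<le> \<delta>" if \<delta>: "0 < \<delta>" for \<delta>
  proof -
    let ?\<epsilon> = "\<delta> / (real (card I) + 1)"
    have \<epsilon>: "0 < ?\<epsilon>" using \<delta> by (intro divide_pos_pos) auto
    have "eventually (\<lambda>m. \<forall>i\<in>I. measure M {\<omega>\<in>space M. f i m \<omega> > ennreal \<delta>} < ?\<epsilon>) sequentially"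
      using order_tendstoD(2)[OF lim[OF _ \<delta>] \<epsilon>] by (intro eventually_ball_finite[OF I]) auto
    then obtain m where m: "\<And>i. i \<in> I \<Longrightarrow> measure M {\<omega>\<in>space M. f i m \<omega> > ennreal \<delta>} < ?\<epsilon>"
      unfolding eventually_sequentially by blast
    have "measure M (bad m \<delta>) \<le> (\<Sum>i\<in>I. measure M {\<omega>\<in>space M. f i m \<omega> > ennreal \<delta>})"
      unfolding bad_def using I sets_f by (intro measure_UNION_le) auto
    also have "\<dots> \<le> (\<Sum>i\<in>I. ?\<epsilon>)" by (intro sum_mono less_imp_le m)
    also have "\<dots> \<le> \<delta>" using \<delta> by (simp add: field_simps)
    finally show ?thesis by blast
  qed
  then have "\<exists>m. measure M (bad m ((1/2)^k)) \<le> (1/2)^k" for k :: nat by simp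
  then obtain r where r: "\<And>k::nat. measure M (bad (r k) ((1/2)^k)) \<le> (1/2)^k" by metis
  have "summable (\<lambda>k. measure M (bad (r k) ((1/2)^k)))"
    by (rule summable_comparison_test[of _ "\<lambda>k. (1/2)^k"]) (use r in \<open>auto intro!: summable_geometric\<close>)
  then have "AE \<omega> in M. eventually (\<lambda>k. \<omega> \<in> space M - bad (r k) ((1/2)^k)) sequentially"
    by (intro borel_cantelli_AE1 sets_bad) (simp_all add: emeasure_eq_measure)
  then have "AE \<omega> in M. eventually (\<lambda>k. \<forall>i\<in>I. f i (r k) \<omega> \<le> ennreal ((1/2)^k)) sequentially"
  proof eventually_elim
    case (elim \<omega>)
    then show ?case by (rule eventually_mono) (auto simp: bad_def not_less)
  qed
  then show thesis by (rule that)
qed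

context usual_filtered_prob_space
begin

lemma energy_measurable:
  fixes H :: "real \<Rightarrow> 'w \<Rightarrow> 'a::euclidean_space \<Rightarrow>\<^sub>L 'b::euclidean_space"
  assumes prog: "progressive F T H" and S: "S \<in> borel_measurable (F s)" and st: "0 \<le> s" "s \<le> t" "t \<le> T"
  shows "energy H S s t \<in> borel_measurable (F t)"
proof -
  have Hm: "(\<lambda>(r, \<omega>). H r \<omega>) \<in> borel_measurable (restrict_space borel {0..t} \<Otimes>\<^sub>M F t)"
    using prog st unfolding progressive_def by auto
  have St: "S \<in> borel_measurable (F t)" by (rule measurable_F_mono[OF S st])
  have "(\<lambda>(r, \<omega>). ennreal ((norm (S \<omega> - H r \<omega>))\<^sup>2)) \<in> borel_measurable (restrict_space borel {0..t} \<Otimes>\<^sub>M F t)"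
    using measurable_compose[OF measurable_snd borel_measurable_blinfun_apply_const[OF St]]
    by (intro progressive_norm_diff_measurable[OF Hm]) (simp add: case_prod_beta')
  from nn_integral_interval_measurable[OF this st(1)] show ?thesis
    unfolding energy_def[abs_def] by measurable
qed

end

context brownian_motion
begin

text \<open>Inside \<open>[s, t]\<close> the simple integrand minus \<open>S\<close> is again piecewise constant and adapted, so this is the
  chain of exponential identities along the partition refined by \<open>s\<close> and \<open>t\<close>. Only an inequality remains because
  the norm of the adjoint is estimated by a product of norms.\<close>

lemma exponential_simple:
  fixes \<xi> :: "nat \<Rightarrow> 'w \<Rightarrow> (real^'d) \<Rightarrow>\<^sub>L (real^'k)" and S :: "'w \<Rightarrow> (real^'d) \<Rightarrow>\<^sub>L (real^'k)"
  assumes simple: "simple_integrand M F T N \<tau> \<xi>"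
    and st: "0 \<le> s" "s \<le> t" "t \<le> T"
    and U: "U \<in> borel_measurable (F s)" and l: "l \<in> borel_measurable (F s)"
    and S: "S \<in> borel_measurable (F s)"
  obtains Q :: "'w \<Rightarrow> real" where "Q \<in> borel_measurable M" "\<And>\<omega>. 0 \<le> Q \<omega>"
    "\<And>\<omega>. ennreal (Q \<omega>) \<le> (\<integral>\<^sup>+r\<in>{s..t}. ennreal ((norm (simple_process N \<tau> \<xi> r \<omega> - S \<omega>))\<^sup>2) \<partial>lborel)"
    "(\<integral>\<^sup>+\<omega>. U \<omega> * ennreal (exp (l \<omega> \<bullet> (simple_integral W N \<tau> \<xi> t \<omega> - simple_integral W N \<tau> \<xi> s \<omega>
        - blinfun_apply (S \<omega>) (W t \<omega> - W s \<omega>)) - (norm (l \<omega>))\<^sup>2 * Q \<omega> / 2)) \<partial>M) \<le> (\<integral>\<^sup>+\<omega>. U \<omega> \<partial>M)"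
proof -
  have \<tau>: "\<And>i. i \<le> N \<Longrightarrow> \<tau> i \<in> {0..T}" "\<And>i. i < N \<Longrightarrow> \<tau> i < \<tau> (Suc i)"
    and \<xi>: "\<And>i. i < N \<Longrightarrow> \<xi> i \<in> borel_measurable (F (\<tau> i))"
    using simple unfolding simple_integrand_def by auto
  (* The points s, then the partition clamped to [s, t], then t. Clamped intervals may be empty; there the
     coefficient is set to 0, since the original one need not be known at the left end point. *)
  define c where "c i = (if i = 0 then s else if i \<le> Suc N then max s (min (\<tau> (i - 1)) t) else t)" for i
  define \<xi>' where "\<xi>' i = (if i = 0 \<or> i > N \<or> \<not> c i < c (Suc i) then (\<lambda>_. 0) else \<xi> (i - 1))" for i
  define g where "g i \<omega> = (\<Sum>b\<in>Basis. (l \<omega> \<bullet> blinfun_apply (\<xi>' i \<omega> - S \<omega>) b) *\<^sub>R b)" for i \<omega>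
  define Q where "Q \<omega> = (\<Sum>i<N + 2. (norm (\<xi>' i \<omega> - S \<omega>))\<^sup>2 * (c (Suc i) - c i))" for \<omega>
  have c_mono: "c i \<le> c (Suc i)" for i
  proof -
    consider "i = 0" | "1 \<le> i" "i < Suc N" | "i = Suc N" | "i > Suc N" by linarith
    then show ?thesis
    proof cases
      case 2
      then obtain j where j: "i = Suc j" "j < N" by (cases i) auto
      then show ?thesis using \<tau>(2)[of j] st by (simp add: c_def)
    qed (use st in \<open>auto simp: c_def\<close>)
  qed
  have c_le: "i \<le> j \<Longrightarrow> c i \<le> c j" for i j by (rule lift_Suc_mono_le[of c]) (use c_mono in auto)
  have c_ge: "s \<le> c i" for i using c_le[of 0 i] by (simp add: c_def)
  have c_t: "c i \<le> t" for i using st by (auto simp: c_def)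
  have Ft: "f \<in> borel_measurable (F (c i))" if "f \<in> borel_measurable (F s)" for f :: "'w \<Rightarrow> 'z::topological_space" and i
    by (rule measurable_F_mono[OF that st(1) c_ge]) (use c_t[of i] st in linarith)
  have \<xi>'m: "\<xi>' i \<in> borel_measurable (F (c i))" for i
  proof (cases "i = 0 \<or> i > N \<or> \<not> c i < c (Suc i)")
    case False
    then obtain j where j: "i = Suc j" "j < N" by (cases i) auto
    have "\<tau> j \<le> c i" using False j by (auto simp: c_def max_def min_def split: if_splits)
    then have "\<xi> j \<in> borel_measurable (F (c i))"
      using \<tau>(1)[of j] c_t[of i] st j by (intro measurable_F_mono[OF \<xi>[OF j(2)]]) auto
    then show ?thesis using False j by (simp add: \<xi>'_def)
  qed (simp add: \<xi>'_def)
  have ms: "(\<lambda>\<omega>. blinfun_apply (\<xi>' i \<omega> - S \<omega>) x) \<in> borel_measurable (F (c i))" for i x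
  proof -
    have "(\<lambda>\<omega>. blinfun_apply (\<xi>' i \<omega>) x - blinfun_apply (S \<omega>) x) \<in> borel_measurable (F (c i))"
      by (intro borel_measurable_diff borel_measurable_blinfun_apply_const \<xi>'m Ft S)
    then show ?thesis by (simp add: blinfun.diff_left)
  qed
  have gm: "g i \<in> borel_measurable (F (c i))" for i
    unfolding g_def by (intro borel_measurable_sum borel_measurable_scaleR borel_measurable_inner Ft l ms) simp
  have chain: "(\<integral>\<^sup>+\<omega>. U \<omega> * ennreal (exp (\<Sum>i<N + 2. g i \<omega> \<bullet> (W (c (Suc i)) \<omega> - W (c i) \<omega>)
      - (norm (g i \<omega>))\<^sup>2 * (c (Suc i) - c i) / 2)) \<partial>M) = (\<integral>\<^sup>+\<omega>. U \<omega> \<partial>M)"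
  proof (rule exponential_chain)
    show "0 \<le> c 0" "c (N + 2) \<le> T" using st by (auto simp: c_def)
    show "U \<in> borel_measurable (F (c 0))" using U by (simp add: c_def)
  qed (use c_mono gm in auto)
  have mart: "(\<Sum>i<N + 2. g i \<omega> \<bullet> (W (c (Suc i)) \<omega> - W (c i) \<omega>))
      = l \<omega> \<bullet> (simple_integral W N \<tau> \<xi> t \<omega> - simple_integral W N \<tau> \<xi> s \<omega> - blinfun_apply (S \<omega>) (W t \<omega> - W s \<omega>))" for \<omega>
  proof -
    let ?D = "\<lambda>i. W (c (Suc i)) \<omega> - W (c i) \<omega>"
    have "(\<Sum>i<N + 2. g i \<omega> \<bullet> ?D i) = l \<omega> \<bullet> ((\<Sum>i<N + 2. blinfun_apply (\<xi>' i \<omega>) (?D i)) - (\<Sum>i<N + 2. blinfun_apply (S \<omega>) (?D i)))"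
      unfolding g_def blinfun_adjoint(1)
      by (simp only: blinfun.diff_left inner_diff_right sum_subtractf inner_sum_right)
    also have "(\<Sum>i<N + 2. blinfun_apply (S \<omega>) (?D i)) = blinfun_apply (S \<omega>) (W t \<omega> - W s \<omega>)"
    proof -
      have "(\<Sum>i<N + 2. ?D i) = W (c (N + 2)) \<omega> - W (c 0) \<omega>" by (rule sum_lessThan_telescope)
      also have "\<dots> = W t \<omega> - W s \<omega>" by (simp add: c_def)
      finally show ?thesis by (simp only: blinfun.sum_right[symmetric])
    qed
    also have "(\<Sum>i<N + 2. blinfun_apply (\<xi>' i \<omega>) (?D i)) = simple_integral W N \<tau> \<xi> t \<omega> - simple_integral W N \<tau> \<xi> s \<omega>"
    proof -
      have "(\<Sum>i<N + 2. blinfun_apply (\<xi>' i \<omega>) (?D i)) = (\<Sum>i<Suc (Suc N). blinfun_apply (\<xi>' i \<omega>) (?D i))" by simp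
      also have "\<dots> = (\<Sum>i<N. blinfun_apply (\<xi>' (Suc i) \<omega>) (?D (Suc i)))"
      proof -
        have "\<xi>' 0 = (\<lambda>_. 0)" "\<xi>' (Suc N) = (\<lambda>_. 0)" by (simp_all add: \<xi>'_def)
        then show ?thesis
          by (simp add: sum.lessThan_Suc_shift[of _ "Suc N"] del: sum.lessThan_Suc) simp
      qed
      also have "\<dots> = (\<Sum>i<N. blinfun_apply (\<xi> i \<omega>) (W (min (\<tau> (Suc i)) t) \<omega> - W (min (\<tau> i) t) \<omega>)
          - blinfun_apply (\<xi> i \<omega>) (W (min (\<tau> (Suc i)) s) \<omega> - W (min (\<tau> i) s) \<omega>))"
      proof (rule sum.cong[OF refl])
        fix i assume "i \<in> {..<N}"
        then have i: "i < N" by simp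
        have 1: "W (max s (min (\<tau> j) t)) \<omega> = W (min (\<tau> j) t) \<omega> - W (min (\<tau> j) s) \<omega> + W s \<omega>" for j
          using st by (cases "\<tau> j \<le> s") (auto simp: max_def min_def)
        have 2: "blinfun_apply (\<xi>' (Suc i) \<omega>) (?D (Suc i)) = blinfun_apply (\<xi> i \<omega>) (?D (Suc i))"
          using i c_mono[of "Suc i"] by (auto simp: \<xi>'_def)
        have 3: "?D (Suc i) = (W (min (\<tau> (Suc i)) t) \<omega> - W (min (\<tau> i) t) \<omega>) - (W (min (\<tau> (Suc i)) s) \<omega> - W (min (\<tau> i) s) \<omega>)"
          using i by (simp add: c_def 1)
        show "blinfun_apply (\<xi>' (Suc i) \<omega>) (?D (Suc i)) = blinfun_apply (\<xi> i \<omega>) (W (min (\<tau> (Suc i)) t) \<omega> - W (min (\<tau> i) t) \<omega>)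
          - blinfun_apply (\<xi> i \<omega>) (W (min (\<tau> (Suc i)) s) \<omega> - W (min (\<tau> i) s) \<omega>)"
          unfolding 2 unfolding 3 by (rule blinfun.diff_right)
      qed
      finally show ?thesis unfolding simple_integral_def by (simp only: sum_subtractf)
    qed
    finally show ?thesis .
  qed
  have pen: "(\<Sum>i<N + 2. (norm (g i \<omega>))\<^sup>2 * (c (Suc i) - c i) / 2) \<le> (norm (l \<omega>))\<^sup>2 * Q \<omega> / 2" for \<omega>
  proof -
    have "(\<Sum>i<N + 2. (norm (g i \<omega>))\<^sup>2 * (c (Suc i) - c i) / 2)
        \<le> (\<Sum>i<N + 2. (norm (l \<omega>) * norm (\<xi>' i \<omega> - S \<omega>))\<^sup>2 * (c (Suc i) - c i) / 2)"
      unfolding g_def using c_mono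
      by (intro sum_mono divide_right_mono mult_right_mono power_mono blinfun_adjoint(2)) auto
    also have "\<dots> = (norm (l \<omega>))\<^sup>2 * Q \<omega> / 2"
      unfolding Q_def by (simp only: sum_distrib_left sum_divide_distrib power_mult_distrib mult.assoc)
    finally show ?thesis .
  qed
  show thesis
  proof
    show "Q \<in> borel_measurable M"
      unfolding Q_def
    proof (intro borel_measurable_sum borel_measurable_times borel_measurable_power borel_measurable_norm_blinfun)
      fix i x
      show "(\<lambda>\<omega>. blinfun_apply (\<xi>' i \<omega> - S \<omega>) x) \<in> borel_measurable M"
        using c_ge[of i] c_t[of i] st by (intro measurable_F_M[OF ms]) auto
    qed simp
    show "0 \<le> Q \<omega>" for \<omega> unfolding Q_def using c_mono by (intro sum_nonneg) simp
    show "ennreal (Q \<omega>) \<le> (\<integral>\<^sup>+r\<in>{s..t}. ennreal ((norm (simple_process N \<tau> \<xi> r \<omega> - S \<omega>))\<^sup>2) \<partial>lborel)" for \<omega>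
    proof -
      let ?a = "\<lambda>i. (norm (\<xi>' i \<omega> - S \<omega>))\<^sup>2"
      have "ennreal (Q \<omega>) = (\<Sum>i<N + 2. ennreal (?a i) * emeasure lborel {c i<..c (Suc i)})"
        unfolding Q_def using c_mono by (simp add: ennreal_mult sum_nonneg del: sum.lessThan_Suc flip: sum_ennreal)
      also have "\<dots> = (\<Sum>i<N + 2. \<integral>\<^sup>+r. ennreal (?a i) * indicator {c i<..c (Suc i)} r \<partial>lborel)"
        by (intro sum.cong refl nn_integral_cmult_indicator[symmetric]) simp
      also have "\<dots> = (\<integral>\<^sup>+r. (\<Sum>i<N + 2. ennreal (?a i) * indicator {c i<..c (Suc i)} r) \<partial>lborel)"
        by (rule nn_integral_sum[symmetric]) simp
      also have "\<dots> \<le> (\<integral>\<^sup>+r\<in>{s..t}. ennreal ((norm (simple_process N \<tau> \<xi> r \<omega> - S \<omega>))\<^sup>2) \<partial>lborel)"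
      proof (rule nn_integral_mono)
        fix r :: real
        show "(\<Sum>i<N + 2. ennreal (?a i) * indicator {c i<..c (Suc i)} r)
          \<le> ennreal ((norm (simple_process N \<tau> \<xi> r \<omega> - S \<omega>))\<^sup>2) * indicator {s..t} r"
        proof (cases "\<exists>j<N + 2. r \<in> {c j<..c (Suc j)}")
          case False
          then have "(\<Sum>i<N + 2. ennreal (?a i) * indicator {c i<..c (Suc i)} r) = 0"
            by (intro sum.neutral) (auto simp: indicator_def)
          then show ?thesis by (simp only: zero_le)
        next
          case True
          then obtain j where j: "j < N + 2" "c j < r" "r \<le> c (Suc j)" by auto
          have rst: "s < r" "r \<le> t" using j c_ge[of j] c_t[of "Suc j"] by linarith+
          have "ennreal (?a i) * indicator {c i<..c (Suc i)} r = (if i = j then ennreal (?a j) else 0)" for i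
          proof -
            consider "i = j" | "Suc i \<le> j" | "Suc j \<le> i" by linarith
            then show ?thesis
              using c_le[of "Suc i" j] c_le[of "Suc j" i] j by cases auto
          qed
          then have "(\<Sum>i<N + 2. ennreal (?a i) * indicator {c i<..c (Suc i)} r) = ennreal (?a j)"
            using j(1) by (simp del: sum.lessThan_Suc)
          moreover have "simple_process N \<tau> \<xi> r \<omega> = \<xi>' j \<omega>"
          proof -
            consider "j = 0" | i where "j = Suc i" "i < N" | "j = Suc N"
              using j(1) by (cases j) (auto simp: less_Suc_eq)
            then show ?thesis
            proof cases
              case 1
              then have "r \<le> \<tau> 0" using j rst by (auto simp: c_def max_def min_def split: if_splits)
              then show ?thesis using simple_process_eq_0[of N \<tau> r \<xi> \<omega>] \<tau>(2) 1 by (simp add: \<xi>'_def)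
            next
              case 2
              have "\<tau> i < r" "r \<le> \<tau> (Suc i)"
                using j rst 2 by (auto simp: c_def max_def min_def split: if_splits)
              then have "simple_process N \<tau> \<xi> r \<omega> = \<xi> i \<omega>"
                using \<tau>(2) 2 by (intro simple_process_eq) auto
              then show ?thesis using 2 j by (simp add: \<xi>'_def)
            next
              case 3
              then have "\<tau> N < r" using j rst by (auto simp: c_def max_def min_def split: if_splits)
              then show ?thesis using simple_process_eq_0[of N \<tau> r \<xi> \<omega>] \<tau>(2) 3 by (simp add: \<xi>'_def)
            qed
          qed
          ultimately show ?thesis using rst by simp
        qed
      qed
      finally show ?thesis .
    qed
    show "(\<integral>\<^sup>+\<omega>. U \<omega> * ennreal (exp (l \<omega> \<bullet> (simple_integral W N \<tau> \<xi> t \<omega> - simple_integral W N \<tau> \<xi> s \<omega>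
        - blinfun_apply (S \<omega>) (W t \<omega> - W s \<omega>)) - (norm (l \<omega>))\<^sup>2 * Q \<omega> / 2)) \<partial>M) \<le> (\<integral>\<^sup>+\<omega>. U \<omega> \<partial>M)"
    proof -
      have "(\<integral>\<^sup>+\<omega>. U \<omega> * ennreal (exp (l \<omega> \<bullet> (simple_integral W N \<tau> \<xi> t \<omega> - simple_integral W N \<tau> \<xi> s \<omega>
        - blinfun_apply (S \<omega>) (W t \<omega> - W s \<omega>)) - (norm (l \<omega>))\<^sup>2 * Q \<omega> / 2)) \<partial>M)
        \<le> (\<integral>\<^sup>+\<omega>. U \<omega> * ennreal (exp (\<Sum>i<N + 2. g i \<omega> \<bullet> (W (c (Suc i)) \<omega> - W (c i) \<omega>)
          - (norm (g i \<omega>))\<^sup>2 * (c (Suc i) - c i) / 2)) \<partial>M)"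
        unfolding sum_subtractf mart
        by (intro nn_integral_mono mult_left_mono ennreal_leI iffD2[OF exp_le_cancel_iff] diff_left_mono pen zero_le)
      then show ?thesis unfolding chain .
    qed
  qed
qed

text \<open>What is left of an increment of \<open>V\<close> after subtracting its linearisation \<open>S\<close> in the increment of \<open>W\<close>.\<close>

abbreviation "defect V S s t \<omega> \<equiv> V t \<omega> - V s \<omega> - blinfun_apply (S \<omega>) (W t \<omega> - W s \<omega>)"

text \<open>Fatou's lemma along an almost surely convergent sequence of simple integrals. The compensator loses the
  factor \<open>1/2\<close>: it is bounded by \<open>|S - H\<^sup>m|\<^sup>2 \<le> 2 |S - H|\<^sup>2 + 2 |H\<^sup>m - H|\<^sup>2\<close>, whose last term vanishes in the
  limit.\<close>

lemma exponential_ito: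
  fixes H :: "real \<Rightarrow> 'w \<Rightarrow> (real^'d) \<Rightarrow>\<^sub>L (real^'k)" and S :: "'w \<Rightarrow> (real^'d) \<Rightarrow>\<^sub>L (real^'k)"
  assumes ito: "is_ito_integral M F T W H X"
    and K: "\<And>r \<omega>. norm (H r \<omega>) \<le> K"
    and st: "0 \<le> s" "s \<le> t" "t \<le> T"
    and v: "v \<in> borel_measurable (F s)" and l: "l \<in> borel_measurable (F s)"
    and S: "S \<in> borel_measurable (F s)"
  shows "(\<integral>\<^sup>+\<omega>. ennreal (exp (v \<omega> + l \<omega> \<bullet> defect X S s t \<omega>
      - (norm (l \<omega>))\<^sup>2 * energy H S s t \<omega>)) \<partial>M)
    \<le> (\<integral>\<^sup>+\<omega>. ennreal (exp (v \<omega>)) \<partial>M)"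
proof -
  obtain N \<tau> \<xi> where simple: "\<And>m::nat. simple_integrand M F T (N m) (\<tau> m) (\<xi> m)"
    and appr: "\<And>\<epsilon>. \<epsilon> > 0 \<Longrightarrow> (\<lambda>m. measure M {\<omega> \<in> space M.
          (\<integral>\<^sup>+s\<in>{0..T}. ennreal ((norm (simple_process (N m) (\<tau> m) (\<xi> m) s \<omega> - H s \<omega>))\<^sup>2) \<partial>lborel)
            > ennreal \<epsilon>}) \<longlonglongrightarrow> 0"
    and lim: "\<And>t \<epsilon>. t \<in> {0..T} \<Longrightarrow> \<epsilon> > 0 \<Longrightarrow> (\<lambda>m. measure M {\<omega> \<in> space M.
          norm (simple_integral W (N m) (\<tau> m) (\<xi> m) t \<omega> - X t \<omega>) > \<epsilon>}) \<longlonglongrightarrow> 0"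
    and prog: "progressive F T H" and adX: "adapted F T X"
    using ito unfolding is_ito_integral_def by blast
  define SP where "SP m = simple_process (N m) (\<tau> m) (\<xi> m)" for m
  define SI where "SI m = simple_integral W (N m) (\<tau> m) (\<xi> m)" for m
  define E where "E m \<omega> = (\<integral>\<^sup>+r\<in>{0..T}. ennreal ((norm (SP m r \<omega> - H r \<omega>))\<^sup>2) \<partial>lborel)" for m \<omega>
  have T0: "0 \<le> T" using st by simp
  have \<tau>: "\<tau> m i \<in> {0..T}" if "i \<le> N m" for m i
    using simple[of m] that unfolding simple_integrand_def by auto
  have \<xi>: "\<xi> m i \<in> borel_measurable M" if "i < N m" for m i
  proof -
    have "\<xi> m i \<in> borel_measurable (F (\<tau> m i))"
      using simple[of m] that unfolding simple_integrand_def by auto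
    then show ?thesis using \<tau>[of i m] that by (intro measurable_F_M) auto
  qed
  have Hm: "(\<lambda>(r, \<omega>). H r \<omega>) \<in> borel_measurable (restrict_space borel {0..T} \<Otimes>\<^sub>M M)"
  proof -
    have HF: "(\<lambda>(r, \<omega>). H r \<omega>) \<in> borel_measurable (restrict_space borel {0..T} \<Otimes>\<^sub>M F T)"
      using prog T0 unfolding progressive_def by auto
    have "(\<lambda>x. x) \<in> measurable M (F T)"
      by (rule measurable_F_M[OF measurable_ident_sets[OF refl] T0 order_refl])
    then have "(\<lambda>p. (fst p, snd p)) \<in> measurable (restrict_space borel {0..T} \<Otimes>\<^sub>M M) (restrict_space borel {0..T} \<Otimes>\<^sub>M F T)"
      by (intro measurable_Pair measurable_fst measurable_compose[OF measurable_snd])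
    from measurable_compose[OF this HF] show ?thesis by (simp add: case_prod_beta')
  qed
  have SPm: "(\<lambda>(r, \<omega>). blinfun_apply (SP m r \<omega>) x) \<in> borel_measurable (restrict_space borel {0..T} \<Otimes>\<^sub>M M)" for m x
    unfolding SP_def by (rule simple_process_measurable[OF \<xi>])
  have dm: "(\<lambda>(r, \<omega>). ennreal ((norm (SP m r \<omega> - H r \<omega>))\<^sup>2)) \<in> borel_measurable (restrict_space borel {0..T} \<Otimes>\<^sub>M M)" for m
    by (rule progressive_norm_diff_measurable[OF Hm SPm])
  have SM: "S \<in> borel_measurable M" using st by (intro measurable_F_M[OF S]) auto
  have Sm: "(\<lambda>(r, \<omega>). ennreal ((norm (S \<omega> - H r \<omega>))\<^sup>2)) \<in> borel_measurable (restrict_space borel {0..T} \<Otimes>\<^sub>M M)"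
    using measurable_compose[OF measurable_snd borel_measurable_blinfun_apply_const[OF SM]]
    by (intro progressive_norm_diff_measurable[OF Hm]) (simp add: case_prod_beta')
  have Em: "E m \<in> borel_measurable M" for m
    using nn_integral_interval_measurable[OF dm, of 0] by (simp add: E_def[abs_def])
  have WM: "W r \<in> borel_measurable M" if "0 \<le> r" "r \<le> T" for r using W_meas that by auto
  have SIm: "SI m r \<in> borel_measurable M" if "0 \<le> r" "r \<le> T" for m r
  proof -
    have "(\<lambda>\<omega>. blinfun_apply (\<xi> m i \<omega>) (W (min (\<tau> m (Suc i)) r) \<omega> - W (min (\<tau> m i) r) \<omega>)) \<in> borel_measurable M"
      if i: "i < N m" for i
    proof (rule borel_measurable_blinfun_apply[OF borel_measurable_blinfun_apply_const[OF \<xi>[OF i]]])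
      have "W (min (\<tau> m (Suc i)) r) \<in> borel_measurable M" "W (min (\<tau> m i) r) \<in> borel_measurable M"
        using \<tau>[of i m] \<tau>[of "Suc i" m] i \<open>0 \<le> r\<close> \<open>r \<le> T\<close> by (auto intro!: WM)
      then show "(\<lambda>\<omega>. W (min (\<tau> m (Suc i)) r) \<omega> - W (min (\<tau> m i) r) \<omega>) \<in> borel_measurable M"
        by (rule borel_measurable_diff)
    qed
    then show ?thesis
      unfolding SI_def simple_integral_def[abs_def] by (intro borel_measurable_sum) simp
  qed
  have Xm: "X r \<in> borel_measurable M" if "0 \<le> r" "r \<le> T" for r
    using adX that unfolding adapted_def by (intro measurable_F_M[of "X r" r]) auto
  define f where "f i m \<omega> = (if i = (0::nat) then E m \<omega> else if i = 1 then ennreal (norm (SI m t \<omega> - X t \<omega>))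
      else ennreal (norm (SI m s \<omega> - X s \<omega>)))" for i m \<omega>
  obtain m where m: "AE \<omega> in M. eventually (\<lambda>k. \<forall>i\<in>{0, 1, 2}. f i (m k) \<omega> \<le> ennreal ((1/2)^k)) sequentially"
  proof (rule AE_fast_subsequence)
    show "f i m \<in> borel_measurable M" for i m
    proof -
      note [measurable] = Em[of m]
      have [measurable]: "SI m t \<in> borel_measurable M" "SI m s \<in> borel_measurable M"
          "X t \<in> borel_measurable M" "X s \<in> borel_measurable M"
        using SIm Xm st by auto
      consider "i = 0" | "i = 1" | "i \<noteq> 0" "i \<noteq> 1" by blast
      then show ?thesis by cases (simp_all add: f_def[abs_def])
    qed
    show "(\<lambda>m. measure M {\<omega>\<in>space M. f i m \<omega> > ennreal \<delta>}) \<longlonglongrightarrow> 0" if "i \<in> {0, 1, 2}" "0 < \<delta>" for i \<delta>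
      using appr[OF that(2)] lim[OF _ that(2), of t] lim[OF _ that(2), of s] that st
      by (auto simp: f_def E_def SP_def SI_def ennreal_less_iff)
  qed simp
  let ?e = "\<lambda>k Q \<omega>. ennreal (exp (v \<omega>)) * ennreal (exp (l \<omega> \<bullet> defect (SI (m k)) S s t \<omega> - (norm (l \<omega>))\<^sup>2 * Q \<omega> / 2))"
  let ?good = "\<lambda>k Q. Q \<in> borel_measurable M \<and> (\<forall>\<omega>. 0 \<le> Q \<omega>) \<and>
      (\<forall>\<omega>. ennreal (Q \<omega>) \<le> (\<integral>\<^sup>+r\<in>{s..t}. ennreal ((norm (SP (m k) r \<omega> - S \<omega>))\<^sup>2) \<partial>lborel)) \<and>
      (\<integral>\<^sup>+\<omega>. ?e k Q \<omega> \<partial>M) \<le> (\<integral>\<^sup>+\<omega>. ennreal (exp (v \<omega>)) \<partial>M)"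
  have "\<exists>Q. ?good k Q" for k
  proof -
    have vm: "(\<lambda>\<omega>. ennreal (exp (v \<omega>))) \<in> borel_measurable (F s)" using v by measurable
    show ?thesis
      unfolding SP_def SI_def by (rule exponential_simple[OF simple[of "m k"] st vm l S], blast)
  qed
  from choice[OF allI[OF this]] obtain Q where good: "\<forall>k. ?good k (Q k)" by (rule exE)
  have Q: "Q k \<in> borel_measurable M" "0 \<le> Q k \<omega>"
      "ennreal (Q k \<omega>) \<le> (\<integral>\<^sup>+r\<in>{s..t}. ennreal ((norm (SP (m k) r \<omega> - S \<omega>))\<^sup>2) \<partial>lborel)"
      "(\<integral>\<^sup>+\<omega>. ?e k (Q k) \<omega> \<partial>M) \<le> (\<integral>\<^sup>+\<omega>. ennreal (exp (v \<omega>)) \<partial>M)" for k \<omega>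
    using good[rule_format, of k] by blast+
  define P where "P = energy H S s t"
  have P: "(\<integral>\<^sup>+r\<in>{s..t}. ennreal ((norm (S \<omega> - H r \<omega>))\<^sup>2) \<partial>lborel) = ennreal (P \<omega>)" for \<omega>
  proof -
    have "(\<integral>\<^sup>+r\<in>{s..t}. ennreal ((norm (S \<omega> - H r \<omega>))\<^sup>2) \<partial>lborel)
        \<le> (\<integral>\<^sup>+r\<in>{s..t}. ennreal ((norm (S \<omega>) + K)\<^sup>2) \<partial>lborel)"
    proof (intro nn_integral_mono mult_right_mono ennreal_leI power_mono)
      fix r show "norm (S \<omega> - H r \<omega>) \<le> norm (S \<omega>) + K"
        using norm_triangle_ineq4[of "S \<omega>" "H r \<omega>"] K[of r \<omega>] by linarith
    qed auto
    also have "\<dots> = ennreal ((norm (S \<omega>) + K)\<^sup>2) * ennreal (t - s)"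
      using st by (simp add: nn_integral_cmult_indicator)
    also have "\<dots> < \<infinity>" by (simp add: ennreal_mult_less_top)
    finally show ?thesis by (simp add: P_def energy_def)
  qed
  let ?x = "\<lambda>k \<omega>. v \<omega> + (l \<omega> \<bullet> defect (SI (m k)) S s t \<omega>)"
  let ?y = "\<lambda>\<omega>. v \<omega> + (l \<omega> \<bullet> defect X S s t \<omega>)"
  let ?Z = "\<lambda>k \<omega>. ennreal (exp (?x k \<omega> - (norm (l \<omega>))\<^sup>2 * Q k \<omega> / 2))"
  have Zeq: "?Z k \<omega> = ?e k (Q k) \<omega>" for k \<omega>
    by (simp add: ennreal_mult[symmetric] exp_add[symmetric] add_diff_eq)
  have Zm: "?Z k \<in> borel_measurable M" for k
  proof -
    have [measurable]: "v \<in> borel_measurable M" "l \<in> borel_measurable M"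
      using st by (auto intro!: measurable_F_M[OF v] measurable_F_M[OF l])
    have [measurable]: "SI (m k) t \<in> borel_measurable M" "SI (m k) s \<in> borel_measurable M" "Q k \<in> borel_measurable M"
      using st SIm Q(1) by auto
    have [measurable]: "(\<lambda>\<omega>. blinfun_apply (S \<omega>) (W t \<omega> - W s \<omega>)) \<in> borel_measurable M"
      by (rule borel_measurable_blinfun_apply[OF borel_measurable_blinfun_apply_const[OF SM]
            borel_measurable_diff[OF WM WM]]) (use st in linarith)+
    show ?thesis by measurable
  qed
  have "AE \<omega> in M. ennreal (exp (?y \<omega> - (norm (l \<omega>))\<^sup>2 * P \<omega>)) \<le> liminf (\<lambda>k. ?Z k \<omega>)"
    using m AE_space
  proof eventually_elim
    case (elim \<omega>)
    then have ev: "eventually (\<lambda>k. E (m k) \<omega> \<le> ennreal ((1/2)^k) \<and> norm (SI (m k) t \<omega> - X t \<omega>) \<le> (1/2)^k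
        \<and> norm (SI (m k) s \<omega> - X s \<omega>) \<le> (1/2)^k) sequentially"
      by (auto elim!: eventually_mono simp: f_def)
    have half: "(\<lambda>k. (1/2::real)^k) \<longlonglongrightarrow> 0" by (simp add: LIMSEQ_realpow_zero)
    have lt: "(\<lambda>k. SI (m k) t \<omega>) \<longlonglongrightarrow> X t \<omega>"
      by (rule LIM_zero_cancel, rule Lim_null_comparison[OF _ half]) (use ev in \<open>auto elim!: eventually_mono\<close>)
    have ls: "(\<lambda>k. SI (m k) s \<omega>) \<longlonglongrightarrow> X s \<omega>"
      by (rule LIM_zero_cancel, rule Lim_null_comparison[OF _ half]) (use ev in \<open>auto elim!: eventually_mono\<close>)
    have Qle: "Q k \<omega> \<le> 2 * P \<omega> + 2 * (1/2)^k" if "E (m k) \<omega> \<le> ennreal ((1/2)^k)" for k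
    proof -
      have sect: "(\<lambda>r. f r \<omega> * indicator {s..t} r) \<in> borel_measurable lborel"
        if "(\<lambda>(r, \<omega>). f r \<omega>) \<in> borel_measurable (restrict_space borel {0..T} \<Otimes>\<^sub>M M)" for f :: "real \<Rightarrow> 'w \<Rightarrow> ennreal"
      proof -
        have "(\<lambda>r. f r \<omega>) \<in> borel_measurable (restrict_space borel {0..T})"
          using measurable_Pair1[OF that, of \<omega>] \<open>\<omega> \<in> space M\<close> by simp
        then have "(\<lambda>r. f r \<omega> * indicator {0..T} r) \<in> borel_measurable borel"
          by (subst (asm) borel_measurable_restrict_space_iff_ennreal) auto
        then have "(\<lambda>r. f r \<omega> * indicator {0..T} r * indicator {s..t} r) \<in> borel_measurable lborel"
          by simp
        also have "(\<lambda>r. f r \<omega> * indicator {0..T} r * indicator {s..t} r) = (\<lambda>r. f r \<omega> * indicator {s..t} r)"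
          using st by (auto simp: fun_eq_iff split: split_indicator)
        finally show ?thesis .
      qed
      have sq: "(norm (a + b))\<^sup>2 \<le> 2 * (norm a)\<^sup>2 + 2 * (norm b)\<^sup>2" for a b :: "(real^'d) \<Rightarrow>\<^sub>L (real^'k)"
      proof -
        have "(norm (a + b))\<^sup>2 \<le> (norm a + norm b)\<^sup>2" by (intro power_mono norm_triangle_ineq) simp
        also have "\<dots> \<le> 2 * (norm a)\<^sup>2 + 2 * (norm b)\<^sup>2" 
          by (use zero_le_power2[of "norm a - norm b"] in \<open>simp add: power2_eq_square algebra_simps\<close>)
        finally show ?thesis .
      qed
      have "ennreal (Q k \<omega>) \<le> (\<integral>\<^sup>+r\<in>{s..t}. ennreal ((norm (SP (m k) r \<omega> - S \<omega>))\<^sup>2) \<partial>lborel)" by (rule Q(3))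
      also have "\<dots> \<le> (\<integral>\<^sup>+r. 2 * (ennreal ((norm (SP (m k) r \<omega> - H r \<omega>))\<^sup>2) * indicator {s..t} r)
          + 2 * (ennreal ((norm (S \<omega> - H r \<omega>))\<^sup>2) * indicator {s..t} r) \<partial>lborel)"
      proof (rule nn_integral_mono)
        fix r :: real
        have "(norm (SP (m k) r \<omega> - S \<omega>))\<^sup>2 \<le> 2 * (norm (SP (m k) r \<omega> - H r \<omega>))\<^sup>2 + 2 * (norm (S \<omega> - H r \<omega>))\<^sup>2"
          using sq[of "SP (m k) r \<omega> - H r \<omega>" "H r \<omega> - S \<omega>"] by (simp add: norm_minus_commute)
        then have "ennreal ((norm (SP (m k) r \<omega> - S \<omega>))\<^sup>2) \<le> 2 * ennreal ((norm (SP (m k) r \<omega> - H r \<omega>))\<^sup>2) + 2 * ennreal ((norm (S \<omega> - H r \<omega>))\<^sup>2)"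
          by (subst (asm) ennreal_le_iff[symmetric]) (simp_all add: ennreal_mult ennreal_plus)
        then show "ennreal ((norm (SP (m k) r \<omega> - S \<omega>))\<^sup>2) * indicator {s..t} r \<le> 2 * (ennreal ((norm (SP (m k) r \<omega> - H r \<omega>))\<^sup>2) * indicator {s..t} r)
          + 2 * (ennreal ((norm (S \<omega> - H r \<omega>))\<^sup>2) * indicator {s..t} r)"
          by (auto split: split_indicator)
      qed
      also have "\<dots> = 2 * (\<integral>\<^sup>+r\<in>{s..t}. ennreal ((norm (SP (m k) r \<omega> - H r \<omega>))\<^sup>2) \<partial>lborel) + 2 * ennreal (P \<omega>)"
        unfolding P[symmetric]
        using sect[OF dm] sect[OF Sm]
        by (simp add: nn_integral_add nn_integral_cmult borel_measurable_const borel_measurable_times_ennreal)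
      also have "\<dots> \<le> 2 * ennreal ((1/2)^k) + 2 * ennreal (P \<omega>)"
      proof (intro add_right_mono mult_left_mono)
        have "(\<integral>\<^sup>+r\<in>{s..t}. ennreal ((norm (SP (m k) r \<omega> - H r \<omega>))\<^sup>2) \<partial>lborel) \<le> E (m k) \<omega>"
          unfolding E_def using st by (intro nn_integral_mono) (auto split: split_indicator)
        also note that
        finally show "(\<integral>\<^sup>+r\<in>{s..t}. ennreal ((norm (SP (m k) r \<omega> - H r \<omega>))\<^sup>2) \<partial>lborel) \<le> ennreal ((1/2)^k)" .
      qed simp
      also have "\<dots> = ennreal (2 * (1/2)^k + 2 * P \<omega>)"
        by (simp add: ennreal_plus ennreal_mult P_def energy_def)
      finally show ?thesis
        by (subst (asm) ennreal_le_iff) (auto simp: P_def energy_def)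
    qed
    let ?low = "\<lambda>k. ennreal (exp (?x k \<omega> - (norm (l \<omega>))\<^sup>2 * (P \<omega> + (1/2)^k)))"
    have lm: "?low \<longlonglongrightarrow> ennreal (exp (?y \<omega> - (norm (l \<omega>))\<^sup>2 * (P \<omega> + 0)))"
      by (intro tendsto_ennrealI tendsto_exp tendsto_intros lt ls half)
    have "ennreal (exp (?y \<omega> - (norm (l \<omega>))\<^sup>2 * P \<omega>)) = liminf ?low"
      using lim_imp_Liminf[OF sequentially_bot lm] by (simp only: add_0_right)
    also have "\<dots> \<le> liminf (\<lambda>k. ?Z k \<omega>)"
    proof (rule Liminf_mono, rule eventually_mono[OF ev], elim conjE)
      fix k assume "E (m k) \<omega> \<le> ennreal ((1/2)^k)"
      then have "(norm (l \<omega>))\<^sup>2 * Q k \<omega> \<le> (norm (l \<omega>))\<^sup>2 * (2 * P \<omega> + 2 * (1/2)^k)"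
        by (intro mult_left_mono Qle) auto
      then show "?low k \<le> ?Z k \<omega>" by (intro ennreal_leI) (simp add: algebra_simps)
    qed
    finally show ?case .
  qed
  then have "(\<integral>\<^sup>+\<omega>. ennreal (exp (?y \<omega> - (norm (l \<omega>))\<^sup>2 * P \<omega>)) \<partial>M) \<le> (\<integral>\<^sup>+\<omega>. liminf (\<lambda>k. ?Z k \<omega>) \<partial>M)"
    by (rule nn_integral_mono_AE)
  also have "\<dots> \<le> liminf (\<lambda>k. \<integral>\<^sup>+\<omega>. ?Z k \<omega> \<partial>M)"
    by (rule nn_integral_liminf[OF Zm])
  also have "\<dots> \<le> (\<integral>\<^sup>+\<omega>. ennreal (exp (v \<omega>)) \<partial>M)"
    using Liminf_mono[OF always_eventually, rule_format, of "\<lambda>k. \<integral>\<^sup>+\<omega>. ?Z k \<omega> \<partial>M" "\<lambda>_. \<integral>\<^sup>+\<omega>. ennreal (exp (v \<omega>)) \<partial>M" sequentially] Q(4)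
    unfolding Zeq by (simp add: Liminf_const)
  finally show ?thesis unfolding P_def .
qed

text \<open>Iterating the previous inequality along the grid. The weight at step \<open>n\<close> is the exponential of the sum over
  the earlier steps, which is known at time \<open>c n\<close> since the integrand is progressive.\<close>

lemma exponential_ito_grid:
  fixes H :: "real \<Rightarrow> 'w \<Rightarrow> (real^'d) \<Rightarrow>\<^sub>L (real^'k)" and S :: "nat \<Rightarrow> 'w \<Rightarrow> (real^'d) \<Rightarrow>\<^sub>L (real^'k)"
    and c :: "nat \<Rightarrow> real"
  defines "Z \<equiv> \<lambda>J l X \<omega>. \<Sum>j<J. l j \<omega> \<bullet> defect X (S j) (c j) (c (Suc j)) \<omega>
      - (norm (l j \<omega>))\<^sup>2 * energy H (S j) (c j) (c (Suc j)) \<omega>"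
  assumes ito: "is_ito_integral M F T W H X"
    and K: "\<And>r \<omega>. norm (H r \<omega>) \<le> K"
    and c: "0 \<le> c 0" "\<And>j. j < J \<Longrightarrow> c j \<le> c (Suc j)" "c J \<le> T"
    and l: "\<And>j. j < J \<Longrightarrow> l j \<in> borel_measurable (F (c j))"
    and S: "\<And>j. j < J \<Longrightarrow> S j \<in> borel_measurable (F (c j))"
  shows "(\<integral>\<^sup>+\<omega>. ennreal (exp (Z J l X \<omega>)) \<partial>M) \<le> 1" "Z J l X \<in> borel_measurable M"
proof -
  have prog: "progressive F T H" and adX: "adapted F T X" using ito unfolding is_ito_integral_def by auto
  have mono: "i \<le> j \<Longrightarrow> j \<le> J \<Longrightarrow> c i \<le> c j" for i j
    by (rule increasing_le[of J c, OF c(2)])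
  have c0: "0 \<le> c j" "c j \<le> T" if "j \<le> J" for j
    using mono[of 0 j] mono[of j J] c that by auto
  have Zm: "Z n l X \<in> borel_measurable (F (c n))" if n: "n \<le> J" for n
  proof -
    have "(\<lambda>\<omega>. l j \<omega> \<bullet> defect X (S j) (c j) (c (Suc j)) \<omega>
      - (norm (l j \<omega>))\<^sup>2 * energy H (S j) (c j) (c (Suc j)) \<omega>) \<in> borel_measurable (F (c n))" if j: "j < n" for j
    proof -
      have up: "f \<in> measurable (F (c n)) R" if "f \<in> measurable (F (c i)) R" "i \<le> n" for f i and R :: "'z measure"
        by (rule measurable_F_mono[OF that(1)]) (use c0[of i] c0[of n] mono[of i n] that n in auto)
      have Wi: "W (c i) \<in> borel_measurable (F (c n))" and Xi: "X (c i) \<in> borel_measurable (F (c n))" if "i \<le> n" for i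
        using W_meas_F[of "c i"] adX[unfolded adapted_def] c0[of i] that n by (auto intro!: up[of _ i])
      have [measurable]: "W (c j) \<in> borel_measurable (F (c n))" "W (c (Suc j)) \<in> borel_measurable (F (c n))"
          "X (c j) \<in> borel_measurable (F (c n))" "X (c (Suc j)) \<in> borel_measurable (F (c n))"
        using Wi Xi j by auto
      have [measurable]: "l j \<in> borel_measurable (F (c n))" using up[OF l] j n by auto
      have "S j \<in> borel_measurable (F (c n))" using up[OF S] j n by auto
      then have [measurable]: "(\<lambda>\<omega>. blinfun_apply (S j \<omega>) (W (c (Suc j)) \<omega> - W (c j) \<omega>)) \<in> borel_measurable (F (c n))"
        by (rule borel_measurable_blinfun_apply[OF borel_measurable_blinfun_apply_const]) measurable
      have "energy H (S j) (c j) (c (Suc j)) \<in> borel_measurable (F (c (Suc j)))"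
        using j n c0[of j] c0[of "Suc j"] mono[of j "Suc j"] by (intro energy_measurable[OF prog S]) auto
      then have [measurable]: "energy H (S j) (c j) (c (Suc j)) \<in> borel_measurable (F (c n))"
        by (rule up) (use j in simp)
      show ?thesis by measurable
    qed
    then show ?thesis unfolding Z_def by (intro borel_measurable_sum) auto
  qed
  have "n \<le> J \<Longrightarrow> (\<integral>\<^sup>+\<omega>. ennreal (exp (Z n l X \<omega>)) \<partial>M) \<le> 1" for n
  proof (induction n)
    case 0
    then show ?case by (simp add: Z_def emeasure_space_1)
  next
    case (Suc n)
    have "(\<integral>\<^sup>+\<omega>. ennreal (exp (Z (Suc n) l X \<omega>)) \<partial>M) =
      (\<integral>\<^sup>+\<omega>. ennreal (exp (Z n l X \<omega> + l n \<omega> \<bullet> defect X (S n) (c n) (c (Suc n)) \<omega>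
      - (norm (l n \<omega>))\<^sup>2 * energy H (S n) (c n) (c (Suc n)) \<omega>)) \<partial>M)"
      by (simp add: Z_def add_diff_eq)
    also have "\<dots> \<le> (\<integral>\<^sup>+\<omega>. ennreal (exp (Z n l X \<omega>)) \<partial>M)"
      using Suc.prems c0[of n] c0[of "Suc n"] c(2)[of n]
      by (intro exponential_ito[OF ito K _ _ _ Zm l S]) auto
    finally show ?case using Suc by auto
  qed
  from this[of J] show "(\<integral>\<^sup>+\<omega>. ennreal (exp (Z J l X \<omega>)) \<partial>M) \<le> 1" by simp
  show "Z J l X \<in> borel_measurable M"
    using measurable_F_M[OF Zm[of J]] c0[of J] by simp
qed

end

section \<open>Hoelder continuity from dyadic increments\<close>

text \<open>Chaining: \<open>f x\<close> is the limit of \<open>f\<close> along the dyadic approximations of \<open>x\<close> from below, and consecutive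
  approximations are equal or adjacent dyadic points, so that the errors form a geometric series. For two points at
  distance about \<open>2\<^bsup>-m\<^esup>\<close>, the approximations of level \<open>m\<close> are equal or adjacent.\<close>

lemma dyadic_holder_unit:
  fixes f :: "real \<Rightarrow> 'a::real_normed_vector"
  assumes \<alpha>: "0 < \<alpha>" and A: "0 \<le> A" and cont: "continuous_on {0..1} f"
    and incr: "\<And>m i. i < 2 ^ m \<Longrightarrow> norm (f (real (Suc i) / 2 ^ m) - f (real i / 2 ^ m)) \<le> A * ((1/2) powr \<alpha>) ^ m"
    and st: "0 \<le> s" "s < t" "t \<le> 1"
  shows "norm (f t - f s) \<le> (1 + 2 / (1 - (1/2) powr \<alpha>)) * 2 powr \<alpha> * A * (t - s) powr \<alpha>"
proof -
  define \<rho> :: real where "\<rho> = (1/2) powr \<alpha>"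
  have \<rho>: "0 < \<rho>" "\<rho> < 1"
  proof -
    have "(1/2) powr \<alpha> < (1/2::real) powr 0" using \<alpha> by (intro powr_less_mono') auto
    then show "0 < \<rho>" "\<rho> < 1" by (simp_all add: \<rho>_def)
  qed
  define k where "k m x = nat \<lfloor>2 ^ m * x\<rfloor>" for m :: nat and x :: real
  define d where "d m x = real (k m x) / 2 ^ m" for m :: nat and x :: real
  have kx: "real (k m x) \<le> 2 ^ m * x" "2 ^ m * x < real (k m x) + 1" if "0 \<le> x" for m x
    using that by (simp_all add: k_def)
  have d_le: "d m x \<le> x" "x \<le> d m x + (1/2) ^ m" "0 \<le> d m x" if "0 \<le> x" for m x
    using kx[OF that, of m] by (simp_all add: d_def field_simps power_one_over)
  have step: "norm (f (d (Suc m) x) - f (d m x)) \<le> A * \<rho> ^ Suc m" if x: "0 \<le> x" "x \<le> 1" for m x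
  proof -
    have "real (k (Suc m) x) < 2 * real (k m x) + 2" "2 * real (k m x) < real (k (Suc m) x) + 1"
      using kx[OF x(1), of m] kx[OF x(1), of "Suc m"] by simp_all
    then have "k (Suc m) x = 2 * k m x \<or> k (Suc m) x = Suc (2 * k m x)" by linarith
    then show ?thesis
    proof
      assume "k (Suc m) x = 2 * k m x"
      then have "d (Suc m) x = d m x" by (simp add: d_def)
      then show ?thesis using A \<rho> by simp
    next
      assume eq: "k (Suc m) x = Suc (2 * k m x)"
      have "real (k (Suc m) x) \<le> 2 ^ Suc m"
        using order_trans[OF kx(1)[OF x(1), of "Suc m"] mult_left_mono[OF x(2), of "2 ^ Suc m"]] by simp
      then have "real (Suc (2 * k m x)) \<le> real (2 ^ Suc m)" using eq by simp
      then have "2 * k m x < 2 ^ Suc m" by linarith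
      from incr[OF this] show ?thesis
        unfolding d_def eq by (simp add: \<rho>_def field_simps)
    qed
  qed
  have steps: "norm (f (d (m + j) x) - f (d m x)) \<le> A * ((\<rho> ^ m - \<rho> ^ (m + j)) / (1 - \<rho>))" if x: "0 \<le> x" "x \<le> 1" for m j x
  proof (induction j)
    case (Suc j)
    have "norm (f (d (m + Suc j) x) - f (d m x)) \<le> norm (f (d (Suc (m + j)) x) - f (d (m + j) x)) + norm (f (d (m + j) x) - f (d m x))"
      using norm_triangle_ineq[of "f (d (Suc (m + j)) x) - f (d (m + j) x)" "f (d (m + j) x) - f (d m x)"] by simp
    also have "\<dots> \<le> A * \<rho> ^ Suc (m + j) + A * ((\<rho> ^ m - \<rho> ^ (m + j)) / (1 - \<rho>))"
      using step[OF x] Suc by (intro add_mono)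
    also have "\<dots> \<le> A * \<rho> ^ (m + j) + A * ((\<rho> ^ m - \<rho> ^ (m + j)) / (1 - \<rho>))"
      using A \<rho> by (intro add_right_mono mult_left_mono power_decreasing) auto
    also have "\<dots> = A * ((\<rho> ^ m - \<rho> ^ (m + Suc j)) / (1 - \<rho>))"
      using \<rho> by (simp add: field_simps)
    finally show ?case .
  qed simp
  have tail: "norm (f x - f (d m x)) \<le> A * (\<rho> ^ m / (1 - \<rho>))" if x: "0 \<le> x" "x \<le> 1" for m x
  proof -
    have "(\<lambda>j. (1/2::real) ^ (m + j)) \<longlonglongrightarrow> 0"
      using LIMSEQ_ignore_initial_segment[OF LIMSEQ_realpow_zero[of "1/2::real"], of m] by (simp add: add.commute)
    then have "(\<lambda>j. d (m + j) x - x) \<longlonglongrightarrow> 0"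
      by (rule Lim_null_comparison[rotated]) (use d_le[OF x(1)] in \<open>auto simp: abs_le_iff algebra_simps\<close>)
    then have lim: "(\<lambda>j. d (m + j) x) \<longlonglongrightarrow> x" by (rule LIM_zero_cancel)
    have "(\<lambda>j. f (d (m + j) x)) \<longlonglongrightarrow> f x"
    proof (rule continuous_on_tendsto_compose[OF cont lim])
      show "x \<in> {0..1}" using x by simp
      show "\<forall>\<^sub>F j in sequentially. d (m + j) x \<in> {0..1}"
        using d_le(3)[OF x(1)] order_trans[OF d_le(1)[OF x(1)] x(2)] by (intro always_eventually) auto
    qed
    then have "(\<lambda>j. norm (f (d (m + j) x) - f (d m x))) \<longlonglongrightarrow> norm (f x - f (d m x))"
      by (intro tendsto_intros)
    then show ?thesis
    proof (rule LIMSEQ_le_const2, intro exI allI impI)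
      fix j
      have "A * ((\<rho> ^ m - \<rho> ^ (m + j)) / (1 - \<rho>)) \<le> A * (\<rho> ^ m / (1 - \<rho>))"
        using A \<rho> by (intro mult_left_mono divide_right_mono) auto
      then show "norm (f (d (m + j) x) - f (d m x)) \<le> A * (\<rho> ^ m / (1 - \<rho>))"
        using steps[OF x, of m j] by linarith
    qed
  qed
  obtain m where m: "(1/2) ^ Suc m < t - s" "t - s \<le> (1/2) ^ m"
  proof -
    let ?P = "\<lambda>n. (1/2::real) ^ n < t - s"
    have ex: "\<exists>n. ?P n" using real_arch_pow_inv[of "t - s" "1/2"] st by auto
    have "?P (LEAST n. ?P n)" by (rule LeastI_ex[OF ex])
    moreover have "(LEAST n. ?P n) \<noteq> 0"
    proof
      assume "(LEAST n. ?P n) = 0"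
      with \<open>?P (LEAST n. ?P n)\<close> show False using st by simp
    qed
    then obtain m where "(LEAST n. ?P n) = Suc m" by (cases "LEAST n. ?P n") auto
    moreover from this have "\<not> ?P m" using not_less_Least[of m ?P] by simp
    ultimately show thesis using that[of m] by simp
  qed
  have x: "0 \<le> s" "s \<le> 1" "0 \<le> t" "t \<le> 1" using st by auto
  have mid: "norm (f (d m t) - f (d m s)) \<le> A * \<rho> ^ m"
  proof -
    have "2 ^ m * t \<le> 2 ^ m * s + 1"
      using mult_left_mono[OF m(2), of "2 ^ m"] by (simp add: algebra_simps power_one_over)
    moreover have "2 ^ m * s \<le> 2 ^ m * t" using st by simp
    ultimately have "real (k m t) < real (k m s) + 2" "real (k m s) < real (k m t) + 1"
      using kx[OF x(1), of m] kx[OF x(3), of m] by linarith+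
    then have "k m t = k m s \<or> k m t = Suc (k m s)" by linarith
    then show ?thesis
    proof
      assume "k m t = k m s"
      then show ?thesis using A \<rho> by (simp add: d_def)
    next
      assume eq: "k m t = Suc (k m s)"
      have "real (k m t) \<le> 2 ^ m"
        using order_trans[OF kx(1)[OF x(3), of m] mult_left_mono[OF x(4), of "2 ^ m"]] by simp
      then have "real (Suc (k m s)) \<le> real (2 ^ m)" using eq by simp
      then have "k m s < 2 ^ m" by linarith
      from incr[OF this] show ?thesis unfolding d_def eq \<rho>_def .
    qed
  qed
  have "norm (f t - f s) \<le> norm (f t - f (d m t)) + norm (f (d m t) - f (d m s)) + norm (f s - f (d m s))"
    using norm_triangle_ineq[of "f t - f (d m t)" "f (d m t) - f (d m s)"]
      norm_triangle_ineq4[of "f t - f (d m s)" "f s - f (d m s)"] by simp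
  also have "\<dots> \<le> A * (\<rho> ^ m / (1 - \<rho>)) + A * \<rho> ^ m + A * (\<rho> ^ m / (1 - \<rho>))"
    by (intro add_mono tail mid x)
  also have "\<dots> = (1 + 2 / (1 - \<rho>)) * A * \<rho> ^ m" by (simp add: algebra_simps add_divide_distrib)
  also have "\<dots> \<le> (1 + 2 / (1 - \<rho>)) * A * (2 powr \<alpha> * (t - s) powr \<alpha>)"
  proof (intro mult_left_mono)
    have "\<rho> ^ m = ((1/2) ^ m) powr \<alpha>"
      unfolding \<rho>_def by (simp add: powr_power powr_realpow[symmetric] powr_powr mult.commute)
    also have "\<dots> \<le> (2 * (t - s)) powr \<alpha>"
      using m(1) \<alpha> st by (intro powr_mono2) auto
    also have "\<dots> = 2 powr \<alpha> * (t - s) powr \<alpha>" by (rule powr_mult)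
    finally show "\<rho> ^ m \<le> 2 powr \<alpha> * (t - s) powr \<alpha>" .
  qed (use A \<rho> in auto)
  finally show ?thesis unfolding \<rho>_def by (simp add: mult_ac)
qed

lemma dyadic_holder:
  fixes T \<alpha> :: real
  assumes "0 < T" "0 < \<alpha>"
  obtains C where "0 \<le> C" "\<And>(f :: real \<Rightarrow> 'a::real_normed_vector) A s t. continuous_on {0..T} f \<Longrightarrow> 0 \<le> A \<Longrightarrow>
    (\<And>m i. i < 2 ^ m \<Longrightarrow> norm (f (grid T (2 ^ m) (Suc i)) - f (grid T (2 ^ m) i)) \<le> A * (real (2 ^ m)) powr (- \<alpha>)) \<Longrightarrow>
    s \<in> {0..T} \<Longrightarrow> t \<in> {0..T} \<Longrightarrow> norm (f t - f s) \<le> C * A * \<bar>t - s\<bar> powr \<alpha>"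
proof
  let ?c = "(1 + 2 / (1 - (1/2) powr \<alpha>)) * 2 powr \<alpha>"
  let ?C = "?c / T powr \<alpha>"
  have "(1/2) powr \<alpha> < (1/2::real) powr 0" using assms by (intro powr_less_mono') auto
  then have c0: "0 \<le> ?c" by simp
  then show "0 \<le> ?C" by simp
  fix f :: "real \<Rightarrow> 'a" and A s t :: real
  assume cont: "continuous_on {0..T} f" and A: "0 \<le> A"
    and incr: "\<And>m i. i < 2 ^ m \<Longrightarrow> norm (f (grid T (2 ^ m) (Suc i)) - f (grid T (2 ^ m) i)) \<le> A * (real (2 ^ m)) powr (- \<alpha>)"
    and st: "s \<in> {0..T}" "t \<in> {0..T}"
  have main: "norm (f t - f s) \<le> ?C * A * (t - s) powr \<alpha>" if "s < t" "0 \<le> s" "t \<le> T" for s t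
  proof -
    let ?g = "\<lambda>x. f (x * T)"
    have "continuous_on {0..1} ?g"
      by (rule continuous_on_compose2[OF cont]) (use assms in \<open>auto intro!: continuous_intros mult_le_one simp: mult_le_cancel_right1\<close>)
    moreover have "norm (?g (real (Suc i) / 2 ^ m) - ?g (real i / 2 ^ m)) \<le> A * ((1/2) powr \<alpha>) ^ m" if "i < 2 ^ m" for m i
    proof -
      have "(real (2 ^ m)) powr (- \<alpha>) = ((1/2) powr \<alpha>) ^ m"
        by (simp add: powr_minus powr_power powr_divide powr_realpow[symmetric] powr_powr power_one_over inverse_eq_divide mult.commute)
      then show ?thesis using incr[OF that] by (simp add: grid_def)
    qed
    ultimately have "norm (?g (t / T) - ?g (s / T)) \<le> ?c * A * (t / T - s / T) powr \<alpha>"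
      using assms that A by (intro dyadic_holder_unit) (auto simp: divide_strict_right_mono)
    also have "t / T - s / T = (t - s) / T" by (simp add: diff_divide_distrib)
    also have "((t - s) / T) powr \<alpha> = (t - s) powr \<alpha> / T powr \<alpha>" by (rule powr_divide)
    finally show ?thesis using assms by simp
  qed
  show "norm (f t - f s) \<le> ?C * A * \<bar>t - s\<bar> powr \<alpha>"
    using main[of s t] main[of t s] st by (cases s t rule: linorder_cases) (simp_all add: norm_minus_commute)
qed

section \<open>Variation by interpolation\<close>

text \<open>Each term is at most the increment times \<open>T\<^bsup>r - 1\<^esup>\<close>, and the increments add up to at most \<open>T\<close>.\<close>

lemma sum_increments_powr_le:
  fixes w :: "nat \<Rightarrow> real"
  assumes mono: "\<And>i. i < N \<Longrightarrow> w i \<le> w (Suc i)" and w: "0 \<le> w 0" "w N \<le> T" and T: "0 < T" and r: "1 \<le> r"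
  shows "(\<Sum>i<N. \<bar>w (Suc i) - w i\<bar> powr r) \<le> T powr r"
proof -
  have le: "i \<le> j \<Longrightarrow> j \<le> N \<Longrightarrow> w i \<le> w j" for i j
    by (rule increasing_le[of N w, OF mono])
  have "(\<Sum>i<N. \<bar>w (Suc i) - w i\<bar> powr r) \<le> (\<Sum>i<N. (w (Suc i) - w i) * T powr (r - 1))"
  proof (rule sum_mono)
    fix i assume "i \<in> {..<N}"
    then have i: "i < N" by simp
    let ?d = "w (Suc i) - w i"
    have d: "0 \<le> ?d" "?d \<le> T" using mono[OF i] le[of 0 i] le[of "Suc i" N] w i by auto
    show "\<bar>?d\<bar> powr r \<le> ?d * T powr (r - 1)"
    proof (cases "?d = 0")
      case False
      then have "\<bar>?d\<bar> powr r = ?d * ?d powr (r - 1)"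
        using d powr_add[of ?d 1 "r - 1"] by simp
      also have "\<dots> \<le> ?d * T powr (r - 1)"
        using d r by (intro mult_left_mono powr_mono2) auto
      finally show ?thesis .
    qed simp
  qed
  also have "\<dots> = (w N - w 0) * T powr (r - 1)"
    by (simp only: sum_distrib_right[symmetric] sum_lessThan_telescope)
  also have "\<dots> \<le> T * T powr (r - 1)" using w by (intro mult_right_mono) auto
  also have "\<dots> = T powr r" using T powr_add[of T 1 "r - 1"] by simp
  finally show ?thesis .
qed

lemma add_powr_le:
  fixes x y p :: real
  assumes "0 \<le> x" "0 \<le> y" "0 < p"
  shows "(x + y) powr p \<le> 2 powr p * (x powr p + y powr p)"
proof -
  have "(x + y) powr p \<le> (2 * max x y) powr p" using assms by (intro powr_mono2) auto
  also have "\<dots> = 2 powr p * (max x y) powr p" by (rule powr_mult)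
  also have "\<dots> \<le> 2 powr p * (x powr p + y powr p)"
    by (intro mult_left_mono) (auto simp: max_def)
  finally show ?thesis .
qed

lemma variation_norm_le:
  assumes "0 < r" "\<And>N u. partition_points T N u \<Longrightarrow> (\<Sum>i<N. norm (Z (u (Suc i)) - Z (u i)) powr r) \<le> B" "0 \<le> B"
  shows "variation_norm r T Z \<le> ennreal (B powr (1 / r))"
proof -
  define V where "V = (SUP (N, u) \<in> {(N, u). partition_points T N u}. ennreal (\<Sum>i<N. norm (Z (u (Suc i)) - Z (u i)) powr r))"
  have V: "V \<le> ennreal B"
    unfolding V_def by (rule SUP_least) (use assms in \<open>auto intro!: ennreal_leI\<close>)
  have fin: "V \<noteq> \<infinity>" using neq_top_trans[OF ennreal_neq_top V] by simp
  have "enn2real V \<le> B" using V assms by (intro enn2real_leI) auto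
  then have "enn2real V powr (1 / r) \<le> B powr (1 / r)" using assms by (intro powr_mono2) auto
  then show ?thesis
    unfolding variation_norm_def V_def[symmetric] ennreal_powr_def using fin by (auto intro: ennreal_leI)
qed

text \<open>Here \<open>z\<close> is constant between the points of a grid of mesh \<open>h\<close> to which \<open>\<eta>\<close> rounds down, and it is within
  \<open>A h\<^bsup>a\<^esup>\<close> of the Hoelder path \<open>y\<close> at these points. Increments of \<open>z - y\<close> are small, of order \<open>h\<^bsup>a\<^esup>\<close>, and they
  are also controlled by \<open>|t - s|\<^bsup>a\<^esup> + |\<eta> t - \<eta> s|\<^bsup>a\<^esup>\<close>: where \<open>z\<close> moves at all, \<open>|\<eta> t - \<eta> s|\<close> is at least \<open>h\<close> and
  absorbs the approximation error. The first estimate is used with power \<open>p' - p\<close> and the second with power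
  \<open>p\<close>, where \<open>a p \<ge> 1\<close> makes the sum over a partition bounded.\<close>

lemma variation_interpolation:
  fixes y z :: "real \<Rightarrow> 'a::real_normed_vector" and \<eta> :: "real \<Rightarrow> real"
  assumes T: "0 < T" and h: "0 < h" and a: "0 < a" and A: "0 \<le> A" and p: "0 < p" "1 \<le> a * p" "p < p'"
    and y: "\<And>s t. s \<in> {0..T} \<Longrightarrow> t \<in> {0..T} \<Longrightarrow> norm (y t - y s) \<le> A * \<bar>t - s\<bar> powr a"
    and \<eta>: "\<And>t. t \<in> {0..T} \<Longrightarrow> \<eta> t \<in> {0..T} \<and> t - h \<le> \<eta> t \<and> \<eta> t \<le> t"
    and \<eta>_mono: "\<And>s t. s \<in> {0..T} \<Longrightarrow> t \<in> {0..T} \<Longrightarrow> s \<le> t \<Longrightarrow> \<eta> s \<le> \<eta> t"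
    and \<eta>_sep: "\<And>s t. s \<in> {0..T} \<Longrightarrow> t \<in> {0..T} \<Longrightarrow> \<eta> s \<noteq> \<eta> t \<Longrightarrow> h \<le> \<bar>\<eta> t - \<eta> s\<bar>"
    and z: "\<And>t. t \<in> {0..T} \<Longrightarrow> z t = z (\<eta> t)"
    and zy: "\<And>t. t \<in> {0..T} \<Longrightarrow> norm (z (\<eta> t) - y (\<eta> t)) \<le> A * h powr a"
  shows "variation_norm p' T (\<lambda>t. z t - y t)
    \<le> ennreal (((4 * A * h powr a) powr (p' - p) * ((4 * A) powr p * (2 powr p * (2 * T powr (a * p))))) powr (1 / p'))"
proof (rule variation_norm_le)
  show "0 < p'" using p by simp
  fix N u assume "partition_points T N u"
  then have u: "u 0 = 0" "u N = T" "\<And>i. i < N \<Longrightarrow> u i < u (Suc i)" by (auto simp: partition_points_def)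
  have le: "i \<le> j \<Longrightarrow> j \<le> N \<Longrightarrow> u i \<le> u j" for i j
    by (rule increasing_le[of N u, OF less_imp_le[OF u(3)]])
  have uT: "u i \<in> {0..T}" if "i \<le> N" for i using le[of 0 i] le[of i N] u that by auto
  let ?e = "\<lambda>t. z t - y t"
  have sup: "norm (?e t) \<le> 2 * A * h powr a" if t: "t \<in> {0..T}" for t
  proof -
    have "norm (?e t) \<le> norm (z (\<eta> t) - y (\<eta> t)) + norm (y t - y (\<eta> t))"
      using z[OF t] norm_triangle_ineq4[of "z (\<eta> t) - y (\<eta> t)" "y t - y (\<eta> t)"] by simp
    also have "norm (y t - y (\<eta> t)) \<le> A * \<bar>t - \<eta> t\<bar> powr a" using \<eta>[OF t] t by (intro y) auto
    also have "\<dots> \<le> A * h powr a" using \<eta>[OF t] a A by (intro mult_left_mono powr_mono2) auto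
    finally show ?thesis using zy[OF t] by simp
  qed
  have d1: "norm (?e t - ?e s) \<le> 4 * A * h powr a" if "s \<in> {0..T}" "t \<in> {0..T}" for s t
    using norm_triangle_ineq4[of "?e t" "?e s"] sup[OF that(1)] sup[OF that(2)] by linarith
  have d2: "norm (?e t - ?e s) \<le> 4 * A * (\<bar>t - s\<bar> powr a + \<bar>\<eta> t - \<eta> s\<bar> powr a)" if s: "s \<in> {0..T}" and t: "t \<in> {0..T}" for s t
  proof -
    have "norm (z t - z s) \<le> 3 * A * \<bar>\<eta> t - \<eta> s\<bar> powr a"
    proof (cases "\<eta> s = \<eta> t")
      case True
      then show ?thesis using z[OF s] z[OF t] by simp
    next
      case False
      have "norm (z t - z s) = norm ((z (\<eta> t) - y (\<eta> t)) - (z (\<eta> s) - y (\<eta> s)) + (y (\<eta> t) - y (\<eta> s)))"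
        using z[OF s] z[OF t] by simp
      also have "\<dots> \<le> norm (z (\<eta> t) - y (\<eta> t)) + norm (z (\<eta> s) - y (\<eta> s)) + norm (y (\<eta> t) - y (\<eta> s))"
        by (intro norm_triangle_le add_right_mono norm_triangle_ineq4)
      also have "\<dots> \<le> A * h powr a + A * h powr a + A * \<bar>\<eta> t - \<eta> s\<bar> powr a"
        using \<eta>[OF s] \<eta>[OF t] by (intro add_mono zy y s t) auto
      also have "A * h powr a \<le> A * \<bar>\<eta> t - \<eta> s\<bar> powr a"
        using \<eta>_sep[OF s t False] A a h by (intro mult_left_mono powr_mono2) auto
      finally show ?thesis by simp
    qed
    moreover have "norm (y t - y s) \<le> A * \<bar>t - s\<bar> powr a" by (rule y[OF s t])
    moreover have "norm (?e t - ?e s) \<le> norm (z t - z s) + norm (y t - y s)"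
      using norm_triangle_ineq4[of "z t - z s" "y t - y s"] by (simp add: algebra_simps)
    moreover have "0 \<le> A * \<bar>\<eta> t - \<eta> s\<bar> powr a" "0 \<le> A * \<bar>t - s\<bar> powr a" using A by auto
    ultimately show ?thesis by (simp add: algebra_simps)
  qed
  have "(\<Sum>i<N. norm (?e (u (Suc i)) - ?e (u i)) powr p')
      \<le> (\<Sum>i<N. (4 * A * h powr a) powr (p' - p) * ((4 * A) powr p * (2 powr p *
          (\<bar>u (Suc i) - u i\<bar> powr (a * p) + \<bar>\<eta> (u (Suc i)) - \<eta> (u i)\<bar> powr (a * p)))))"
  proof (rule sum_mono)
    fix i assume "i \<in> {..<N}"
    then have st: "u i \<in> {0..T}" "u (Suc i) \<in> {0..T}" using uT by auto
    let ?d = "norm (?e (u (Suc i)) - ?e (u i))"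
    have "?d powr p' = ?d powr (p' - p) * ?d powr p" by (simp add: powr_add[symmetric])
    also have "\<dots> \<le> (4 * A * h powr a) powr (p' - p) *
        (4 * A * (\<bar>u (Suc i) - u i\<bar> powr a + \<bar>\<eta> (u (Suc i)) - \<eta> (u i)\<bar> powr a)) powr p"
      using p by (intro mult_mono powr_mono2 d1 d2 st) auto
    also have "\<dots> = (4 * A * h powr a) powr (p' - p) *
        ((4 * A) powr p * (\<bar>u (Suc i) - u i\<bar> powr a + \<bar>\<eta> (u (Suc i)) - \<eta> (u i)\<bar> powr a) powr p)"
      by (simp only: powr_mult)
    also have "\<dots> \<le> (4 * A * h powr a) powr (p' - p) * ((4 * A) powr p * (2 powr p *
          (\<bar>u (Suc i) - u i\<bar> powr (a * p) + \<bar>\<eta> (u (Suc i)) - \<eta> (u i)\<bar> powr (a * p))))"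
      using add_powr_le[of "\<bar>u (Suc i) - u i\<bar> powr a" "\<bar>\<eta> (u (Suc i)) - \<eta> (u i)\<bar> powr a" p] p
      by (intro mult_left_mono) (auto simp: powr_powr)
    finally show "?d powr p' \<le> \<dots>" .
  qed
  also have "\<dots> = (4 * A * h powr a) powr (p' - p) * ((4 * A) powr p * (2 powr p *
      ((\<Sum>i<N. \<bar>u (Suc i) - u i\<bar> powr (a * p)) + (\<Sum>i<N. \<bar>\<eta> (u (Suc i)) - \<eta> (u i)\<bar> powr (a * p)))))"
    by (simp only: sum_distrib_left[symmetric] sum.distrib)
  also have "\<dots> \<le> (4 * A * h powr a) powr (p' - p) * ((4 * A) powr p * (2 powr p * (2 * T powr (a * p))))"
  proof (intro mult_left_mono)
    have "(\<Sum>i<N. \<bar>u (Suc i) - u i\<bar> powr (a * p)) \<le> T powr (a * p)"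
      by (rule sum_increments_powr_le) (use u T p in \<open>auto intro: less_imp_le\<close>)
    moreover have "(\<Sum>i<N. \<bar>\<eta> (u (Suc i)) - \<eta> (u i)\<bar> powr (a * p)) \<le> T powr (a * p)"
    proof (rule sum_increments_powr_le[where w = "\<lambda>i. \<eta> (u i)"])
      show "\<eta> (u i) \<le> \<eta> (u (Suc i))" if "i < N" for i
        using that u(3)[OF that] by (intro \<eta>_mono uT) auto
    qed (use \<eta>[OF uT[of 0]] \<eta>[OF uT[of N]] T p in auto)
    ultimately show "(\<Sum>i<N. \<bar>u (Suc i) - u i\<bar> powr (a * p)) + (\<Sum>i<N. \<bar>\<eta> (u (Suc i)) - \<eta> (u i)\<bar> powr (a * p)) \<le> 2 * T powr (a * p)"
      by simp
  qed auto
  finally show "(\<Sum>i<N. norm (?e (u (Suc i)) - ?e (u i)) powr p')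
      \<le> (4 * A * h powr a) powr (p' - p) * ((4 * A) powr p * (2 powr p * (2 * T powr (a * p))))" .
qed simp

section \<open>A stochastic Gronwall estimate for the logarithm\<close>

lemma ln_powr_absorb:
  assumes "1 \<le> n" "0 \<le> c" "0 < \<epsilon>"
  shows "(c + 3 * ln (real n)) * real n powr (- \<epsilon>) \<le> c + 3 / \<epsilon>"
proof -
  have n1: "1 \<le> real n" using assms by simp
  have "ln (real n) * real n powr (- \<epsilon>) \<le> (real n powr \<epsilon> / \<epsilon>) * real n powr (- \<epsilon>)"
    using ln_powr_bound[OF n1 assms(3)] by (intro mult_right_mono) auto
  also have "\<dots> = 1 / \<epsilon>" using n1 by (simp add: powr_minus)
  finally have "3 * (ln (real n) * real n powr (- \<epsilon>)) \<le> 3 / \<epsilon>" by simp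
  moreover have "c * real n powr (- \<epsilon>) \<le> c * 1"
    using n1 assms powr_mono[of "- \<epsilon>" 0 "real n"] by (intro mult_left_mono) auto
  ultimately show ?thesis by (simp add: algebra_simps)
qed

lemma ln_lyapunov_step:
  fixes e v :: "'a::real_inner"
  assumes "0 < \<delta>"
  shows "ln ((norm (e + v))\<^sup>2 + \<delta>\<^sup>2) \<le> ln ((norm e)\<^sup>2 + \<delta>\<^sup>2) + (2 * (e \<bullet> v) + (norm v)\<^sup>2) / ((norm e)\<^sup>2 + \<delta>\<^sup>2)"
proof -
  let ?V = "(norm e)\<^sup>2 + \<delta>\<^sup>2" and ?V' = "(norm (e + v))\<^sup>2 + \<delta>\<^sup>2"
  have pos: "0 < ?V" "0 < ?V'" using assms by (auto intro: add_nonneg_pos)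
  have "ln ?V' - ln ?V = ln (?V' / ?V)" using ln_divide_pos[OF pos(2,1)] by simp
  also have "\<dots> \<le> ?V' / ?V - 1" by (intro ln_le_minus_one divide_pos_pos pos)
  also have "\<dots> = (2 * (e \<bullet> v) + (norm v)\<^sup>2) / ?V"
  proof -
    have "?V' = ?V + (2 * (e \<bullet> v) + (norm v)\<^sup>2)"
      by (simp add: power2_norm_eq_inner inner_add_left inner_add_right inner_commute)
    moreover have "(x + c) / x - 1 = c / x" if "0 < x" for x c :: real using that by (simp add: field_simps)
    ultimately show ?thesis using pos(1) by (simp only:)
  qed
  finally show ?thesis by simp
qed

lemma sum_sq_le: "(x + y)\<^sup>2 \<le> 2 * x\<^sup>2 + 2 * (y::real)\<^sup>2"
  using zero_le_power2[of "x - y"] by (simp add: power2_eq_square algebra_simps)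

text \<open>In the application \<open>e\<close> is the error at the grid points, \<open>d\<close> the drift part and \<open>m\<close> the martingale part of
  its increments, \<open>En\<close> the energy that compensates \<open>m\<close>, \<open>w\<close> the norm of the Brownian increments, and \<open>r\<close> bounds
  the one-step remainders. Since \<open>ln (1 + x) \<le> x\<close>, the increment of \<open>ln V\<close> is at most
  \<open>(2 e \<bullet> (d + m) + |d + m|\<^sup>2) / V\<close>. Here every factor \<open>|e|\<^sup>2\<close>, \<open>|e| \<delta>\<close> or \<open>\<delta>\<^sup>2\<close> is absorbed by \<open>V\<close>: the drift
  contributes \<open>O(h)\<close> per step, the square of \<open>m\<close> contributes \<open>r\<^sup>2 / \<delta>\<^sup>2 + L\<^sup>2 w\<^sup>2\<close>, and the compensator of the
  martingale term is again \<open>O(h)\<close>.\<close>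

lemma stochastic_log_gronwall:
  fixes e d m :: "nat \<Rightarrow> 'a::real_inner" and w En :: "nat \<Rightarrow> real"
  defines "V \<equiv> \<lambda>\<delta> j. (norm (e j))\<^sup>2 + \<delta>\<^sup>2"
  assumes h: "0 \<le> h" "real n * h = T" "h \<le> T" and L: "0 \<le> L" and G: "0 \<le> G" and \<delta>: "0 < \<delta>" and \<theta>: "0 < \<theta>"
    and rec: "\<And>j. j < n \<Longrightarrow> e (Suc j) = e j + (d j + m j)" and e0: "e 0 = 0"
    and d: "\<And>j. j < n \<Longrightarrow> norm (d j) \<le> h * (L * (G * \<delta> + norm (e j)))"
    and mart: "\<And>J. J \<le> n \<Longrightarrow> (\<Sum>j<J. \<theta> * (2 * (e j \<bullet> m j) / V \<delta> j) - (\<theta> * (2 * norm (e j) / V \<delta> j))\<^sup>2 * En j) \<le> R"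
    and En: "\<And>j. j < n \<Longrightarrow> En j \<le> (L * (G * \<delta> + norm (e j)))\<^sup>2 * h"
    and m: "\<And>j. j < n \<Longrightarrow> norm (m j) \<le> r + L * norm (e j) * w j"
    and r: "0 \<le> r" "real n * r\<^sup>2 \<le> G2 * \<delta>\<^sup>2" and w: "\<And>j. j < n \<Longrightarrow> 0 \<le> w j" and Q: "(\<Sum>j<n. (w j)\<^sup>2) \<le> Q"
    and J: "J \<le> n"
  shows "norm (e J) \<le> \<delta> * exp ((T * L * (G + 2) + 4 * T\<^sup>2 * L\<^sup>2 * (G\<^sup>2 + 1) + 4 * G2 + 4 * L\<^sup>2 * Q + R / \<theta> + 8 * \<theta> * T * L\<^sup>2 * (G\<^sup>2 + 1)) / 2)"
proof -
  have V: "0 < V \<delta> j" "(norm (e j))\<^sup>2 \<le> V \<delta> j" "\<delta>\<^sup>2 \<le> V \<delta> j" for j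
    using \<delta> unfolding V_def by (auto intro: add_nonneg_pos)
  have sq: "(G * \<delta> + norm (e j))\<^sup>2 \<le> 2 * (G\<^sup>2 + 1) * V \<delta> j" for j
  proof -
    have "(G * \<delta> + norm (e j))\<^sup>2 \<le> 2 * (G * \<delta>)\<^sup>2 + 2 * (norm (e j))\<^sup>2" by (rule sum_sq_le)
    also have "\<dots> = 2 * G\<^sup>2 * \<delta>\<^sup>2 + 2 * (norm (e j))\<^sup>2" by (simp add: power_mult_distrib)
    also have "\<dots> \<le> 2 * G\<^sup>2 * V \<delta> j + 2 * V \<delta> j" using V by (intro add_mono mult_left_mono) auto
    finally show ?thesis by (simp add: algebra_simps)
  qed
  have drift: "2 * (e j \<bullet> d j) / V \<delta> j \<le> h * (L * (G + 2))" if j: "j < n" for j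
  proof -
    have "e j \<bullet> d j \<le> norm (e j) * (h * (L * (G * \<delta> + norm (e j))))"
      using norm_cauchy_schwarz[of "e j" "d j"] mult_left_mono[OF d[OF j], of "norm (e j)"] by simp
    then have "2 * (e j \<bullet> d j) \<le> h * L * (G * (2 * norm (e j) * \<delta>) + 2 * (norm (e j))\<^sup>2)"
      by (simp add: power2_eq_square algebra_simps)
    also have "\<dots> \<le> h * L * (G * V \<delta> j + 2 * V \<delta> j)"
      using h L G V[of j] sum_squares_bound[of "norm (e j)" \<delta>]
      by (intro mult_left_mono add_mono) (auto simp: V_def)
    finally show ?thesis using V(1)[of j] by (simp add: pos_divide_le_eq algebra_simps)
  qed
  have d2: "(norm (d j))\<^sup>2 / V \<delta> j \<le> h * (2 * T * L\<^sup>2 * (G\<^sup>2 + 1))" if j: "j < n" for j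
  proof -
    have "(norm (d j))\<^sup>2 \<le> (h * (L * (G * \<delta> + norm (e j))))\<^sup>2" by (intro power_mono d j) simp
    also have "\<dots> = h\<^sup>2 * L\<^sup>2 * (G * \<delta> + norm (e j))\<^sup>2" by (simp add: power_mult_distrib)
    also have "\<dots> \<le> h\<^sup>2 * L\<^sup>2 * (2 * (G\<^sup>2 + 1) * V \<delta> j)" by (intro mult_left_mono sq) simp
    finally have "(norm (d j))\<^sup>2 / V \<delta> j \<le> h\<^sup>2 * L\<^sup>2 * (2 * (G\<^sup>2 + 1))"
      using V(1)[of j] by (simp add: pos_divide_le_eq mult.assoc)
    also have "\<dots> = (h * h) * (L\<^sup>2 * (2 * (G\<^sup>2 + 1)))" by (simp add: power2_eq_square)
    also have "\<dots> \<le> (h * T) * (L\<^sup>2 * (2 * (G\<^sup>2 + 1)))" using h by (intro mult_right_mono mult_left_mono) auto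
    finally show ?thesis by (simp only: mult_ac)
  qed
  have m2: "(norm (m j))\<^sup>2 / V \<delta> j \<le> 2 * r\<^sup>2 / \<delta>\<^sup>2 + 2 * L\<^sup>2 * (w j)\<^sup>2" if j: "j < n" for j
  proof -
    have "(norm (m j))\<^sup>2 \<le> (r + L * norm (e j) * w j)\<^sup>2" by (intro power_mono m j) simp
    also have "\<dots> \<le> 2 * r\<^sup>2 + 2 * (L * norm (e j) * w j)\<^sup>2" by (rule sum_sq_le)
    also have "\<dots> = (2 * r\<^sup>2 / \<delta>\<^sup>2) * \<delta>\<^sup>2 + (2 * L\<^sup>2 * (w j)\<^sup>2) * (norm (e j))\<^sup>2"
      using \<delta> by (simp add: power_mult_distrib)
    also have "\<dots> \<le> (2 * r\<^sup>2 / \<delta>\<^sup>2) * V \<delta> j + (2 * L\<^sup>2 * (w j)\<^sup>2) * V \<delta> j"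
      using V by (intro add_mono mult_left_mono) auto
    finally show ?thesis using V(1)[of j] by (simp add: pos_divide_le_eq algebra_simps)
  qed
  have quad: "(norm (d j + m j))\<^sup>2 / V \<delta> j \<le> 2 * ((norm (d j))\<^sup>2 / V \<delta> j) + 2 * ((norm (m j))\<^sup>2 / V \<delta> j)" for j
  proof -
    have "(norm (d j + m j))\<^sup>2 \<le> (norm (d j) + norm (m j))\<^sup>2" by (intro power_mono norm_triangle_ineq) simp
    also have "\<dots> \<le> 2 * (norm (d j))\<^sup>2 + 2 * (norm (m j))\<^sup>2" by (rule sum_sq_le)
    finally show ?thesis using V(1)[of j] by (simp add: pos_divide_le_eq add_divide_distrib[symmetric])
  qed
  have pen: "(\<theta> * (2 * norm (e j) / V \<delta> j))\<^sup>2 * En j \<le> \<theta>\<^sup>2 * (h * (8 * L\<^sup>2 * (G\<^sup>2 + 1)))" if j: "j < n" for j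
  proof -
    have "(2 * norm (e j) / V \<delta> j)\<^sup>2 * En j \<le> (2 * norm (e j) / V \<delta> j)\<^sup>2 * ((L * (G * \<delta> + norm (e j)))\<^sup>2 * h)"
      by (intro mult_left_mono En j) simp
    also have "\<dots> = (4 * L\<^sup>2 * h / (V \<delta> j * V \<delta> j)) * ((norm (e j))\<^sup>2 * (G * \<delta> + norm (e j))\<^sup>2)"
      by (simp add: power_mult_distrib power_divide power2_eq_square)
    also have "\<dots> \<le> (4 * L\<^sup>2 * h / (V \<delta> j * V \<delta> j)) * (V \<delta> j * (2 * (G\<^sup>2 + 1) * V \<delta> j))"
      using V[of j] h sq by (intro mult_left_mono mult_mono) auto
    also have "\<dots> = h * (8 * L\<^sup>2 * (G\<^sup>2 + 1))" using V(1)[of j] by simp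
    finally have "\<theta>\<^sup>2 * ((2 * norm (e j) / V \<delta> j)\<^sup>2 * En j) \<le> \<theta>\<^sup>2 * (h * (8 * L\<^sup>2 * (G\<^sup>2 + 1)))"
      by (intro mult_left_mono) auto
    then show ?thesis by (simp only: power_mult_distrib mult.assoc)
  qed
  have hJ: "(\<Sum>j<J. h * c) \<le> T * c" if "0 \<le> c" for c
  proof -
    have "(\<Sum>j<J. h * c) = (real J * h) * c" by simp
    also have "\<dots> \<le> (real n * h) * c" using J h that by (intro mult_right_mono) auto
    finally show ?thesis using h by simp
  qed
  have S1: "(\<Sum>j<J. 2 * (e j \<bullet> d j) / V \<delta> j) \<le> T * L * (G + 2)"
  proof -
    have "(\<Sum>j<J. 2 * (e j \<bullet> d j) / V \<delta> j) \<le> (\<Sum>j<J. h * (L * (G + 2)))" using J by (intro sum_mono drift) auto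
    also have "\<dots> \<le> T * (L * (G + 2))" using L G by (intro hJ) auto
    finally show ?thesis by simp
  qed
  have S2: "(\<Sum>j<J. 2 * (e j \<bullet> m j) / V \<delta> j) \<le> R / \<theta> + 8 * \<theta> * T * L\<^sup>2 * (G\<^sup>2 + 1)"
  proof -
    have "\<theta> * (\<Sum>j<J. 2 * (e j \<bullet> m j) / V \<delta> j) \<le> R + (\<Sum>j<J. (\<theta> * (2 * norm (e j) / V \<delta> j))\<^sup>2 * En j)"
      using mart[OF J] unfolding sum_subtractf sum_distrib_left by simp
    also have "(\<Sum>j<J. (\<theta> * (2 * norm (e j) / V \<delta> j))\<^sup>2 * En j) \<le> (\<Sum>j<J. \<theta>\<^sup>2 * (h * (8 * L\<^sup>2 * (G\<^sup>2 + 1))))"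
      using J by (intro sum_mono pen) auto
    also have "\<dots> = \<theta>\<^sup>2 * (\<Sum>j<J. h * (8 * L\<^sup>2 * (G\<^sup>2 + 1)))" by (rule sum_distrib_left[symmetric])
    also have "\<dots> \<le> \<theta>\<^sup>2 * (T * (8 * L\<^sup>2 * (G\<^sup>2 + 1)))" by (intro mult_left_mono hJ) auto
    finally have "(\<Sum>j<J. 2 * (e j \<bullet> m j) / V \<delta> j) * \<theta> \<le> R + \<theta>\<^sup>2 * (T * (8 * L\<^sup>2 * (G\<^sup>2 + 1)))" by (simp add: mult.commute)
    then have "(\<Sum>j<J. 2 * (e j \<bullet> m j) / V \<delta> j) \<le> (R + \<theta>\<^sup>2 * (T * (8 * L\<^sup>2 * (G\<^sup>2 + 1)))) / \<theta>"
      using \<theta> by (simp only: pos_le_divide_eq)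
    also have "\<dots> = R / \<theta> + 8 * \<theta> * T * L\<^sup>2 * (G\<^sup>2 + 1)" using \<theta> by (simp add: add_divide_distrib power2_eq_square)
    finally show ?thesis .
  qed
  have S3: "(\<Sum>j<J. (norm (d j + m j))\<^sup>2 / V \<delta> j) \<le> 4 * T\<^sup>2 * L\<^sup>2 * (G\<^sup>2 + 1) + 4 * G2 + 4 * L\<^sup>2 * Q"
  proof -
    have "(\<Sum>j<J. (norm (d j + m j))\<^sup>2 / V \<delta> j)
        \<le> (\<Sum>j<J. 2 * (h * (2 * T * L\<^sup>2 * (G\<^sup>2 + 1))) + 2 * (2 * r\<^sup>2 / \<delta>\<^sup>2 + 2 * L\<^sup>2 * (w j)\<^sup>2))"
      using J d2 m2 by (intro sum_mono order_trans[OF quad] add_mono mult_left_mono) auto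
    also have "\<dots> = 2 * (\<Sum>j<J. h * (2 * T * L\<^sup>2 * (G\<^sup>2 + 1))) + real J * (4 * r\<^sup>2 / \<delta>\<^sup>2) + 4 * L\<^sup>2 * (\<Sum>j<J. (w j)\<^sup>2)"
      by (simp add: sum.distrib sum_distrib_left algebra_simps)
    also have "\<dots> \<le> 2 * (T * (2 * T * L\<^sup>2 * (G\<^sup>2 + 1))) + 4 * G2 + 4 * L\<^sup>2 * Q"
    proof (intro add_mono mult_left_mono)
      have "0 \<le> T" using h by simp
      then show "(\<Sum>j<J. h * (2 * T * L\<^sup>2 * (G\<^sup>2 + 1))) \<le> T * (2 * T * L\<^sup>2 * (G\<^sup>2 + 1))" by (intro hJ) auto
      have "real J * (4 * r\<^sup>2 / \<delta>\<^sup>2) \<le> real n * (4 * r\<^sup>2 / \<delta>\<^sup>2)" using J by (intro mult_right_mono) auto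
      also have "\<dots> = 4 * (real n * r\<^sup>2) / \<delta>\<^sup>2" by simp
      also have "\<dots> \<le> 4 * (G2 * \<delta>\<^sup>2) / \<delta>\<^sup>2" using r by (intro divide_right_mono mult_left_mono) auto
      finally show "real J * (4 * r\<^sup>2 / \<delta>\<^sup>2) \<le> 4 * G2" using \<delta> by simp
      have "(\<Sum>j<J. (w j)\<^sup>2) \<le> (\<Sum>j<n. (w j)\<^sup>2)" using J by (intro sum_mono2) auto
      then show "(\<Sum>j<J. (w j)\<^sup>2) \<le> Q" using Q by simp
    qed auto
    finally show ?thesis by (simp add: power2_eq_square mult_ac)
  qed
  have "J' \<le> J \<Longrightarrow> ln (V \<delta> J') \<le> ln (\<delta>\<^sup>2) + (\<Sum>j<J'. (2 * (e j \<bullet> (d j + m j)) + (norm (d j + m j))\<^sup>2) / V \<delta> j)" for J'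
  proof (induction J')
    case 0
    then show ?case by (simp add: V_def e0)
  next
    case (Suc j)
    have "ln (V \<delta> (Suc j)) \<le> ln (V \<delta> j) + (2 * (e j \<bullet> (d j + m j)) + (norm (d j + m j))\<^sup>2) / V \<delta> j"
      using ln_lyapunov_step[OF \<delta>, of "e j" "d j + m j"] rec[of j] Suc.prems J by (simp add: V_def)
    then show ?case using Suc by simp
  qed
  from this[of J] have "ln (V \<delta> J) \<le> ln (\<delta>\<^sup>2) + (\<Sum>j<J. (2 * (e j \<bullet> (d j + m j)) + (norm (d j + m j))\<^sup>2) / V \<delta> j)" by simp
  also have "(\<Sum>j<J. (2 * (e j \<bullet> (d j + m j)) + (norm (d j + m j))\<^sup>2) / V \<delta> j)
      = (\<Sum>j<J. 2 * (e j \<bullet> d j) / V \<delta> j) + (\<Sum>j<J. 2 * (e j \<bullet> m j) / V \<delta> j) + (\<Sum>j<J. (norm (d j + m j))\<^sup>2 / V \<delta> j)"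
    by (simp only: inner_add_right distrib_left add_divide_distrib sum.distrib)
  finally have lnV: "ln (V \<delta> J) \<le> ln (\<delta>\<^sup>2) + (T * L * (G + 2) + 4 * T\<^sup>2 * L\<^sup>2 * (G\<^sup>2 + 1) + 4 * G2 + 4 * L\<^sup>2 * Q + R / \<theta> + 8 * \<theta> * T * L\<^sup>2 * (G\<^sup>2 + 1))"
    (is "_ \<le> _ + ?K") using S1 S2 S3 by linarith
  have "(norm (e J))\<^sup>2 \<le> exp (ln (V \<delta> J))" using V by simp
  also have "\<dots> \<le> exp (ln (\<delta>\<^sup>2) + ?K)" using lnV by simp
  also have "\<dots> = (\<delta> * exp (?K / 2))\<^sup>2"
  proof -
    have "exp (ln (\<delta>\<^sup>2) + k) = (\<delta> * exp (k / 2))\<^sup>2" for k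
      using \<delta> exp_double[of "k / 2"] by (simp add: exp_add power_mult_distrib)
    then show ?thesis .
  qed
  finally show ?thesis
    by (rule power2_le_imp_le) (use \<delta> in simp)
qed

section \<open>Almost sure bounds with measurable random constants\<close>

text \<open>Summing \<open>n\<^sup>-\<^sup>3 exp Z\<^sub>n\<^sub>,\<^sub>i\<close> over all \<open>n\<close> and \<open>i \<le> n\<close> gives an integrable, hence almost surely finite, random
  variable that dominates each of its terms; take logarithms. The weight \<open>n\<^sup>-\<^sup>3\<close> leaves \<open>\<Sum> n\<^sup>-\<^sup>2\<close> after the sum
  over the \<open>n + 1\<close> values of \<open>i\<close>.\<close>

lemma (in prob_space) exponential_union_bound:
  fixes Z :: "nat \<Rightarrow> nat \<Rightarrow> 'a \<Rightarrow> real"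
  assumes Z: "\<And>n i. 1 \<le> n \<Longrightarrow> i \<le> n \<Longrightarrow> Z n i \<in> borel_measurable M"
    and bound: "\<And>n i. 1 \<le> n \<Longrightarrow> i \<le> n \<Longrightarrow> (\<integral>\<^sup>+\<omega>. ennreal (exp (Z n i \<omega>)) \<partial>M) \<le> 1"
  obtains S where "S \<in> borel_measurable M"
    "AE \<omega> in M. \<forall>n\<ge>1. \<forall>i\<le>n. Z n i \<omega> \<le> S \<omega> + 3 * ln (real n)"
proof -
  let ?w = "\<lambda>n. 1 / real (Suc n) ^ 3"
  define G where "G \<omega> = (\<Sum>n. \<Sum>i\<le>Suc n. ennreal (?w n) * ennreal (exp (Z (Suc n) i \<omega>)))" for \<omega>
  have mt: "(\<lambda>\<omega>. ennreal (?w n) * ennreal (exp (Z (Suc n) i \<omega>))) \<in> borel_measurable M" if "i \<le> Suc n" for n i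
    using Z[of "Suc n" i] that by measurable
  have ms: "(\<lambda>\<omega>. \<Sum>i\<le>Suc n. ennreal (?w n) * ennreal (exp (Z (Suc n) i \<omega>))) \<in> borel_measurable M" for n
    by (intro borel_measurable_sum mt) simp
  have Gm: "G \<in> borel_measurable M"
    unfolding G_def[abs_def] by (intro borel_measurable_suminf_order ms)
  have "(\<integral>\<^sup>+\<omega>. G \<omega> \<partial>M) = (\<Sum>n. \<integral>\<^sup>+\<omega>. (\<Sum>i\<le>Suc n. ennreal (?w n) * ennreal (exp (Z (Suc n) i \<omega>))) \<partial>M)"
    unfolding G_def by (rule nn_integral_suminf[OF ms])
  also have "\<dots> \<le> (\<Sum>n. ennreal (2 * (1 / real (Suc n) ^ 2)))"
  proof (rule suminf_le)
    fix n
    have "(\<integral>\<^sup>+\<omega>. (\<Sum>i\<le>Suc n. ennreal (?w n) * ennreal (exp (Z (Suc n) i \<omega>))) \<partial>M)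
        = (\<Sum>i\<le>Suc n. \<integral>\<^sup>+\<omega>. ennreal (?w n) * ennreal (exp (Z (Suc n) i \<omega>)) \<partial>M)"
      by (rule nn_integral_sum[OF mt]) simp
    also have "\<dots> \<le> (\<Sum>i\<le>Suc n. ennreal (?w n))"
    proof (rule sum_mono)
      fix i assume i: "i \<in> {..Suc n}"
      have "(\<integral>\<^sup>+\<omega>. ennreal (?w n) * ennreal (exp (Z (Suc n) i \<omega>)) \<partial>M) = ennreal (?w n) * (\<integral>\<^sup>+\<omega>. ennreal (exp (Z (Suc n) i \<omega>)) \<partial>M)"
      proof (rule nn_integral_cmult)
        have [measurable]: "Z (Suc n) i \<in> borel_measurable M" using Z[of "Suc n" i] i by simp
        show "(\<lambda>\<omega>. ennreal (exp (Z (Suc n) i \<omega>))) \<in> borel_measurable M" by measurable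
      qed
      also have "\<dots> \<le> ennreal (?w n) * 1"
        using bound[of "Suc n" i] i by (intro mult_left_mono) auto
      finally show "(\<integral>\<^sup>+\<omega>. ennreal (?w n) * ennreal (exp (Z (Suc n) i \<omega>)) \<partial>M) \<le> ennreal (?w n)" by simp
    qed
    also have "\<dots> = ennreal (real (n + 2) * ?w n)"
      by (subst sum_ennreal) auto
    also have "\<dots> \<le> ennreal (2 * (1 / real (Suc n) ^ 2))"
    proof (rule ennreal_leI)
      have "real (n + 2) * ?w n \<le> (2 * real (Suc n)) * ?w n" by (intro mult_right_mono) auto
      also have "\<dots> = 2 * (1 / real (Suc n) ^ 2)"
      proof -
        have "(2 * x) * (1 / x ^ 3) = 2 * (1 / x ^ 2)" if "x > 0" for x :: real
          using that by (simp add: power2_eq_square power3_eq_cube)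
        from this[of "real (Suc n)"] show ?thesis by simp
      qed
      finally show "real (n + 2) * ?w n \<le> 2 * (1 / real (Suc n) ^ 2)" .
    qed
    finally show "(\<integral>\<^sup>+\<omega>. (\<Sum>i\<le>Suc n. ennreal (?w n) * ennreal (exp (Z (Suc n) i \<omega>))) \<partial>M) \<le> ennreal (2 * (1 / real (Suc n) ^ 2))" .
  qed auto
  also have "\<dots> < \<infinity>"
  proof -
    have "summable (\<lambda>n. 1 / real (Suc n) ^ 2)"
      using inverse_power_summable[of 2, where 'a = real] summable_Suc_iff[of "\<lambda>n. inverse (real n ^ 2)"]
      by (simp add: inverse_eq_divide)
    then have "summable (\<lambda>n. 2 * (1 / real (Suc n) ^ 2))" by (rule summable_mult)
    then show ?thesis by (subst suminf_ennreal2) auto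
  qed
  finally have "(\<integral>\<^sup>+\<omega>. G \<omega> \<partial>M) \<noteq> \<infinity>" by simp
  then have fin: "AE \<omega> in M. G \<omega> \<noteq> \<infinity>" by (rule nn_integral_PInf_AE[OF Gm])
  show thesis
  proof
    show "(\<lambda>\<omega>. ln (enn2real (G \<omega>) + 1)) \<in> borel_measurable M" using Gm by measurable
    show "AE \<omega> in M. \<forall>n\<ge>1. \<forall>i\<le>n. Z n i \<omega> \<le> ln (enn2real (G \<omega>) + 1) + 3 * ln (real n)"
      using fin
    proof eventually_elim
      case (elim \<omega>)
      show ?case
      proof safe
        fix n i :: nat assume n: "1 \<le> n" and i: "i \<le> n"
        obtain m where m: "n = Suc m" using n by (cases n) auto
        have "ennreal (?w m) * ennreal (exp (Z n i \<omega>)) \<le> (\<Sum>i\<le>Suc m. ennreal (?w m) * ennreal (exp (Z (Suc m) i \<omega>)))"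
          using member_le_sum[of i "{..Suc m}" "\<lambda>i. ennreal (?w m) * ennreal (exp (Z (Suc m) i \<omega>))"] i
          unfolding m by simp
        also have "\<dots> \<le> G \<omega>"
          unfolding G_def using sum_le_suminf[OF summableI, of "{m}" "\<lambda>n. \<Sum>i\<le>Suc n. ennreal (?w n) * ennreal (exp (Z (Suc n) i \<omega>))"] by simp
        also have "\<dots> = ennreal (enn2real (G \<omega>))" using elim by (simp add: less_top)
        finally have "?w m * exp (Z n i \<omega>) \<le> enn2real (G \<omega>)"
          by (simp add: ennreal_mult[symmetric])
        then have "exp (Z n i \<omega>) \<le> real n ^ 3 * enn2real (G \<omega>)" using m by (simp add: field_simps)
        also have "\<dots> \<le> real n ^ 3 * (enn2real (G \<omega>) + 1)" by (intro mult_left_mono) auto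
        finally have "ln (exp (Z n i \<omega>)) \<le> ln (real n ^ 3 * (enn2real (G \<omega>) + 1))"
          using n by (subst ln_le_cancel_iff) (auto intro!: mult_pos_pos add_nonneg_pos)
        also have "\<dots> = 3 * ln (real n) + ln (enn2real (G \<omega>) + 1)"
        proof -
          have "0 < enn2real (G \<omega>) + 1" by (rule add_nonneg_pos) auto
          then show ?thesis using n by (simp add: ln_mult ln_realpow)
        qed
        finally show "Z n i \<omega> \<le> ln (enn2real (G \<omega>) + 1) + 3 * ln (real n)" by simp
      qed
    qed
  qed
qed

context prob_space
begin

text \<open>The first argument of \<open>P\<close> is a constant in a pathwise estimate. Existence of such a constant for almost
  every \<open>\<omega>\<close> does not provide a measurable choice of it, so measurability is part of the notion. All larger
  constants are admitted as well, so that several estimates can share one constant.\<close>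

definition random_bound :: "(real \<Rightarrow> 'a \<Rightarrow> bool) \<Rightarrow> bool" where
  "random_bound P \<longleftrightarrow> (\<exists>S \<in> borel_measurable M. AE \<omega> in M. \<forall>s\<ge>S \<omega>. P s \<omega>)"

text \<open>How a deterministic implication between pathwise estimates is lifted. The constant for \<open>P\<close> may be replaced by
  the next natural number \<open>k\<close>, and \<open>k \<mapsto> c k\<close> is measurable whatever it is.\<close>

lemma random_bound_trans:
  assumes P: "random_bound P" and PQ: "\<And>s. 0 \<le> s \<Longrightarrow> \<exists>c. AE \<omega> in M. P s \<omega> \<longrightarrow> Q c \<omega>"
    and mono: "\<And>s s' \<omega>. s \<le> s' \<Longrightarrow> Q s \<omega> \<Longrightarrow> Q s' \<omega>"
  shows "random_bound Q"
proof -
  obtain S where S: "S \<in> borel_measurable M" "AE \<omega> in M. \<forall>s\<ge>S \<omega>. P s \<omega>"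
    using P unfolding random_bound_def by blast
  have "\<forall>k::nat. \<exists>c. AE \<omega> in M. P (real k) \<omega> \<longrightarrow> Q c \<omega>" using PQ by simp
  then obtain c where c: "\<And>k::nat. AE \<omega> in M. P (real k) \<omega> \<longrightarrow> Q (c k) \<omega>" by metis
  then have "AE \<omega> in M. \<forall>k. P (real k) \<omega> \<longrightarrow> Q (c k) \<omega>" by (simp add: AE_all_countable)
  then have "AE \<omega> in M. \<forall>s\<ge>c (nat \<lceil>S \<omega>\<rceil>). Q s \<omega>"
    using S(2)
  proof eventually_elim
    case (elim \<omega>)
    have "S \<omega> \<le> real (nat \<lceil>S \<omega>\<rceil>)" by linarith
    then show ?case using elim mono by blast
  qed
  moreover have "(\<lambda>\<omega>. c (nat \<lceil>S \<omega>\<rceil>)) \<in> borel_measurable M"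
  proof -
    have "(\<lambda>\<omega>. nat \<lceil>S \<omega>\<rceil>) \<in> measurable M (count_space UNIV)" using S(1) by measurable
    then show ?thesis by (rule measurable_compose) simp
  qed
  ultimately show ?thesis
    unfolding random_bound_def by (intro bexI[of _ "\<lambda>\<omega>. c (nat \<lceil>S \<omega>\<rceil>)"])
qed

lemma random_bound_weaken:
  assumes "random_bound P" "\<And>s \<omega>. P s \<omega> \<Longrightarrow> Q s \<omega>"
  shows "random_bound Q"
  using assms unfolding random_bound_def by (fast elim: eventually_mono)

lemma random_bound_conj:
  assumes "random_bound P" "random_bound Q"
  shows "random_bound (\<lambda>s \<omega>. P s \<omega> \<and> Q s \<omega>)"
proof -
  obtain S S' where S: "S \<in> borel_measurable M" "S' \<in> borel_measurable M"
    "AE \<omega> in M. \<forall>s\<ge>S \<omega>. P s \<omega>" "AE \<omega> in M. \<forall>s\<ge>S' \<omega>. Q s \<omega>"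
    using assms unfolding random_bound_def by blast
  have "AE \<omega> in M. \<forall>s\<ge>max (S \<omega>) (S' \<omega>). P s \<omega> \<and> Q s \<omega>"
    using S(3,4) by eventually_elim auto
  then show ?thesis
    unfolding random_bound_def using S(1,2) by (intro bexI[of _ "\<lambda>\<omega>. max (S \<omega>) (S' \<omega>)"]) auto
qed

lemma random_bound_finite:
  assumes "finite B" "\<And>b. b \<in> B \<Longrightarrow> random_bound (P b)"
  shows "random_bound (\<lambda>s \<omega>. \<forall>b\<in>B. P b s \<omega>)"
  using assms
proof (induction B rule: finite_induct)
  case empty
  then show ?case unfolding random_bound_def by (intro bexI[of _ "\<lambda>_. 0"]) auto
next
  case (insert b B)
  then have "random_bound (\<lambda>s \<omega>. P b s \<omega> \<and> (\<forall>b\<in>B. P b s \<omega>))" by (intro random_bound_conj) auto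
  then show ?case by simp
qed

lemma random_bound_exponential:
  assumes "\<And>n i. 1 \<le> n \<Longrightarrow> i \<le> n \<Longrightarrow> Z n i \<in> borel_measurable M"
    and "\<And>n i. 1 \<le> n \<Longrightarrow> i \<le> n \<Longrightarrow> (\<integral>\<^sup>+\<omega>. ennreal (exp (Z n i \<omega>)) \<partial>M) \<le> 1"
  shows "random_bound (\<lambda>s \<omega>. \<forall>n\<ge>1. \<forall>i\<le>n. Z n i \<omega> \<le> s + 3 * ln (real n))"
proof -
  obtain S where S: "S \<in> borel_measurable M" "AE \<omega> in M. \<forall>n\<ge>1. \<forall>i\<le>n. Z n i \<omega> \<le> S \<omega> + 3 * ln (real n)"
    by (rule exponential_union_bound[OF assms])
  from S(2) have "AE \<omega> in M. \<forall>s\<ge>S \<omega>. \<forall>n\<ge>1. \<forall>i\<le>n. Z n i \<omega> \<le> s + 3 * ln (real n)"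
    by eventually_elim (meson add_right_mono order_trans)
  then show ?thesis unfolding random_bound_def using S(1) by (intro bexI[of _ S])
qed

end

section \<open>The Euler scheme on the grid\<close>

lemma norm_le_of_directions:
  fixes x :: "'a::euclidean_space"
  assumes "\<And>v. v \<in> Basis \<union> uminus ` Basis \<Longrightarrow> v \<bullet> x \<le> R"
  shows "norm x \<le> real DIM('a) * R"
proof -
  have "\<bar>x \<bullet> u\<bar> \<le> R" if "u \<in> Basis" for u
    using assms[of u] assms[of "- u"] that by (simp add: abs_if inner_commute)
  then have "(\<Sum>u\<in>Basis. \<bar>x \<bullet> u\<bar>) \<le> (\<Sum>u\<in>(Basis :: 'a set). R)" by (rule sum_mono)
  then show ?thesis using norm_le_l1[of x] by simp
qed

lemma grid_0: "grid T n 0 = 0" by (simp add: grid_def)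

lemma grid_end: "1 \<le> n \<Longrightarrow> grid T n n = T" by (simp add: grid_def)

lemma grid_Suc_diff: "grid T n (Suc i) - grid T n i = T / real n"
  by (simp add: grid_def diff_divide_distrib[symmetric] algebra_simps)

lemma grid_mono: "0 \<le> T \<Longrightarrow> i \<le> j \<Longrightarrow> grid T n i \<le> grid T n j"
  unfolding grid_def by (intro divide_right_mono mult_right_mono) auto

lemma grid_le_iff: "0 < T \<Longrightarrow> 1 \<le> n \<Longrightarrow> grid T n i \<le> grid T n j \<longleftrightarrow> i \<le> j"
  by (simp add: grid_def divide_le_cancel)

lemma grid_in: "0 \<le> T \<Longrightarrow> i \<le> n \<Longrightarrow> 1 \<le> n \<Longrightarrow> 0 \<le> grid T n i \<and> grid T n i \<le> T"
  using grid_mono[of T 0 i n] grid_mono[of T i n n] by (simp add: grid_0 grid_end)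

lemma set_integral_increment_approx:
  fixes f :: "real \<Rightarrow> 'a::euclidean_space"
  assumes cont: "continuous_on {0..T} f" and st: "0 \<le> s" "s \<le> t" "t \<le> T"
    and B: "\<And>r. r \<in> {s..t} \<Longrightarrow> norm (f r - c) \<le> B"
  shows "norm ((LINT r:{0..t}|lborel. f r) - (LINT r:{0..s}|lborel. f r) - (t - s) *\<^sub>R c) \<le> B * (t - s)"
proof -
  have eq: "(LINT r:{0..u}|lborel. f r) = integral {0..u} f" if "u \<le> T" for u
    by (rule set_borel_integral_eq_integral(2)[OF borel_integrable_atLeastAtMost'])
      (rule continuous_on_subset[OF cont], use that in auto)
  have ct: "continuous_on {0..t} f" "continuous_on {s..t} f" using st by (auto intro: continuous_on_subset[OF cont])
  have "integral {0..s} f + integral {s..t} f = integral {0..t} f"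
    using st by (intro Henstock_Kurzweil_Integration.integral_combine integrable_continuous_real ct) auto
  then have "(LINT r:{0..t}|lborel. f r) - (LINT r:{0..s}|lborel. f r) - (t - s) *\<^sub>R c = integral {s..t} f - integral {s..t} (\<lambda>_. c)"
    using st by (simp add: eq algebra_simps)
  also have "\<dots> = integral {s..t} (\<lambda>r. f r - c)"
    by (intro Henstock_Kurzweil_Integration.integral_diff[symmetric] integrable_continuous_real ct) auto
  also have "norm \<dots> \<le> B * (t - s)"
    using st B by (intro integral_bound) (auto intro!: continuous_intros ct)
  finally show ?thesis .
qed

text \<open>The equation and its Euler schemes with the regularity of the coefficients spelled out by the constants \<open>K\<close>
  and \<open>L\<close>; \<open>X\<close> is the stochastic integral in the equation for \<open>Y\<close> and \<open>Z n\<close> the scheme with \<open>n\<close> steps.\<close>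

locale sde_euler = brownian_motion M F T W
  for M :: "'w measure" and F and T :: real and W :: "real \<Rightarrow> 'w \<Rightarrow> real ^ 'd" +
  fixes y0 :: "real ^ 'k"
    and b :: "real \<times> (real ^ 'k) \<Rightarrow> real ^ 'k"
    and \<sigma> :: "real \<times> (real ^ 'k) \<Rightarrow> (real ^ 'd) \<Rightarrow>\<^sub>L (real ^ 'k)"
    and X Y :: "real \<Rightarrow> 'w \<Rightarrow> real ^ 'k" and Z :: "nat \<Rightarrow> real \<Rightarrow> 'w \<Rightarrow> real ^ 'k"
    and K L :: real
  assumes T_pos: "0 < T" and L_pos: "0 < L"
    and b_cont: "continuous_on UNIV b" and \<sigma>_cont: "continuous_on UNIV \<sigma>"
    and b_le: "norm (b z) \<le> K" and \<sigma>_le: "norm (\<sigma> z) \<le> K"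
    and b_lip: "norm (b (s, x) - b (t, y)) \<le> L * (\<bar>s - t\<bar> + norm (x - y))"
    and \<sigma>_lip: "norm (\<sigma> (s, x) - \<sigma> (t, y)) \<le> L * (\<bar>s - t\<bar> + norm (x - y))"
    and Y_adapted: "adapted F T Y" and Y_continuous: "AE_continuous M T Y"
    and ito: "is_ito_integral M F T W (\<lambda>s \<omega>. \<sigma> (s, Y s \<omega>)) X"
    and Y_eq: "AE \<omega> in M. \<forall>t\<in>{0..T}. Y t \<omega> = y0 + (LINT s:{0..t}|lborel. b (s, Y s \<omega>)) + X t \<omega>"
    and euler: "1 \<le> n \<Longrightarrow> is_euler_approximation M T W y0 b \<sigma> n (Z n)"
begin

abbreviation "\<t> \<equiv> grid T"

abbreviation "incr V n j \<omega> \<equiv> V (\<t> n (Suc j)) \<omega> - V (\<t> n j) \<omega>"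

abbreviation "holder_path V \<alpha> A \<omega> \<equiv> \<forall>s\<in>{0..T}. \<forall>t\<in>{0..T}. norm (V t \<omega> - V s \<omega>) \<le> A * \<bar>t - s\<bar> powr \<alpha>"

lemma holder_path_mono: "A \<le> A' \<Longrightarrow> holder_path V \<alpha> A \<omega> \<Longrightarrow> holder_path V \<alpha> A' \<omega>"
  by (meson mult_right_mono order_trans powr_ge_zero)

lemma power_bound_mono:
  "A \<le> A' \<Longrightarrow> \<forall>n\<ge>1. \<forall>j. P n j \<longrightarrow> norm (f n j) \<le> A * real n powr c
    \<Longrightarrow> \<forall>n\<ge>1. \<forall>j. P n j \<longrightarrow> norm (f n j) \<le> A' * real n powr c"
  by (meson mult_right_mono order_trans powr_ge_zero)

lemma K_nonneg: "0 \<le> K" using norm_ge_zero b_le order_trans by blast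

lemma grid_T: "i \<le> n \<Longrightarrow> 1 \<le> n \<Longrightarrow> 0 \<le> \<t> n i" "i \<le> n \<Longrightarrow> 1 \<le> n \<Longrightarrow> \<t> n i \<le> T"
  using grid_in[of T i n] T_pos by auto

lemma X_continuous: "AE_continuous M T X" and X_adapted: "adapted F T X"
  using ito unfolding is_ito_integral_def by auto

lemma euler_step:
  assumes n: "1 \<le> n" and j: "j < n" and \<omega>: "\<omega> \<in> space M"
  shows "Z n (\<t> n (Suc j)) \<omega> = Z n (\<t> n j) \<omega> + (T / real n) *\<^sub>R b (\<t> n j, Z n (\<t> n j) \<omega>)
    + blinfun_apply (\<sigma> (\<t> n j, Z n (\<t> n j) \<omega>)) (incr W n j \<omega>)"
proof -
  have eq: "Z n (\<t> n i) \<omega> = y0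
      + (\<Sum>i<i. (T / real n) *\<^sub>R b (\<t> n i, Z n (\<t> n i) \<omega>))
      + (\<Sum>i<i. blinfun_apply (\<sigma> (\<t> n i, Z n (\<t> n i) \<omega>)) (incr W n i \<omega>))" if i: "i \<le> n" for i
  proof -
    have "{k. k < n \<and> \<t> n (Suc k) \<le> \<t> n i} = {..<i}"
      using i n T_pos by (auto simp: grid_le_iff)
    moreover have "\<t> n i \<in> {0..T}" using grid_T[OF i n] by auto
    ultimately show ?thesis
      using euler[OF n] \<omega> unfolding is_euler_approximation_def by (simp add: grid_Suc_diff)
  qed
  show ?thesis using eq[of "Suc j"] eq[of j] j by simp
qed

lemma euler_start: "1 \<le> n \<Longrightarrow> \<omega> \<in> space M \<Longrightarrow> Z n 0 \<omega> = y0"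
proof -
  assume n: "1 \<le> n" and \<omega>: "\<omega> \<in> space M"
  have "{k. k < n \<and> \<t> n (Suc k) \<le> 0} = {}"
    using grid_le_iff[OF T_pos n, of _ 0] by (auto simp: grid_0)
  note empty = this
  have "Z n 0 \<omega> = y0 + (\<Sum>i | i < n \<and> \<t> n (Suc i) \<le> 0. (\<t> n (Suc i) - \<t> n i) *\<^sub>R b (\<t> n i, Z n (\<t> n i) \<omega>))
      + (\<Sum>i | i < n \<and> \<t> n (Suc i) \<le> 0. blinfun_apply (\<sigma> (\<t> n i, Z n (\<t> n i) \<omega>)) (incr W n i \<omega>))"
    using euler[OF n] \<omega> T_pos unfolding is_euler_approximation_def by (elim ballE[of _ _ \<omega>] ballE[of _ _ 0]) auto
  then show ?thesis by (simp only: empty sum.empty add_0_right)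
qed

definition rounding :: "nat \<Rightarrow> real \<Rightarrow> real" where
  "rounding n t = \<t> n (nat \<lfloor>t * real n / T\<rfloor>)"

lemma rounding_index:
  assumes n: "1 \<le> n" and t: "t \<in> {0..T}"
  shows "nat \<lfloor>t * real n / T\<rfloor> \<le> n" "rounding n t \<le> t" "t - T / real n \<le> rounding n t"
    "\<t> n i \<le> t \<longleftrightarrow> \<t> n i \<le> rounding n t"
proof -
  let ?k = "nat \<lfloor>t * real n / T\<rfloor>"
  have k: "real ?k \<le> t * real n / T" "t * real n / T < real ?k + 1" using t T_pos n by simp_all
  have "t * real n / T \<le> real n" using t T_pos n by (simp add: field_simps)
  then show "?k \<le> n" using k by linarith
  show "rounding n t \<le> t" using k(1) T_pos n by (simp add: rounding_def grid_def field_simps)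
  show "t - T / real n \<le> rounding n t"
  proof -
    have "t * real n \<le> (real ?k + 1) * T" using k(2) T_pos by (simp add: pos_divide_less_eq)
    then have "t \<le> (real ?k + 1) * T / real n" using n by (simp add: pos_le_divide_eq)
    also have "\<dots> = rounding n t + T / real n"
      by (simp add: rounding_def grid_def add_divide_distrib distrib_right)
    finally show ?thesis by simp
  qed
  have "\<t> n i \<le> t \<longleftrightarrow> real i \<le> t * real n / T" using T_pos n by (simp add: grid_def field_simps)
  also have "\<dots> \<longleftrightarrow> i \<le> ?k" using k by linarith
  also have "\<dots> \<longleftrightarrow> \<t> n i \<le> rounding n t"
    unfolding rounding_def using grid_le_iff[OF T_pos n] by simp
  finally show "\<t> n i \<le> t \<longleftrightarrow> \<t> n i \<le> rounding n t" .
qed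

lemma euler_piecewise_constant:
  assumes n: "1 \<le> n" and t: "t \<in> {0..T}" and \<omega>: "\<omega> \<in> space M"
  shows "Z n t \<omega> = Z n (rounding n t) \<omega>"
proof -
  have "rounding n t \<in> {0..T}"
    using grid_T[OF rounding_index(1)[OF n t] n] unfolding rounding_def by auto
  then show ?thesis
    using euler[OF n] t \<omega> unfolding is_euler_approximation_def
    by (simp add: rounding_index(4)[OF n t])
qed

lemma \<sigma>_measurable: "f \<in> borel_measurable N \<Longrightarrow> (\<lambda>\<omega>. \<sigma> (r, f \<omega>)) \<in> borel_measurable N"
proof -
  assume f: "f \<in> borel_measurable N"
  have "continuous_on UNIV (\<lambda>x. \<sigma> (r, x))"
    by (rule continuous_on_compose2[OF \<sigma>_cont]) (auto intro!: continuous_intros)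
  from measurable_compose[OF f borel_measurable_continuous_onI[OF this]] show ?thesis .
qed

lemma b_measurable: "f \<in> borel_measurable N \<Longrightarrow> (\<lambda>\<omega>. b (r, f \<omega>)) \<in> borel_measurable N"
proof -
  assume f: "f \<in> borel_measurable N"
  have "continuous_on UNIV (\<lambda>x. b (r, x))"
    by (rule continuous_on_compose2[OF b_cont]) (auto intro!: continuous_intros)
  from measurable_compose[OF f borel_measurable_continuous_onI[OF this]] show ?thesis .
qed

lemma euler_measurable:
  assumes n: "1 \<le> n" shows "j \<le> n \<Longrightarrow> Z n (\<t> n j) \<in> borel_measurable (F (\<t> n j))"
proof (induction j)
  case 0
  have "Z n (\<t> n 0) \<in> borel_measurable (F (\<t> n 0)) \<longleftrightarrow> (\<lambda>_. y0) \<in> borel_measurable (F (\<t> n 0))"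
    using euler_start[OF n] space_F[of 0] T_pos by (intro measurable_cong) (simp add: grid_0)
  then show ?case by simp
next
  case (Suc j)
  then have j: "j < n" "j \<le> n" by auto
  let ?F = "F (\<t> n (Suc j))"
  have up: "f \<in> borel_measurable ?F" if "f \<in> borel_measurable (F (\<t> n j))" for f :: "'w \<Rightarrow> 'z::topological_space"
    by (rule measurable_F_mono[OF that grid_T(1)[OF j(2) n] grid_mono grid_T(2)[OF Suc.prems n]]) (use T_pos in auto)
  have Zj: "Z n (\<t> n j) \<in> borel_measurable ?F" using Suc.IH j by (intro up) auto
  have "W (\<t> n (Suc j)) \<in> borel_measurable ?F" "W (\<t> n j) \<in> borel_measurable ?F"
    by (rule W_meas_F[OF grid_T[OF Suc.prems n]], rule up[OF W_meas_F[OF grid_T[OF j(2) n]]])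
  then have W: "(\<lambda>\<omega>. incr W n j \<omega>) \<in> borel_measurable ?F" by (rule borel_measurable_diff)
  have "(\<lambda>\<omega>. Z n (\<t> n j) \<omega> + (T / real n) *\<^sub>R b (\<t> n j, Z n (\<t> n j) \<omega>)
    + blinfun_apply (\<sigma> (\<t> n j, Z n (\<t> n j) \<omega>)) (incr W n j \<omega>)) \<in> borel_measurable ?F"
    by (intro borel_measurable_add borel_measurable_scaleR borel_measurable_const Zj b_measurable
          borel_measurable_blinfun_apply[OF borel_measurable_blinfun_apply_const[OF \<sigma>_measurable[OF Zj]] W])
  also have "?this \<longleftrightarrow> Z n (\<t> n (Suc j)) \<in> borel_measurable ?F"
    using euler_step[OF n j(1)] space_F[OF grid_T[OF Suc.prems n]] by (intro measurable_cong) simp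
  finally show ?case .
qed

text \<open>All simple integrals vanish at time 0, hence so does their limit in probability.\<close>

lemma X_start: "AE \<omega> in M. X 0 \<omega> = 0"
proof -
  obtain N \<tau> \<xi> where simple: "\<And>m::nat. simple_integrand M F T (N m) (\<tau> m) (\<xi> m)"
    and lim: "\<And>\<epsilon>. \<epsilon> > 0 \<Longrightarrow> (\<lambda>m. measure M {\<omega> \<in> space M.
          norm (simple_integral W (N m) (\<tau> m) (\<xi> m) 0 \<omega> - X 0 \<omega>) > \<epsilon>}) \<longlonglongrightarrow> 0"
    using ito T_pos unfolding is_ito_integral_def by fastforce
  have Xm: "X 0 \<in> borel_measurable M"
    using X_adapted T_pos unfolding adapted_def by (intro measurable_F_M[of "X 0" 0]) auto
  have zero: "simple_integral W (N m) (\<tau> m) (\<xi> m) 0 \<omega> = 0" for m \<omega>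
  proof -
    have "min (\<tau> m i) 0 = 0" if "i \<le> N m" for i
      using simple[of m] that unfolding simple_integrand_def by (auto simp: min_def)
    then show ?thesis unfolding simple_integral_def by (intro sum.neutral) auto
  qed
  have "AE \<omega> in M. norm (X 0 \<omega>) \<le> 1 / real (Suc k)" for k
  proof -
    have "measure M {\<omega> \<in> space M. norm (X 0 \<omega>) > 1 / real (Suc k)} = 0"
      using lim[of "1 / real (Suc k)"] unfolding zero by (simp add: LIMSEQ_const_iff)
    moreover have "{\<omega> \<in> space M. norm (X 0 \<omega>) > 1 / real (Suc k)} \<in> sets M" using Xm by measurable
    ultimately show ?thesis
      by (subst AE_iff_measurable[OF _ refl]) (simp_all add: not_le emeasure_eq_measure)
  qed
  then have "AE \<omega> in M. \<forall>k. norm (X 0 \<omega>) \<le> 1 / real (Suc k)" by (simp add: AE_all_countable)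
  then show ?thesis
  proof eventually_elim
    case (elim \<omega>)
    have "norm (X 0 \<omega>) \<le> 0"
      by (rule LIMSEQ_le_const[OF LIMSEQ_inverse_real_of_nat]) (use elim in \<open>auto simp: inverse_eq_divide\<close>)
    then show ?case by simp
  qed
qed

lemma Y_start: "AE \<omega> in M. Y 0 \<omega> = y0"
  using X_start Y_eq
proof eventually_elim
  case (elim \<omega>)
  have "(LINT s:{0..0}|lborel. b (s, Y s \<omega>)) = 0"
    unfolding set_lebesgue_integral_def
    by (rule integral_eq_zero_AE) (use AE_lborel_singleton[of 0] in \<open>eventually_elim, auto\<close>)
  then show ?case using elim T_pos by simp
qed

section \<open>Path regularity\<close>

text \<open>Exponential moments of the rescaled increments, in every direction, give \<open>|V(t\<^sub>i\<^sub>+\<^sub>1) - V(t\<^sub>i)| \<le> n\<^bsup>-1/2\<^esup>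
  (S + 3 ln n)\<close> up to constants, simultaneously for all grids. The logarithm is absorbed into \<open>n\<^bsup>1/2 - \<alpha>\<^esup>\<close>, and
  the grids with \<open>n = 2\<^sup>m\<close> are enough for chaining.\<close>

lemma holder_random_bound:
  fixes V :: "real \<Rightarrow> 'w \<Rightarrow> 'b::euclidean_space"
  assumes cont: "AE_continuous M T V" and \<alpha>: "0 < \<alpha>" "\<alpha> < 1/2" and c: "0 \<le> c"
    and V: "\<And>r. r \<in> {0..T} \<Longrightarrow> V r \<in> borel_measurable M"
    and mgf: "\<And>v n i. norm v = 1 \<Longrightarrow> 1 \<le> n \<Longrightarrow> i < n \<Longrightarrow>
      (\<integral>\<^sup>+\<omega>. ennreal (exp (sqrt (real n) * (v \<bullet> incr V n i \<omega>) - c)) \<partial>M) \<le> 1"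
  shows "random_bound (\<lambda>A \<omega>. holder_path V \<alpha> A \<omega>)"
proof -
  obtain C where C: "0 \<le> C" "\<And>(f :: real \<Rightarrow> 'b) A s t. continuous_on {0..T} f \<Longrightarrow> 0 \<le> A \<Longrightarrow>
    (\<And>m i. i < 2 ^ m \<Longrightarrow> norm (f (grid T (2 ^ m) (Suc i)) - f (grid T (2 ^ m) i)) \<le> A * (real (2 ^ m)) powr (- \<alpha>)) \<Longrightarrow>
    s \<in> {0..T} \<Longrightarrow> t \<in> {0..T} \<Longrightarrow> norm (f t - f s) \<le> C * A * \<bar>t - s\<bar> powr \<alpha>"
    using dyadic_holder[OF T_pos \<alpha>(1), where 'a = 'b] by blast
  let ?P = "\<lambda>v s \<omega>. \<forall>n\<ge>1. \<forall>i<n. sqrt (real n) * (v \<bullet> (incr V n i \<omega>)) - c \<le> s + 3 * ln (real n)"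
  have "random_bound (\<lambda>s \<omega>. \<forall>v\<in>Basis \<union> uminus ` Basis. ?P v s \<omega>)"
  proof (rule random_bound_finite)
    fix v :: 'b assume "v \<in> Basis \<union> uminus ` Basis"
    then have v: "norm v = 1" by auto
    (* A grid with n steps has the increments 0, ..., n - 1, while the union bound runs over the indices up to n;
       the superfluous exponent is 0. *)
    have "random_bound (\<lambda>s \<omega>. \<forall>n\<ge>1. \<forall>i\<le>n.
        (if i < n then sqrt (real n) * (v \<bullet> incr V n i \<omega>) - c else 0) \<le> s + 3 * ln (real n))" (is "random_bound (\<lambda>s \<omega>. \<forall>n\<ge>1. \<forall>i\<le>n. ?Z n i \<omega> \<le> _ s n)")
    proof (rule random_bound_exponential)
      fix n i :: nat assume n: "1 \<le> n"
      show "(\<integral>\<^sup>+\<omega>. ennreal (exp (?Z n i \<omega>)) \<partial>M) \<le> 1"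
        using mgf[OF v n, of i] by (cases "i < n") (auto simp: emeasure_space_1)
      have "V (\<t> n j) \<in> borel_measurable M" if "j \<le> n" for j using grid_T[OF that n] by (intro V) auto
      from this[of i] this[of "Suc i"] show "?Z n i \<in> borel_measurable M" by (cases "i < n") auto
    qed
    then show "random_bound (?P v)"
    proof (rule random_bound_weaken, intro allI impI)
      fix s \<omega> and n i :: nat
      assume *: "\<forall>n\<ge>1. \<forall>i\<le>n. ?Z n i \<omega> \<le> s + 3 * ln (real n)" and "1 \<le> n" "i < n"
      then have "?Z n i \<omega> \<le> s + 3 * ln (real n)" using less_imp_le[of i n] by blast
      then show "sqrt (real n) * (v \<bullet> incr V n i \<omega>) - c \<le> s + 3 * ln (real n)" using \<open>i < n\<close> by simp
    qed
  qed simp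
  then show ?thesis
  proof (rule random_bound_trans)
    show "holder_path V \<alpha> A' \<omega>" if "A \<le> A'" "holder_path V \<alpha> A \<omega>" for A A' \<omega> by (rule holder_path_mono[where V = V and \<omega> = \<omega>, OF that])
  next
    fix S :: real assume S: "0 \<le> S"
    let ?A = "real DIM('b) * (S + c + 3 / (1/2 - \<alpha>))"
    have A: "0 \<le> ?A" using S c \<alpha> by simp
    show "\<exists>A. AE \<omega> in M. (\<forall>v\<in>Basis \<union> uminus ` Basis. ?P v S \<omega>) \<longrightarrow>
        holder_path V \<alpha> A \<omega>"
    proof (intro exI)
      show "AE \<omega> in M. (\<forall>v\<in>Basis \<union> uminus ` Basis. ?P v S \<omega>) \<longrightarrow>
        holder_path V \<alpha> (C * ?A) \<omega>"
        using cont unfolding AE_continuous_def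
      proof eventually_elim
        case (elim \<omega>)
        show ?case
        proof (intro impI ballI)
          fix s t assume P: "\<forall>v\<in>Basis \<union> uminus ` Basis. ?P v S \<omega>" and st: "s \<in> {0..T}" "t \<in> {0..T}"
          show "norm (V t \<omega> - V s \<omega>) \<le> C * ?A * \<bar>t - s\<bar> powr \<alpha>"
          proof (rule C(2)[OF elim A _ st])
            fix m i :: nat assume i: "i < 2 ^ m"
            let ?n = "2 ^ m :: nat" and ?v = "V (\<t> (2 ^ m) (Suc i)) \<omega> - V (\<t> (2 ^ m) i) \<omega>"
            let ?R = "S + c + 3 * ln (real ?n)"
            have n: "1 \<le> ?n" by simp
            have sq: "0 < sqrt (real ?n)" by simp
            have "norm ?v \<le> real DIM('b) * (?R / sqrt (real ?n))"
            proof (rule norm_le_of_directions)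
              fix u :: 'b assume "u \<in> Basis \<union> uminus ` Basis"
              then have "sqrt (real ?n) * (u \<bullet> ?v) - c \<le> S + 3 * ln (real ?n)" using P i n by blast
              then have "(u \<bullet> ?v) * sqrt (real ?n) \<le> ?R" by (simp only: mult.commute diff_le_eq add_ac)
              then show "u \<bullet> ?v \<le> ?R / sqrt (real ?n)" using sq by (simp only: pos_le_divide_eq)
            qed
            also have "?R / sqrt (real ?n) = (S + c + 3 * ln (real ?n)) * real ?n powr (- (1/2 - \<alpha>)) * real ?n powr (- \<alpha>)"
            proof -
              have "1 / sqrt (real ?n) = real ?n powr (- (1/2))" by (simp add: powr_minus powr_half_sqrt inverse_eq_divide)
              also have "\<dots> = real ?n powr (- (1/2 - \<alpha>)) * real ?n powr (- \<alpha>)" by (simp add: powr_add[symmetric])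
              finally have e: "1 / sqrt (real ?n) = real ?n powr (- (1/2 - \<alpha>)) * real ?n powr (- \<alpha>)" .
              have "?R / sqrt (real ?n) = ?R * (1 / sqrt (real ?n))" by (simp only: times_divide_eq_right mult_1_right)
              then show ?thesis unfolding e by (simp only: mult.assoc)
            qed
            also have "\<dots> \<le> (S + c + 3 / (1/2 - \<alpha>)) * real ?n powr (- \<alpha>)"
              by (intro mult_right_mono ln_powr_absorb n) (use S c \<alpha> in auto)
            finally show "norm ?v \<le> ?A * (real ?n) powr (- \<alpha>)" by (simp only: mult.assoc mult_left_mono of_nat_0_le_iff)
          qed
        qed
      qed
    qed
  qed
qed

lemma X_holder:
  assumes "0 < \<alpha>" "\<alpha> < 1/2"
  shows "random_bound (\<lambda>A \<omega>. holder_path X \<alpha> A \<omega>)"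
proof (rule holder_random_bound[OF X_continuous assms])
  show "0 \<le> K\<^sup>2 * T" using T_pos by simp
  show "X r \<in> borel_measurable M" if "r \<in> {0..T}" for r
    using X_adapted that unfolding adapted_def by (intro measurable_F_M[of _ r]) auto
  fix v :: "real^'k" and n i :: nat assume v: "norm v = 1" and n: "1 \<le> n" and i: "i < n"
  then have i': "i \<le> n" "Suc i \<le> n" by auto
  let ?H = "\<lambda>r \<omega>. \<sigma> (r, Y r \<omega>)" and ?l = "sqrt (real n) *\<^sub>R v"
  have "(\<integral>\<^sup>+\<omega>. ennreal (exp (sqrt (real n) * (v \<bullet> incr X n i \<omega>) - K\<^sup>2 * T)) \<partial>M)
    \<le> (\<integral>\<^sup>+\<omega>. ennreal (exp (0 + ?l \<bullet> (incr X n i \<omega> - blinfun_apply 0 (incr W n i \<omega>))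
        - (norm ?l)\<^sup>2 * energy ?H (\<lambda>_. 0) (\<t> n i) (\<t> n (Suc i)) \<omega>)) \<partial>M)"
  proof (intro nn_integral_mono ennreal_leI iffD2[OF exp_le_cancel_iff])
    fix \<omega>
    have "energy ?H (\<lambda>_. 0) (\<t> n i) (\<t> n (Suc i)) \<omega> \<le> K\<^sup>2 * (T / real n)"
      using energy_le[of "\<t> n i" "\<t> n (Suc i)" K "\<lambda>_. 0" \<omega> ?H] grid_mono[of T i "Suc i" n] T_pos K_nonneg \<sigma>_le
      by (simp add: grid_Suc_diff)
    then have "real n * energy ?H (\<lambda>_. 0) (\<t> n i) (\<t> n (Suc i)) \<omega> \<le> real n * (K\<^sup>2 * (T / real n))"
      by (intro mult_left_mono) auto
    then show "sqrt (real n) * (v \<bullet> incr X n i \<omega>) - K\<^sup>2 * T \<le> 0 + ?l \<bullet> (incr X n i \<omega> - blinfun_apply 0 (incr W n i \<omega>))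
        - (norm ?l)\<^sup>2 * energy ?H (\<lambda>_. 0) (\<t> n i) (\<t> n (Suc i)) \<omega>"
      using v n by (simp add: power_mult_distrib)
  qed
  also have "\<dots> \<le> (\<integral>\<^sup>+\<omega>. ennreal (exp 0) \<partial>M)"
    using grid_T[OF i'(1) n] grid_T[OF i'(2) n] grid_mono[of T i "Suc i" n] T_pos \<sigma>_le
    by (intro exponential_ito[OF ito]) auto
  finally show "(\<integral>\<^sup>+\<omega>. ennreal (exp (sqrt (real n) * (v \<bullet> incr X n i \<omega>) - K\<^sup>2 * T)) \<partial>M) \<le> 1"
    by (simp add: emeasure_space_1)
qed

lemma W_holder:
  assumes "0 < \<alpha>" "\<alpha> < 1/2"
  shows "random_bound (\<lambda>A \<omega>. holder_path W \<alpha> A \<omega>)"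
proof (rule holder_random_bound[OF W_continuous assms])
  show "0 \<le> T / 2" using T_pos by simp
  show "W r \<in> borel_measurable M" if "r \<in> {0..T}" for r using W_meas that by auto
  fix v :: "real^'d" and n i :: nat assume v: "norm v = 1" and n: "1 \<le> n" and i: "i < n"
  then have i': "i \<le> n" "Suc i \<le> n" by auto
  let ?l = "sqrt (real n) *\<^sub>R v"
  have "(\<integral>\<^sup>+\<omega>. ennreal (exp (sqrt (real n) * (v \<bullet> incr W n i \<omega>) - T / 2)) \<partial>M)
    = (\<integral>\<^sup>+\<omega>. 1 * ennreal (exp (?l \<bullet> incr W n i \<omega> - (norm ?l)\<^sup>2 * (\<t> n (Suc i) - \<t> n i) / 2)) \<partial>M)"
    using v n by (intro nn_integral_cong) (simp add: grid_Suc_diff power_mult_distrib)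
  also have "\<dots> = (\<integral>\<^sup>+\<omega>. 1 \<partial>M)"
    using grid_T[OF i'(1) n] grid_T[OF i'(2) n] grid_mono[of T i "Suc i" n] T_pos
    by (intro exponential_step) auto
  finally show "(\<integral>\<^sup>+\<omega>. ennreal (exp (sqrt (real n) * (v \<bullet> incr W n i \<omega>) - T / 2)) \<partial>M) \<le> 1"
    by (simp add: emeasure_space_1)
qed

lemma Y_path_continuous: "AE \<omega> in M. continuous_on {0..T} (\<lambda>r. b (r, Y r \<omega>))"
  using Y_continuous unfolding AE_continuous_def
proof eventually_elim
  case (elim \<omega>)
  show ?case
    by (rule continuous_on_compose2[OF b_cont]) (auto intro!: continuous_intros elim)
qed

lemma Y_holder:
  assumes \<alpha>: "0 < \<alpha>" "\<alpha> < 1/2"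
  shows "random_bound (\<lambda>A \<omega>. holder_path Y \<alpha> A \<omega>)"
  using X_holder[OF \<alpha>]
proof (rule random_bound_trans)
  show "holder_path Y \<alpha> A' \<omega>" if "A \<le> A'" "holder_path Y \<alpha> A \<omega>" for A A' \<omega> by (rule holder_path_mono[where V = Y and \<omega> = \<omega>, OF that])
next
  fix A :: real assume A: "0 \<le> A"
  show "\<exists>c. AE \<omega> in M. holder_path X \<alpha> A \<omega> \<longrightarrow>
      holder_path Y \<alpha> c \<omega>"
  proof (intro exI)
    show "AE \<omega> in M. holder_path X \<alpha> A \<omega> \<longrightarrow>
      holder_path Y \<alpha> (K * T powr (1 - \<alpha>) + A) \<omega>"
      using Y_path_continuous Y_eq
    proof eventually_elim
      case (elim \<omega>)
      show ?case
      proof (intro impI)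
        assume X: "holder_path X \<alpha> A \<omega>"
        have le: "norm (Y t \<omega> - Y s \<omega>) \<le> (K * T powr (1 - \<alpha>) + A) * \<bar>t - s\<bar> powr \<alpha>" if st: "0 \<le> s" "s < t" "t \<le> T" for s t
        proof -
          let ?I = "(LINT r:{0..t}|lborel. b (r, Y r \<omega>)) - (LINT r:{0..s}|lborel. b (r, Y r \<omega>))"
          have "Y t \<omega> - Y s \<omega> = ?I + (X t \<omega> - X s \<omega>)" using elim(2) st by simp
          then have "norm (Y t \<omega> - Y s \<omega>) \<le> norm ?I + norm (X t \<omega> - X s \<omega>)" by (simp only: norm_triangle_ineq)
          also have "norm ?I \<le> K * (t - s)"
            using set_integral_increment_approx[OF elim(1), of s t 0 K] st b_le by simp
          also have "K * (t - s) \<le> K * (T powr (1 - \<alpha>) * (t - s) powr \<alpha>)"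
          proof (intro mult_left_mono K_nonneg)
            have "t - s = (t - s) powr (1 - \<alpha>) * (t - s) powr \<alpha>" using st by (simp add: powr_add[symmetric])
            also have "\<dots> \<le> T powr (1 - \<alpha>) * (t - s) powr \<alpha>"
              using st \<alpha> by (intro mult_right_mono powr_mono2) auto
            finally show "t - s \<le> T powr (1 - \<alpha>) * (t - s) powr \<alpha>" .
          qed
          also have "norm (X t \<omega> - X s \<omega>) \<le> A * \<bar>t - s\<bar> powr \<alpha>" using bspec[OF bspec[OF X, of s], of t] st by simp
          finally show ?thesis using st by (simp add: algebra_simps)
        qed
        show "holder_path Y \<alpha> (K * T powr (1 - \<alpha>) + A) \<omega>"
        proof (intro ballI)
          fix s t assume "s \<in> {0..T}" "t \<in> {0..T}"
          then show "norm (Y t \<omega> - Y s \<omega>) \<le> (K * T powr (1 - \<alpha>) + A) * \<bar>t - s\<bar> powr \<alpha>"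
            using le[of s t] le[of t s] by (cases s t rule: linorder_cases) (simp_all add: norm_minus_commute abs_minus_commute)
        qed
      qed
    qed
  qed
qed

section \<open>The error at the grid points\<close>

definition err :: "nat \<Rightarrow> nat \<Rightarrow> 'w \<Rightarrow> real^'k" where
  "err n j \<omega> = Y (\<t> n j) \<omega> - Z n (\<t> n j) \<omega>"

text \<open>The martingale part of the increment \<open>err n (Suc j) - err n j\<close>: the Ito integral over one step against the
  frozen coefficient of the Euler scheme.\<close>

definition mart :: "nat \<Rightarrow> nat \<Rightarrow> 'w \<Rightarrow> real^'k" where
  "mart n j \<omega> = defect X (\<lambda>\<omega>. \<sigma> (\<t> n j, Z n (\<t> n j) \<omega>)) (\<t> n j) (\<t> n (Suc j)) \<omega>"

text \<open>The level \<open>n\<^bsup>-a\<^esup>\<close> keeps the logarithm of this quantity meaningful when the error vanishes.\<close>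

definition lyap :: "real \<Rightarrow> nat \<Rightarrow> nat \<Rightarrow> 'w \<Rightarrow> real" where
  "lyap a n j \<omega> = (norm (err n j \<omega>))\<^sup>2 + (real n powr (- a))\<^sup>2"

definition euler_energy :: "nat \<Rightarrow> nat \<Rightarrow> 'w \<Rightarrow> real" where
  "euler_energy n j = energy (\<lambda>s \<omega>. \<sigma> (s, Y s \<omega>)) (\<lambda>\<omega>. \<sigma> (\<t> n j, Z n (\<t> n j) \<omega>)) (\<t> n j) (\<t> n (Suc j))"

lemma lyap_pos: "1 \<le> n \<Longrightarrow> 0 < lyap a n j \<omega>"
  unfolding lyap_def by (intro add_nonneg_pos) auto

text \<open>The left-hand side is, up to its compensator, the martingale part of \<open>\<theta> ln (lyap a n J)\<close>. The coefficient
  \<open>\<theta> (2 / lyap) err\<close> is known at the beginning of each step, so the exponential inequality on the grid applies. A large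
  \<open>\<theta>\<close> makes the logarithmic term \<open>3 ln n / \<theta>\<close> small.\<close>

lemma martingale_bound:
  assumes \<theta>: "0 < \<theta>"
  shows "random_bound (\<lambda>s \<omega>. \<forall>n\<ge>1. \<forall>J\<le>n.
    (\<Sum>j<J. \<theta> * (2 * (err n j \<omega> \<bullet> mart n j \<omega>) / lyap a n j \<omega>)
      - (\<theta> * (2 * norm (err n j \<omega>) / lyap a n j \<omega>))\<^sup>2 * euler_energy n j \<omega>) \<le> s + 3 * ln (real n))"
proof -
  let ?l = "\<lambda>n j \<omega>. (\<theta> * (2 / lyap a n j \<omega>)) *\<^sub>R err n j \<omega>"
  let ?S = "\<lambda>n j \<omega>. \<sigma> (\<t> n j, Z n (\<t> n j) \<omega>)"
  let ?Z = "\<lambda>n J \<omega>. \<Sum>j<J. ?l n j \<omega> \<bullet> defect X (?S n j) (\<t> n j) (\<t> n (Suc j)) \<omega>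
      - (norm (?l n j \<omega>))\<^sup>2 * energy (\<lambda>s \<omega>. \<sigma> (s, Y s \<omega>)) (?S n j) (\<t> n j) (\<t> n (Suc j)) \<omega>"
  have eq: "?Z n J \<omega> = (\<Sum>j<J. \<theta> * (2 * (err n j \<omega> \<bullet> mart n j \<omega>) / lyap a n j \<omega>)
      - (\<theta> * (2 * norm (err n j \<omega>) / lyap a n j \<omega>))\<^sup>2 * euler_energy n j \<omega>)" if "1 \<le> n" for n J \<omega>
  proof (rule sum.cong[OF refl])
    fix j
    have nl: "norm (?l n j \<omega>) = \<theta> * (2 * norm (err n j \<omega>) / lyap a n j \<omega>)"
      using lyap_pos[OF that, of a j \<omega>] \<theta> by simp
    show "?l n j \<omega> \<bullet> defect X (?S n j) (\<t> n j) (\<t> n (Suc j)) \<omega>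
      - (norm (?l n j \<omega>))\<^sup>2 * energy (\<lambda>s \<omega>. \<sigma> (s, Y s \<omega>)) (?S n j) (\<t> n j) (\<t> n (Suc j)) \<omega>
      = \<theta> * (2 * (err n j \<omega> \<bullet> mart n j \<omega>) / lyap a n j \<omega>)
      - (\<theta> * (2 * norm (err n j \<omega>) / lyap a n j \<omega>))\<^sup>2 * euler_energy n j \<omega>"
      unfolding nl mart_def[symmetric] euler_energy_def[symmetric] inner_scaleR_left by simp
  qed
  have "?Z n J \<in> borel_measurable M \<and> (\<integral>\<^sup>+\<omega>. ennreal (exp (?Z n J \<omega>)) \<partial>M) \<le> 1" if n: "1 \<le> n" and J: "J \<le> n" for n J
  proof -
    have Zm: "Z n (\<t> n j) \<in> borel_measurable (F (\<t> n j))" if "j < J" for j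
      using euler_measurable[OF n, of j] that J by simp
    have Ym: "Y (\<t> n j) \<in> borel_measurable (F (\<t> n j))" if "j < J" for j
      using Y_adapted grid_T[of j n] n that J unfolding adapted_def by auto
    have em: "err n j \<in> borel_measurable (F (\<t> n j))" if "j < J" for j
      unfolding err_def[abs_def] by (intro borel_measurable_diff Zm Ym that)
    have lm: "?l n j \<in> borel_measurable (F (\<t> n j))" if "j < J" for j
    proof -
      note [measurable] = em[OF that]
      show ?thesis unfolding lyap_def by measurable
    qed
    show ?thesis
      using exponential_ito_grid[OF ito \<sigma>_le, of "\<t> n" J "?l n" "?S n"] lm Zm grid_T[of 0 n] grid_T[of J n] grid_mono[of T _ _ n] T_pos n J
      by (auto intro!: \<sigma>_measurable)
  qed
  then have "random_bound (\<lambda>s \<omega>. \<forall>n\<ge>1. \<forall>J\<le>n. ?Z n J \<omega> \<le> s + 3 * ln (real n))"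
    by (intro random_bound_exponential) auto
  then show ?thesis
  proof (rule random_bound_weaken, intro allI impI)
    fix s \<omega> and n J :: nat
    assume *: "\<forall>n\<ge>1. \<forall>J\<le>n. ?Z n J \<omega> \<le> s + 3 * ln (real n)" and n: "1 \<le> n" and J: "J \<le> n"
    then have "?Z n J \<omega> \<le> s + 3 * ln (real n)" by blast
    then show "(\<Sum>j<J. \<theta> * (2 * (err n j \<omega> \<bullet> mart n j \<omega>) / lyap a n j \<omega>)
      - (\<theta> * (2 * norm (err n j \<omega>) / lyap a n j \<omega>))\<^sup>2 * euler_energy n j \<omega>) \<le> s + 3 * ln (real n)"
      by (simp only: eq[OF n])
  qed
qed

text \<open>Summation by parts: \<open>\<Sum> |\<Delta>W\<^sub>j|\<^sup>2 = |W\<^sub>T|\<^sup>2 - |W\<^sub>0|\<^sup>2 - 2 \<Sum> W\<^sub>j \<bullet> \<Delta>W\<^sub>j\<close>. The last sum is a discrete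
  stochastic integral, to which the exponential identity applies with coefficient \<open>-2 \<theta> W\<^sub>j\<close>; its compensator is
  bounded because \<open>W\<close> is bounded on \<open>[0, T]\<close>.\<close>

lemma quadratic_variation:
  assumes \<kappa>: "0 < \<kappa>"
  shows "random_bound (\<lambda>s \<omega>. \<forall>n\<ge>1. (\<Sum>j<n. (norm (incr W n j \<omega>))\<^sup>2) \<le> s + \<kappa> * ln (real n))"
proof -
  define \<theta> where "\<theta> = 3 / \<kappa>"
  have \<theta>: "0 < \<theta>" using \<kappa> by (simp add: \<theta>_def)
  let ?D = "\<lambda>n j \<omega>. incr W n j \<omega>"
  let ?g = "\<lambda>n j \<omega>. (- 2 * \<theta>) *\<^sub>R W (\<t> n j) \<omega>"
  let ?Z = "\<lambda>n \<omega>. \<Sum>j<n. ?g n j \<omega> \<bullet> ?D n j \<omega> - (norm (?g n j \<omega>))\<^sup>2 * (\<t> n (Suc j) - \<t> n j) / 2"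
  let ?P = "\<lambda>s \<omega>. \<forall>n\<ge>1. \<forall>i\<le>n. ?Z n \<omega> \<le> s + 3 * ln (real n)"
  let ?Q = "\<lambda>A \<omega>. holder_path W (1/4) A \<omega>"
  have "random_bound ?P"
  proof (rule random_bound_exponential)
    fix n i :: nat assume n: "1 \<le> n"
    have Wm: "W (\<t> n j) \<in> borel_measurable M" if "j \<le> n" for j using W_meas grid_T[OF that n] by auto
    have "(\<lambda>\<omega>. ?g n j \<omega> \<bullet> ?D n j \<omega> - (norm (?g n j \<omega>))\<^sup>2 * (\<t> n (Suc j) - \<t> n j) / 2) \<in> borel_measurable M" if "j < n" for j
    proof -
      have [measurable]: "W (\<t> n j) \<in> borel_measurable M" "W (\<t> n (Suc j)) \<in> borel_measurable M" using Wm that by auto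
      show ?thesis by measurable
    qed
    then show "?Z n \<in> borel_measurable M" by (intro borel_measurable_sum) auto
    have "(\<integral>\<^sup>+\<omega>. 1 * ennreal (exp (?Z n \<omega>)) \<partial>M) = (\<integral>\<^sup>+\<omega>. 1 \<partial>M)"
    proof (rule exponential_chain[where c = "\<t> n"])
      show "0 \<le> \<t> n 0" "\<t> n n \<le> T" using grid_T[of 0 n] grid_T[of n n] n by auto
      show "\<t> n i \<le> \<t> n (Suc i)" for i using grid_mono[of T i "Suc i" n] T_pos by simp
      show "?g n i \<in> borel_measurable (F (\<t> n i))" if "i < n" for i
        using W_meas_F[of "\<t> n i"] grid_T[of i n] n that by (intro borel_measurable_scaleR) auto
    qed simp
    then show "(\<integral>\<^sup>+\<omega>. ennreal (exp (?Z n \<omega>)) \<partial>M) \<le> 1" by (simp add: emeasure_space_1)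
  qed
  moreover have "random_bound ?Q" by (rule W_holder) auto
  ultimately have "random_bound (\<lambda>s \<omega>. ?P s \<omega> \<and> ?Q s \<omega>)" by (rule random_bound_conj)
  then show ?thesis
  proof (rule random_bound_trans)
    show "\<forall>n\<ge>1. (\<Sum>j<n. (norm (?D n j \<omega>))\<^sup>2) \<le> s' + \<kappa> * ln (real n)"
      if "s \<le> s'" "\<forall>n\<ge>1. (\<Sum>j<n. (norm (?D n j \<omega>))\<^sup>2) \<le> s + \<kappa> * ln (real n)" for s s' \<omega>
      using that by (meson add_right_mono order_trans)
  next
    fix s :: real assume s: "0 \<le> s"
    let ?B = "s * T powr (1/4)"
    let ?c = "?B\<^sup>2 + s / \<theta> + 2 * \<theta> * T * ?B\<^sup>2"
    show "\<exists>c. AE \<omega> in M. ?P s \<omega> \<and> ?Q s \<omega> \<longrightarrow>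
        (\<forall>n\<ge>1. (\<Sum>j<n. (norm (?D n j \<omega>))\<^sup>2) \<le> c + \<kappa> * ln (real n))"
    proof (intro exI)
      show "AE \<omega> in M. ?P s \<omega> \<and> ?Q s \<omega> \<longrightarrow>
        (\<forall>n\<ge>1. (\<Sum>j<n. (norm (?D n j \<omega>))\<^sup>2) \<le> ?c + \<kappa> * ln (real n))"
        using W_zero
      proof eventually_elim
        case (elim \<omega>)
        show ?case
        proof (intro impI allI)
          assume PQ: "?P s \<omega> \<and> ?Q s \<omega>"
          fix n :: nat assume n: "1 \<le> n"
          have B: "norm (W t \<omega>) \<le> ?B" if t: "0 \<le> t" "t \<le> T" for t
          proof -
            have "norm (W t \<omega> - W 0 \<omega>) \<le> s * \<bar>t - 0\<bar> powr (1/4)"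
              by (rule bspec[OF bspec[OF conjunct2[OF PQ]]]) (use t T_pos in auto)
            also have "\<dots> \<le> ?B" using t s by (intro mult_left_mono powr_mono2) auto
            finally show ?thesis using elim by simp
          qed
          have BT: "(norm (W (\<t> n j) \<omega>))\<^sup>2 \<le> ?B\<^sup>2" if "j \<le> n" for j
            using B grid_T[OF that n] by (intro power_mono) auto
          have tele: "(\<Sum>j<n. (norm (?D n j \<omega>))\<^sup>2) = (norm (W (\<t> n n) \<omega>))\<^sup>2 - (norm (W (\<t> n 0) \<omega>))\<^sup>2 - 2 * (\<Sum>j<n. W (\<t> n j) \<omega> \<bullet> ?D n j \<omega>)"
          proof -
            have "(norm (?D n j \<omega>))\<^sup>2 = ((norm (W (\<t> n (Suc j)) \<omega>))\<^sup>2 - (norm (W (\<t> n j) \<omega>))\<^sup>2) - 2 * (W (\<t> n j) \<omega> \<bullet> ?D n j \<omega>)" for j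
              unfolding power2_norm_eq_inner by (simp add: inner_diff_left inner_diff_right inner_commute)
            then have "(\<Sum>j<n. (norm (?D n j \<omega>))\<^sup>2) = (\<Sum>j<n. ((norm (W (\<t> n (Suc j)) \<omega>))\<^sup>2 - (norm (W (\<t> n j) \<omega>))\<^sup>2) - 2 * (W (\<t> n j) \<omega> \<bullet> ?D n j \<omega>))"
              by (intro sum.cong refl)
            also have "\<dots> = (\<Sum>j<n. (norm (W (\<t> n (Suc j)) \<omega>))\<^sup>2 - (norm (W (\<t> n j) \<omega>))\<^sup>2) - 2 * (\<Sum>j<n. W (\<t> n j) \<omega> \<bullet> ?D n j \<omega>)"
              by (simp only: sum_subtractf[of _ "\<lambda>j. 2 * (W (\<t> n j) \<omega> \<bullet> ?D n j \<omega>)"] sum_distrib_left)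
            also have "(\<Sum>j<n. (norm (W (\<t> n (Suc j)) \<omega>))\<^sup>2 - (norm (W (\<t> n j) \<omega>))\<^sup>2) = (norm (W (\<t> n n) \<omega>))\<^sup>2 - (norm (W (\<t> n 0) \<omega>))\<^sup>2"
              by (rule sum_lessThan_telescope[where f = "\<lambda>j. (norm (W (\<t> n j) \<omega>))\<^sup>2"])
            finally show ?thesis .
          qed
          have "?Z n \<omega> \<le> s + 3 * ln (real n)" using PQ n by blast
          moreover have "?Z n \<omega> = \<theta> * (- 2 * (\<Sum>j<n. W (\<t> n j) \<omega> \<bullet> ?D n j \<omega>)) - (\<Sum>j<n. 2 * \<theta>\<^sup>2 * (norm (W (\<t> n j) \<omega>))\<^sup>2 * (T / real n))"
          proof -
            have "?g n j \<omega> \<bullet> ?D n j \<omega> - (norm (?g n j \<omega>))\<^sup>2 * (\<t> n (Suc j) - \<t> n j) / 2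
              = \<theta> * (- 2 * (W (\<t> n j) \<omega> \<bullet> ?D n j \<omega>)) - 2 * \<theta>\<^sup>2 * (norm (W (\<t> n j) \<omega>))\<^sup>2 * (T / real n)" for j
              unfolding grid_Suc_diff inner_scaleR_left norm_scaleR by (simp add: power_mult_distrib)
            then show ?thesis by (simp only: sum_subtractf sum_distrib_left)
          qed
          moreover have "(\<Sum>j<n. 2 * \<theta>\<^sup>2 * (norm (W (\<t> n j) \<omega>))\<^sup>2 * (T / real n)) \<le> 2 * \<theta>\<^sup>2 * ?B\<^sup>2 * T"
          proof -
            have "(\<Sum>j<n. 2 * \<theta>\<^sup>2 * (norm (W (\<t> n j) \<omega>))\<^sup>2 * (T / real n)) \<le> (\<Sum>j<n. 2 * \<theta>\<^sup>2 * ?B\<^sup>2 * (T / real n))"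
              using BT T_pos by (intro sum_mono mult_right_mono mult_left_mono) auto
            also have "\<dots> = 2 * \<theta>\<^sup>2 * ?B\<^sup>2 * T" using n by simp
            finally show ?thesis .
          qed
          ultimately have "(- 2 * (\<Sum>j<n. W (\<t> n j) \<omega> \<bullet> ?D n j \<omega>)) * \<theta> \<le> s + 3 * ln (real n) + 2 * \<theta>\<^sup>2 * ?B\<^sup>2 * T"
            by (simp only: mult.commute[of \<theta>])
          then have "- 2 * (\<Sum>j<n. W (\<t> n j) \<omega> \<bullet> ?D n j \<omega>) \<le> (s + 3 * ln (real n) + 2 * \<theta>\<^sup>2 * ?B\<^sup>2 * T) / \<theta>"
            using \<theta> by (simp only: pos_le_divide_eq)
          also have "\<dots> = s / \<theta> + \<kappa> * ln (real n) + 2 * \<theta> * T * ?B\<^sup>2"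
            using \<kappa> by (simp add: \<theta>_def field_simps power2_eq_square)
          finally have "- 2 * (\<Sum>j<n. W (\<t> n j) \<omega> \<bullet> ?D n j \<omega>) \<le> s / \<theta> + \<kappa> * ln (real n) + 2 * \<theta> * T * ?B\<^sup>2" .
          then show "(\<Sum>j<n. (norm (?D n j \<omega>))\<^sup>2) \<le> ?c + \<kappa> * ln (real n)"
            unfolding tele using BT[OF order_refl] zero_le_power2[of "norm (W (\<t> n 0) \<omega>)"] by linarith
        qed
      qed
    qed
  qed
qed

text \<open>The one-step error of freezing \<open>\<sigma>\<close> along the solution itself; in contrast to \<open>mart\<close> it does not involve the
  Euler scheme.\<close>

definition remainder :: "nat \<Rightarrow> nat \<Rightarrow> 'w \<Rightarrow> real^'k" where
  "remainder n j \<omega> = defect X (\<lambda>\<omega>. \<sigma> (\<t> n j, Y (\<t> n j) \<omega>)) (\<t> n j) (\<t> n (Suc j)) \<omega>"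

text \<open>For a \<open>\<gamma>\<close>-Hoelder path \<open>Y\<close> the integrand of the remainder is \<open>O(n\<^bsup>-\<gamma>\<^esup>)\<close> on an interval of length \<open>T/n\<close>. The
  exponential inequality with \<open>l\<close> of size \<open>n\<^bsup>1/2 + \<gamma>\<^esup>\<close> therefore has a bounded compensator and gives
  \<open>O(n\<^bsup>-1/2 - \<gamma>\<^esup> ln n)\<close>. Taking \<open>\<gamma>\<close> strictly between \<open>\<alpha>\<close> and \<open>1/2\<close> absorbs the logarithm.\<close>

lemma remainder_bound:
  assumes \<alpha>: "0 < \<alpha>" "\<alpha> < 1/2"
  shows "random_bound (\<lambda>A \<omega>. \<forall>n\<ge>1. \<forall>j<n. norm (remainder n j \<omega>) \<le> A * real n powr (- (1/2 + \<alpha>)))"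
proof -
  define \<gamma> where "\<gamma> = (\<alpha> + 1/2) / 2"
  have \<gamma>: "\<alpha> < \<gamma>" "\<gamma> < 1/2" "0 < \<gamma>" using \<alpha> by (auto simp: \<gamma>_def)
  let ?H = "\<lambda>r \<omega>. \<sigma> (r, Y r \<omega>)"
  let ?S = "\<lambda>n j \<omega>. \<sigma> (\<t> n j, Y (\<t> n j) \<omega>)"
  let ?r = "\<lambda>n. real n powr (1/2 + \<gamma>)"
  let ?Z = "\<lambda>v n j \<omega>. if j < n then ?r n * (v \<bullet> remainder n j \<omega>) - (?r n)\<^sup>2 * energy ?H (?S n j) (\<t> n j) (\<t> n (Suc j)) \<omega> else 0"
  let ?P = "\<lambda>v s \<omega>. \<forall>n\<ge>1. \<forall>j\<le>n. ?Z v n j \<omega> \<le> s + 3 * ln (real n)"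
  let ?Q = "\<lambda>A \<omega>. holder_path Y \<gamma> A \<omega>"
  have "random_bound (?P v)" if v: "norm v = 1" for v
  proof (rule random_bound_exponential)
    fix n j :: nat assume n: "1 \<le> n"
    show "?Z v n j \<in> borel_measurable M" "(\<integral>\<^sup>+\<omega>. ennreal (exp (?Z v n j \<omega>)) \<partial>M) \<le> 1"
    proof (atomize(full), cases "j < n")
      case True
      then have j: "j \<le> n" "Suc j \<le> n" by auto
      have Ym: "Y (\<t> n j) \<in> borel_measurable (F (\<t> n j))"
        using Y_adapted grid_T[OF j(1) n] unfolding adapted_def by auto
      let ?c = "\<lambda>i. \<t> n (j + i)"
      have eq: "?Z v n j \<omega> = (\<Sum>i<1. (?r n *\<^sub>R v) \<bullet> defect X (?S n j) (?c i) (?c (Suc i)) \<omega>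
          - (norm (?r n *\<^sub>R v))\<^sup>2 * energy ?H (?S n j) (?c i) (?c (Suc i)) \<omega>)" for \<omega>
        using True v by (simp add: remainder_def)
      show "?Z v n j \<in> borel_measurable M \<and> (\<integral>\<^sup>+\<omega>. ennreal (exp (?Z v n j \<omega>)) \<partial>M) \<le> 1"
        unfolding eq
      proof (rule conjI)
        have c: "0 \<le> ?c 0" "?c 1 \<le> T" using grid_T[OF j(1) n] grid_T[OF j(2) n] by auto
        have mono: "?c i \<le> ?c (Suc i)" for i using grid_mono[of T "j + i" "j + Suc i" n] T_pos by simp
        have S: "?S n j \<in> borel_measurable (F (?c i))" if "i < 1" for i
          using \<sigma>_measurable[OF Ym, of "\<t> n j"] that by simp
        note grid_bound = exponential_ito_grid[OF ito \<sigma>_le c(1) mono c(2) borel_measurable_const S]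
        show "(\<lambda>\<omega>. \<Sum>i<1. (?r n *\<^sub>R v) \<bullet> defect X (?S n j) (?c i) (?c (Suc i)) \<omega>
          - (norm (?r n *\<^sub>R v))\<^sup>2 * energy ?H (?S n j) (?c i) (?c (Suc i)) \<omega>) \<in> borel_measurable M"
          by (rule grid_bound(2))
        show "(\<integral>\<^sup>+\<omega>. ennreal (exp (\<Sum>i<1. (?r n *\<^sub>R v) \<bullet> defect X (?S n j) (?c i) (?c (Suc i)) \<omega>
          - (norm (?r n *\<^sub>R v))\<^sup>2 * energy ?H (?S n j) (?c i) (?c (Suc i)) \<omega>)) \<partial>M) \<le> 1"
          by (rule grid_bound(1))
      qed
    qed (simp add: emeasure_space_1)
  qed
  note PV = this
  let ?B = "Basis \<union> uminus ` Basis :: (real^'k) set"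
  have "random_bound (\<lambda>s \<omega>. \<forall>v\<in>?B. ?P v s \<omega>)"
  proof (rule random_bound_finite)
    show "random_bound (?P v)" if "v \<in> ?B" for v using that by (intro PV) auto
  qed simp
  moreover have "random_bound ?Q" by (rule Y_holder[OF \<gamma>(3,2)])
  ultimately have "random_bound (\<lambda>s \<omega>. (\<forall>v\<in>?B. ?P v s \<omega>) \<and> ?Q s \<omega>)" by (rule random_bound_conj)
  then show ?thesis
  proof (rule random_bound_trans)
    show "\<forall>n\<ge>1. \<forall>j<n. norm (remainder n j \<omega>) \<le> A' * real n powr (- (1/2 + \<alpha>))"
      if "A \<le> A'" "\<forall>n\<ge>1. \<forall>j<n. norm (remainder n j \<omega>) \<le> A * real n powr (- (1/2 + \<alpha>))" for A A' \<omega>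
      by (rule power_bound_mono[OF that])
  next
    fix s :: real assume s: "0 \<le> s"
    let ?G = "T powr (1 - \<gamma>) + s"
    let ?c = "L\<^sup>2 * ?G\<^sup>2 * T powr (1 + 2 * \<gamma>)"
    let ?A = "real DIM(real^'k) * (s + ?c + 3 / (\<gamma> - \<alpha>))"
    have c: "0 \<le> ?c" by simp
    have path: "\<forall>n\<ge>1. \<forall>j<n. norm (remainder n j \<omega>) \<le> ?A * real n powr (- (1/2 + \<alpha>))"
      if P: "\<forall>v\<in>?B. ?P v s \<omega>" and Q: "?Q s \<omega>" for \<omega>
    proof (intro allI impI)
      fix n j :: nat assume n: "1 \<le> n" and jn: "j < n"
      then have j: "j \<le> n" "Suc j \<le> n" by auto
      define h where "h = T / real n"
      have h: "0 < h" "h \<le> T" using T_pos n by (simp_all add: h_def divide_le_eq mult_le_cancel_left1)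
      have En: "energy ?H (?S n j) (\<t> n j) (\<t> n (Suc j)) \<omega> \<le> (L * (?G * h powr \<gamma>))\<^sup>2 * h"
      proof -
        have "energy ?H (?S n j) (\<t> n j) (\<t> n (Suc j)) \<omega> \<le> (L * (?G * h powr \<gamma>))\<^sup>2 * (\<t> n (Suc j) - \<t> n j)"
        proof (rule energy_le)
          show "\<t> n j \<le> \<t> n (Suc j)" using grid_mono[of T j "Suc j" n] T_pos by simp
          show "0 \<le> L * (?G * h powr \<gamma>)" using L_pos s by simp
          fix r assume r: "r \<in> {\<t> n j..\<t> n (Suc j)}"
          have rh: "\<bar>r - \<t> n j\<bar> \<le> h" using r grid_Suc_diff[of T n j] by (simp add: h_def)
          have rT: "r \<in> {0..T}" "\<t> n j \<in> {0..T}" using r grid_T[OF j(1) n] grid_T[OF j(2) n] by auto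
          have "norm (Y r \<omega> - Y (\<t> n j) \<omega>) \<le> s * \<bar>r - \<t> n j\<bar> powr \<gamma>" by (rule bspec[OF bspec[OF Q rT(2)] rT(1)])
          also have "\<dots> \<le> s * h powr \<gamma>" using rh s \<gamma> by (intro mult_left_mono powr_mono2) auto
          finally have y: "norm (Y (\<t> n j) \<omega> - Y r \<omega>) \<le> s * h powr \<gamma>" by (simp add: norm_minus_commute)
          have "h = h powr (1 - \<gamma>) * h powr \<gamma>" using h by (simp add: powr_add[symmetric])
          also have "\<dots> \<le> T powr (1 - \<gamma>) * h powr \<gamma>" using h \<gamma> by (intro mult_right_mono powr_mono2) auto
          finally have hh: "h \<le> T powr (1 - \<gamma>) * h powr \<gamma>" .
          have "norm (?S n j \<omega> - ?H r \<omega>) \<le> L * (\<bar>\<t> n j - r\<bar> + norm (Y (\<t> n j) \<omega> - Y r \<omega>))" by (rule \<sigma>_lip)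
          also have "\<dots> \<le> L * (?G * h powr \<gamma>)"
            using y hh rh L_pos by (intro mult_left_mono) (auto simp: distrib_right abs_minus_commute)
          finally show "norm (?S n j \<omega> - ?H r \<omega>) \<le> L * (?G * h powr \<gamma>)" .
        qed
        then show ?thesis by (simp add: grid_Suc_diff h_def)
      qed
      have rh2: "(?r n)\<^sup>2 * ((L * (?G * h powr \<gamma>))\<^sup>2 * h) = ?c"
      proof -
        have "h powr (1 + 2 * \<gamma>) = h powr 1 * (h powr \<gamma> * h powr \<gamma>)" by (simp only: powr_add[symmetric] mult_2)
        then have h2: "(h powr \<gamma>)\<^sup>2 * h = h powr (1 + 2 * \<gamma>)" using h by (simp add: power2_eq_square mult_ac)
        have "1 + 2 * \<gamma> = (1/2 + \<gamma>) + (1/2 + \<gamma>)" by simp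
        then have n2: "(?r n)\<^sup>2 = real n powr (1 + 2 * \<gamma>)" by (simp only: power2_eq_square powr_add)
        have nh: "real n powr (1 + 2 * \<gamma>) * h powr (1 + 2 * \<gamma>) = T powr (1 + 2 * \<gamma>)"
          using n by (simp add: powr_mult[symmetric] h_def)
        have "(?r n)\<^sup>2 * ((L * (?G * h powr \<gamma>))\<^sup>2 * h) = L\<^sup>2 * ?G\<^sup>2 * ((?r n)\<^sup>2 * ((h powr \<gamma>)\<^sup>2 * h))"
          by (simp only: power_mult_distrib mult_ac)
        also have "\<dots> = ?c" by (simp only: h2 n2 nh)
        finally show ?thesis .
      qed
      let ?R = "s + ?c + 3 * ln (real n)"
      have rn: "0 < ?r n" using n by simp
      have one: "?r n * (v \<bullet> remainder n j \<omega>) \<le> ?R" if v: "v \<in> ?B" for v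
      proof -
        have "?Z v n j \<omega> \<le> s + 3 * ln (real n)" using P v n j(1) by blast
        then have "?r n * (v \<bullet> remainder n j \<omega>) \<le> s + 3 * ln (real n) + (?r n)\<^sup>2 * energy ?H (?S n j) (\<t> n j) (\<t> n (Suc j)) \<omega>"
          using jn by simp
        also have "(?r n)\<^sup>2 * energy ?H (?S n j) (\<t> n j) (\<t> n (Suc j)) \<omega> \<le> ?c"
          unfolding rh2[symmetric] by (intro mult_left_mono En) simp
        finally show ?thesis by simp
      qed
      have "norm (remainder n j \<omega>) \<le> real DIM(real^'k) * (?R / ?r n)"
      proof (rule norm_le_of_directions)
        fix v :: "real^'k" assume "v \<in> ?B"
        from one[OF this] have "(v \<bullet> remainder n j \<omega>) * ?r n \<le> ?R" by (simp only: mult.commute)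
        then show "v \<bullet> remainder n j \<omega> \<le> ?R / ?r n" using rn by (simp only: pos_le_divide_eq)
      qed
      also have "?R / ?r n = (s + ?c + 3 * ln (real n)) * real n powr (- (\<gamma> - \<alpha>)) * real n powr (- (1/2 + \<alpha>))"
      proof -
        have "1 / ?r n = real n powr (- (1/2 + \<gamma>))" by (simp only: powr_minus inverse_eq_divide)
        also have "- (1/2 + \<gamma>) = - (\<gamma> - \<alpha>) + - (1/2 + \<alpha>)" by simp
        also have "real n powr \<dots> = real n powr (- (\<gamma> - \<alpha>)) * real n powr (- (1/2 + \<alpha>))" by (rule powr_add)
        finally have e: "1 / ?r n = real n powr (- (\<gamma> - \<alpha>)) * real n powr (- (1/2 + \<alpha>))" .
        have "?R / ?r n = ?R * (1 / ?r n)" by (simp only: times_divide_eq_right mult_1_right)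
        then show ?thesis unfolding e by (simp only: mult.assoc)
      qed
      also have "\<dots> \<le> (s + ?c + 3 / (\<gamma> - \<alpha>)) * real n powr (- (1/2 + \<alpha>))"
        by (intro mult_right_mono ln_powr_absorb n) (use s c \<gamma> in auto)
      finally show "norm (remainder n j \<omega>) \<le> ?A * real n powr (- (1/2 + \<alpha>))"
        by (simp only: mult.assoc mult_left_mono of_nat_0_le_iff)
    qed
    then show "\<exists>A. AE \<omega> in M. (\<forall>v\<in>?B. ?P v s \<omega>) \<and> ?Q s \<omega> \<longrightarrow>
        (\<forall>n\<ge>1. \<forall>j<n. norm (remainder n j \<omega>) \<le> A * real n powr (- (1/2 + \<alpha>)))"
      by (intro exI[of _ ?A] AE_I2 impI) blast
  qed
qed

text \<open>The Gronwall estimate at the level \<open>\<delta> = n\<^bsup>-a2\<^esup>\<close> with \<open>a < a2 < 1/2\<close>, fed with the martingale bound, the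
  quadratic variation, the remainder bound and the Hoelder regularity of \<open>Y\<close>. The resulting exponent is half of a
  polynomial in the common random constant \<open>s\<close> plus a multiple of \<open>ln n\<close>, whose coefficient is made equal to
  \<open>2 (a2 - a)\<close>.\<close>

lemma error_bound:
  assumes a: "0 < a" "a < 1/2"
  shows "random_bound (\<lambda>B \<omega>. \<forall>n\<ge>1. \<forall>j\<le>n. norm (err n j \<omega>) \<le> B * real n powr (- a))"
proof -
  define a2 where "a2 = (a + 1/2) / 2"
  define \<eta> where "\<eta> = a2 - a"
  (* The final exponent contains (4 L^2 \<kappa> + 3 / \<theta>) ln n; both summands are made equal to \<eta> ln n, so that half of
     the exponent contributes exactly the factor n powr \<eta>. *)
  define \<kappa> where "\<kappa> = \<eta> / (4 * L\<^sup>2)"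
  define \<theta> where "\<theta> = 3 / \<eta>"
  have a2: "0 < a2" "a2 < 1/2" and \<eta>: "0 < \<eta>" using a by (auto simp: a2_def \<eta>_def)
  have \<kappa>: "0 < \<kappa>" "4 * L\<^sup>2 * \<kappa> = \<eta>" using \<eta> L_pos by (auto simp: \<kappa>_def)
  have \<theta>: "0 < \<theta>" "3 / \<theta> = \<eta>" using \<eta> by (auto simp: \<theta>_def)
  let ?P1 = "\<lambda>s \<omega>. \<forall>n\<ge>1. \<forall>J\<le>n.
    (\<Sum>j<J. \<theta> * (2 * (err n j \<omega> \<bullet> mart n j \<omega>) / lyap a2 n j \<omega>)
      - (\<theta> * (2 * norm (err n j \<omega>) / lyap a2 n j \<omega>))\<^sup>2 * euler_energy n j \<omega>) \<le> s + 3 * ln (real n)"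
  let ?P2 = "\<lambda>s \<omega>. \<forall>n\<ge>1. (\<Sum>j<n. (norm (incr W n j \<omega>))\<^sup>2) \<le> s + \<kappa> * ln (real n)"
  let ?P3 = "\<lambda>A \<omega>. \<forall>n\<ge>1. \<forall>j<n. norm (remainder n j \<omega>) \<le> A * real n powr (- (1/2 + a2))"
  let ?P4 = "\<lambda>A \<omega>. holder_path Y a2 A \<omega>"
  have "random_bound (\<lambda>s \<omega>. ?P1 s \<omega> \<and> ?P2 s \<omega> \<and> ?P3 s \<omega> \<and> ?P4 s \<omega>)"
    by (intro random_bound_conj martingale_bound[OF \<theta>(1)] quadratic_variation[OF \<kappa>(1)] remainder_bound[OF a2] Y_holder[OF a2])
  then show ?thesis
  proof (rule random_bound_trans)
    show "\<forall>n\<ge>1. \<forall>j\<le>n. norm (err n j \<omega>) \<le> A' * real n powr (- a)"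
      if "A \<le> A'" "\<forall>n\<ge>1. \<forall>j\<le>n. norm (err n j \<omega>) \<le> A * real n powr (- a)" for A A' \<omega>
      by (rule power_bound_mono[OF that])
  next
    fix s :: real assume s: "0 \<le> s"
    define G where "G = (T powr (1 - a2) + s) * T powr a2"
    have G: "0 \<le> G" using s by (simp add: G_def)
    define K0 where "K0 = T * L * (G + 2) + 4 * T\<^sup>2 * L\<^sup>2 * (G\<^sup>2 + 1) + 4 * s\<^sup>2 + 4 * L\<^sup>2 * s + s / \<theta> + 8 * \<theta> * T * L\<^sup>2 * (G\<^sup>2 + 1)"
    have path: "norm (err n J \<omega>) \<le> exp (K0 / 2) * real n powr (- a)"
      if \<omega>: "\<omega> \<in> space M" and Yeq: "\<forall>t\<in>{0..T}. Y t \<omega> = y0 + (LINT s:{0..t}|lborel. b (s, Y s \<omega>)) + X t \<omega>"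
        and Y0: "Y 0 \<omega> = y0" and cont: "continuous_on {0..T} (\<lambda>r. b (r, Y r \<omega>))"
        and P1: "?P1 s \<omega>" and P2: "?P2 s \<omega>" and P3: "?P3 s \<omega>" and P4: "?P4 s \<omega>"
        and n: "1 \<le> n" and J: "J \<le> n" for n J \<omega>
    proof -
      define h where "h = T / real n"
      define \<delta> where "\<delta> = real n powr (- a2)"
      have h: "0 < h" "h \<le> T" "real n * h = T" using T_pos n by (simp_all add: h_def divide_le_eq mult_le_cancel_left1)
      have \<delta>: "0 < \<delta>" using n by (simp add: \<delta>_def)
      have h\<delta>: "h powr a2 = T powr a2 * \<delta>"
        by (simp add: h_def \<delta>_def powr_divide powr_minus_divide)
      have hG: "h + s * h powr a2 \<le> G * \<delta>"
      proof -
        have "h = h powr (1 - a2) * h powr a2" using h by (simp add: powr_add[symmetric])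
        also have "\<dots> \<le> T powr (1 - a2) * h powr a2" using h a2 by (intro mult_right_mono powr_mono2) auto
        finally have "h + s * h powr a2 \<le> T powr (1 - a2) * h powr a2 + s * h powr a2" by simp
        also have "\<dots> = G * \<delta>" unfolding h\<delta> G_def by (simp add: algebra_simps)
        finally show ?thesis .
      qed
      have close: "\<bar>\<t> n j - r\<bar> + norm (Z n (\<t> n j) \<omega> - Y r \<omega>) \<le> G * \<delta> + norm (err n j \<omega>)"
        if j: "j < n" and r: "r \<in> {\<t> n j..\<t> n (Suc j)}" for j r
      proof -
        have j': "j \<le> n" "Suc j \<le> n" using j by auto
        have rh: "\<bar>r - \<t> n j\<bar> \<le> h" using r grid_Suc_diff[of T n j] by (simp add: h_def)
        have rT: "r \<in> {0..T}" "\<t> n j \<in> {0..T}" using r grid_T[OF j'(1) n] grid_T[OF j'(2) n] by auto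
        have "norm (Y r \<omega> - Y (\<t> n j) \<omega>) \<le> s * \<bar>r - \<t> n j\<bar> powr a2" by (rule bspec[OF bspec[OF P4 rT(2)] rT(1)])
        also have "\<dots> \<le> s * h powr a2" using rh s a2 by (intro mult_left_mono powr_mono2) auto
        finally have y: "norm (Y r \<omega> - Y (\<t> n j) \<omega>) \<le> s * h powr a2" .
        have "norm (Z n (\<t> n j) \<omega> - Y r \<omega>) \<le> norm (Y r \<omega> - Y (\<t> n j) \<omega>) + norm (err n j \<omega>)"
          using norm_triangle_ineq[of "Y r \<omega> - Y (\<t> n j) \<omega>" "err n j \<omega>"] by (simp add: err_def norm_minus_commute)
        then show ?thesis using y rh hG by linarith
      qed
      have "norm (err n J \<omega>) \<le> \<delta> * exp ((T * L * (G + 2) + 4 * T\<^sup>2 * L\<^sup>2 * (G\<^sup>2 + 1) + 4 * s\<^sup>2 + 4 * L\<^sup>2 * (s + \<kappa> * ln (real n))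
          + (s + 3 * ln (real n)) / \<theta> + 8 * \<theta> * T * L\<^sup>2 * (G\<^sup>2 + 1)) / 2)"
      proof (rule stochastic_log_gronwall[where h = h and n = n and e = "\<lambda>j. err n j \<omega>" and m = "\<lambda>j. mart n j \<omega>"
            and d = "\<lambda>j. err n (Suc j) \<omega> - err n j \<omega> - mart n j \<omega>" and w = "\<lambda>j. norm (incr W n j \<omega>)"
            and En = "\<lambda>j. euler_energy n j \<omega>" and r = "s * real n powr (- (1/2 + a2))"])
        show "err n 0 \<omega> = 0" using Y0 euler_start[OF n \<omega>] by (simp add: err_def grid_0)
        show "(\<Sum>j<J'. \<theta> * (2 * (err n j \<omega> \<bullet> mart n j \<omega>) / ((norm (err n j \<omega>))\<^sup>2 + \<delta>\<^sup>2))
          - (\<theta> * (2 * norm (err n j \<omega>) / ((norm (err n j \<omega>))\<^sup>2 + \<delta>\<^sup>2)))\<^sup>2 * euler_energy n j \<omega>) \<le> s + 3 * ln (real n)"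
          if "J' \<le> n" for J'
          using P1[rule_format, OF n that] unfolding lyap_def \<delta>_def .
        show "(\<Sum>j<n. (norm (incr W n j \<omega>))\<^sup>2) \<le> s + \<kappa> * ln (real n)"
          using P2 n by blast
        show "real n * (s * real n powr (- (1/2 + a2)))\<^sup>2 \<le> s\<^sup>2 * \<delta>\<^sup>2"
        proof -
          have "real n * (real n powr (- (1/2 + a2)))\<^sup>2 = real n powr 1 * (real n powr (- (1/2 + a2)) * real n powr (- (1/2 + a2)))"
            using n by (simp add: power2_eq_square)
          also have "\<dots> = real n powr (1 + (- (1/2 + a2) + - (1/2 + a2)))" by (simp only: powr_add)
          also have "1 + (- (1/2 + a2) + - (1/2 + a2)) = - a2 + - a2" by simp
          also have "real n powr \<dots> = \<delta>\<^sup>2" unfolding \<delta>_def by (simp only: powr_add power2_eq_square)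
          finally have sq: "real n * (real n powr (- (1/2 + a2)))\<^sup>2 = \<delta>\<^sup>2" .
          have "real n * (s * real n powr (- (1/2 + a2)))\<^sup>2 = s\<^sup>2 * (real n * (real n powr (- (1/2 + a2)))\<^sup>2)"
            by (simp only: power_mult_distrib mult_ac)
          then show ?thesis unfolding sq by (rule eq_refl)
        qed
        fix j assume j: "j < n"
        then have j': "j \<le> n" "Suc j \<le> n" by auto
        have tj: "\<t> n j \<in> {0..T}" "\<t> n (Suc j) \<in> {0..T}" using grid_T[OF j'(1) n] grid_T[OF j'(2) n] by auto
        have le: "\<t> n j \<le> \<t> n (Suc j)" using grid_mono[of T j "Suc j" n] T_pos by simp
        show "err n (Suc j) \<omega> = err n j \<omega> + ((err n (Suc j) \<omega> - err n j \<omega> - mart n j \<omega>) + mart n j \<omega>)" by simp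
        show "0 \<le> norm (incr W n j \<omega>)" by simp
        show "norm (err n (Suc j) \<omega> - err n j \<omega> - mart n j \<omega>) \<le> h * (L * (G * \<delta> + norm (err n j \<omega>)))"
        proof -
          let ?I = "\<lambda>t. LINT r:{0..t}|lborel. b (r, Y r \<omega>)"
          have "err n (Suc j) \<omega> - err n j \<omega> - mart n j \<omega> = ?I (\<t> n (Suc j)) - ?I (\<t> n j) - (\<t> n (Suc j) - \<t> n j) *\<^sub>R b (\<t> n j, Z n (\<t> n j) \<omega>)"
            using bspec[OF Yeq tj(1)] bspec[OF Yeq tj(2)] euler_step[OF n j \<omega>] unfolding err_def mart_def grid_Suc_diff by simp
          also have "norm \<dots> \<le> (L * (G * \<delta> + norm (err n j \<omega>))) * (\<t> n (Suc j) - \<t> n j)"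
          proof (rule set_integral_increment_approx[OF cont])
            fix r assume r: "r \<in> {\<t> n j..\<t> n (Suc j)}"
            have "norm (b (\<t> n j, Z n (\<t> n j) \<omega>) - b (r, Y r \<omega>)) \<le> L * (\<bar>\<t> n j - r\<bar> + norm (Z n (\<t> n j) \<omega> - Y r \<omega>))" by (rule b_lip)
            also have "\<dots> \<le> L * (G * \<delta> + norm (err n j \<omega>))" using close[OF j r] L_pos by (intro mult_left_mono) auto
            finally show "norm (b (r, Y r \<omega>) - b (\<t> n j, Z n (\<t> n j) \<omega>)) \<le> L * (G * \<delta> + norm (err n j \<omega>))"
              by (subst norm_minus_commute)
          qed (use tj le in auto)
          finally show ?thesis by (simp add: grid_Suc_diff h_def mult.commute)
        qed
        show "euler_energy n j \<omega> \<le> (L * (G * \<delta> + norm (err n j \<omega>)))\<^sup>2 * h"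
        proof -
          have "euler_energy n j \<omega> \<le> (L * (G * \<delta> + norm (err n j \<omega>)))\<^sup>2 * (\<t> n (Suc j) - \<t> n j)"
            unfolding euler_energy_def
          proof (rule energy_le[OF le])
            show "0 \<le> L * (G * \<delta> + norm (err n j \<omega>))" using L_pos G \<delta> by simp
            fix r assume r: "r \<in> {\<t> n j..\<t> n (Suc j)}"
            have "norm (\<sigma> (\<t> n j, Z n (\<t> n j) \<omega>) - \<sigma> (r, Y r \<omega>)) \<le> L * (\<bar>\<t> n j - r\<bar> + norm (Z n (\<t> n j) \<omega> - Y r \<omega>))" by (rule \<sigma>_lip)
            also have "\<dots> \<le> L * (G * \<delta> + norm (err n j \<omega>))" using close[OF j r] L_pos by (intro mult_left_mono) auto
            finally show "norm (\<sigma> (\<t> n j, Z n (\<t> n j) \<omega>) - \<sigma> (r, Y r \<omega>)) \<le> L * (G * \<delta> + norm (err n j \<omega>))" .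
          qed
          then show ?thesis by (simp add: grid_Suc_diff h_def)
        qed
        show "norm (mart n j \<omega>) \<le> s * real n powr (- (1/2 + a2)) + L * norm (err n j \<omega>) * norm (incr W n j \<omega>)"
        proof -
          let ?D = "incr W n j \<omega>"
          let ?\<sigma> = "\<sigma> (\<t> n j, Y (\<t> n j) \<omega>) - \<sigma> (\<t> n j, Z n (\<t> n j) \<omega>)"
          have "mart n j \<omega> = remainder n j \<omega> + blinfun_apply ?\<sigma> ?D"
            unfolding mart_def remainder_def by (simp add: blinfun.diff_left)
          then have "norm (mart n j \<omega>) \<le> norm (remainder n j \<omega>) + norm (blinfun_apply ?\<sigma> ?D)" by (simp only: norm_triangle_ineq)
          also have "norm (blinfun_apply ?\<sigma> ?D) \<le> norm ?\<sigma> * norm ?D" by (rule norm_blinfun)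
          also have "norm ?\<sigma> * norm ?D \<le> (L * norm (err n j \<omega>)) * norm ?D"
            using \<sigma>_lip[of "\<t> n j" "Y (\<t> n j) \<omega>" "\<t> n j" "Z n (\<t> n j) \<omega>"] by (intro mult_right_mono) (simp_all add: err_def)
          also have "norm (remainder n j \<omega>) \<le> s * real n powr (- (1/2 + a2))" using P3 n j by blast
          finally show ?thesis by simp
        qed
      qed (use h L_pos G \<delta> \<theta> s J in auto)
      also have "T * L * (G + 2) + 4 * T\<^sup>2 * L\<^sup>2 * (G\<^sup>2 + 1) + 4 * s\<^sup>2 + 4 * L\<^sup>2 * (s + \<kappa> * ln (real n))
          + (s + 3 * ln (real n)) / \<theta> + 8 * \<theta> * T * L\<^sup>2 * (G\<^sup>2 + 1) = K0 + 2 * \<eta> * ln (real n)"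
      proof -
        have "4 * L\<^sup>2 * (s + \<kappa> * ln (real n)) = 4 * L\<^sup>2 * s + (4 * L\<^sup>2 * \<kappa>) * ln (real n)" by (simp add: algebra_simps)
        moreover have "(s + 3 * ln (real n)) / \<theta> = s / \<theta> + (3 / \<theta>) * ln (real n)" by (simp add: add_divide_distrib)
        ultimately show ?thesis unfolding K0_def \<kappa>(2) \<theta>(2) by simp
      qed
      also have "\<delta> * exp ((K0 + 2 * \<eta> * ln (real n)) / 2) = exp (K0 / 2) * (real n powr (- a2) * real n powr \<eta>)"
      proof -
        have "exp ((K0 + 2 * \<eta> * ln (real n)) / 2) = exp (K0 / 2) * exp (\<eta> * ln (real n))"
          by (simp add: exp_add[symmetric] add_divide_distrib)
        also have "exp (\<eta> * ln (real n)) = real n powr \<eta>" using n by (simp add: powr_def)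
        finally show ?thesis by (simp add: \<delta>_def)
      qed
      also have "real n powr (- a2) * real n powr \<eta> = real n powr (- a)"
        by (simp add: powr_add[symmetric] \<eta>_def)
      finally show ?thesis .
    qed
    show "\<exists>c. AE \<omega> in M. ?P1 s \<omega> \<and> ?P2 s \<omega> \<and> ?P3 s \<omega> \<and> ?P4 s \<omega> \<longrightarrow>
        (\<forall>n\<ge>1. \<forall>j\<le>n. norm (err n j \<omega>) \<le> c * real n powr (- a))"
    proof (rule exI[of _ "exp (K0 / 2)"])
      show "AE \<omega> in M. ?P1 s \<omega> \<and> ?P2 s \<omega> \<and> ?P3 s \<omega> \<and> ?P4 s \<omega> \<longrightarrow>
        (\<forall>n\<ge>1. \<forall>j\<le>n. norm (err n j \<omega>) \<le> exp (K0 / 2) * real n powr (- a))"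
        using AE_space Y_eq Y_start Y_path_continuous
      proof eventually_elim
        case (elim \<omega>)
        show ?case
        proof (intro impI allI, elim conjE)
          fix n j :: nat assume "?P1 s \<omega>" "?P2 s \<omega>" "?P3 s \<omega>" "?P4 s \<omega>" "1 \<le> n" "j \<le> n"
          then show "norm (err n j \<omega>) \<le> exp (K0 / 2) * real n powr (- a)" by (rule path[OF elim])
        qed
      qed
    qed
  qed
qed

section \<open>The rate in variation norm\<close>

lemma rounding_mono:
  assumes "1 \<le> n" "s \<in> {0..T}" "t \<in> {0..T}" "s \<le> t"
  shows "rounding n s \<le> rounding n t"
  unfolding rounding_def using assms T_pos
  by (intro grid_mono nat_mono floor_mono divide_right_mono mult_right_mono) auto

lemma rounding_separated:
  assumes n: "1 \<le> n" and ne: "rounding n s \<noteq> rounding n t"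
  shows "T / real n \<le> \<bar>rounding n t - rounding n s\<bar>"
proof -
  let ?k = "\<lambda>t. nat \<lfloor>t * real n / T\<rfloor>"
  have "?k s \<noteq> ?k t" using ne by (auto simp: rounding_def)
  then have "1 \<le> \<bar>real (?k t) - real (?k s)\<bar>" by linarith
  then have "1 * (T / real n) \<le> \<bar>real (?k t) - real (?k s)\<bar> * (T / real n)" using T_pos by (intro mult_right_mono) auto
  also have "\<dots> = \<bar>(real (?k t) - real (?k s)) * (T / real n)\<bar>" using T_pos by (simp add: abs_mult)
  also have "(real (?k t) - real (?k s)) * (T / real n) = rounding n t - rounding n s"
    by (simp add: rounding_def grid_def left_diff_distrib diff_divide_distrib)
  finally show ?thesis by simp
qed

theorem euler_variation_rate:
  assumes a: "0 < a" "a < 1/2" and p: "0 < p" "1 \<le> a * p" "p < p'"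
  shows "random_bound (\<lambda>C \<omega>. \<forall>n\<ge>1. variation_norm p' T (\<lambda>t. Z n t \<omega> - Y t \<omega>)
    \<le> ennreal (C * real n powr (- (a * (1 - p / p')))))"
proof -
  let ?P = "\<lambda>B \<omega>. \<forall>n\<ge>1. \<forall>j\<le>n. norm (err n j \<omega>) \<le> B * real n powr (- a)"
  let ?Q = "\<lambda>A \<omega>. holder_path Y a A \<omega>"
  have "random_bound (\<lambda>s \<omega>. ?P s \<omega> \<and> ?Q s \<omega>)"
    by (rule random_bound_conj[OF error_bound[OF a] Y_holder[OF a]])
  then show ?thesis
  proof (rule random_bound_trans)
    fix s s' :: real and \<omega>
    assume le: "s \<le> s'" and *: "\<forall>n\<ge>1. variation_norm p' T (\<lambda>t. Z n t \<omega> - Y t \<omega>) \<le> ennreal (s * real n powr (- (a * (1 - p / p'))))"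
    show "\<forall>n\<ge>1. variation_norm p' T (\<lambda>t. Z n t \<omega> - Y t \<omega>) \<le> ennreal (s' * real n powr (- (a * (1 - p / p'))))"
      using * ennreal_leI[OF mult_right_mono[OF le powr_ge_zero]] by (meson order_trans)
  next
    fix s :: real assume s: "0 \<le> s"
    define A where "A = s + s / T powr a"
    have A: "0 \<le> A" "s \<le> A" "s / T powr a \<le> A" using s by (auto simp: A_def)
    let ?D = "(4 * A) powr (p' - p) * T powr (a * (p' - p)) * ((4 * A) powr p * (2 powr p * (2 * T powr (a * p))))"
    show "\<exists>c. AE \<omega> in M. ?P s \<omega> \<and> ?Q s \<omega> \<longrightarrow> (\<forall>n\<ge>1. variation_norm p' T (\<lambda>t. Z n t \<omega> - Y t \<omega>)
        \<le> ennreal (c * real n powr (- (a * (1 - p / p')))))"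
    proof (intro exI[of _ "?D powr (1 / p')"] AE_I2 impI allI, elim conjE)
      fix \<omega> and n :: nat assume \<omega>: "\<omega> \<in> space M" and n: "1 \<le> n" and P: "?P s \<omega>" and Q: "?Q s \<omega>"
      define h where "h = T / real n"
      have h: "0 < h" using T_pos n by (simp add: h_def)
      have "variation_norm p' T (\<lambda>t. Z n t \<omega> - Y t \<omega>)
        \<le> ennreal (((4 * A * h powr a) powr (p' - p) * ((4 * A) powr p * (2 powr p * (2 * T powr (a * p))))) powr (1 / p'))"
      proof (rule variation_interpolation[where \<eta> = "rounding n", OF T_pos h a(1) A(1) p])
        fix r t assume "r \<in> {0..T}" "t \<in> {0..T}"
        then have "norm (Y t \<omega> - Y r \<omega>) \<le> s * \<bar>t - r\<bar> powr a" using Q by blast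
        also have "\<dots> \<le> A * \<bar>t - r\<bar> powr a" using A by (intro mult_right_mono) auto
        finally show "norm (Y t \<omega> - Y r \<omega>) \<le> A * \<bar>t - r\<bar> powr a" .
      next
        fix t assume t: "t \<in> {0..T}"
        show "rounding n t \<in> {0..T} \<and> t - h \<le> rounding n t \<and> rounding n t \<le> t"
          using rounding_index(1,2,3)[OF n t] grid_T[OF rounding_index(1)[OF n t] n] by (simp add: rounding_def h_def)
        show "Z n t \<omega> = Z n (rounding n t) \<omega>" by (rule euler_piecewise_constant[OF n t \<omega>])
        have "norm (err n (nat \<lfloor>t * real n / T\<rfloor>) \<omega>) \<le> s * real n powr (- a)" using P n rounding_index(1)[OF n t] by blast
        also have "s * real n powr (- a) = (s / T powr a) * h powr a"
          using T_pos by (simp add: h_def powr_divide powr_minus field_simps)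
        also have "\<dots> \<le> A * h powr a" using A by (intro mult_right_mono) auto
        finally show "norm (Z n (rounding n t) \<omega> - Y (rounding n t) \<omega>) \<le> A * h powr a"
          by (simp add: err_def rounding_def norm_minus_commute)
      qed (use rounding_mono[OF n] rounding_separated[OF n] in \<open>auto simp: h_def\<close>)
      also have "((4 * A * h powr a) powr (p' - p) * ((4 * A) powr p * (2 powr p * (2 * T powr (a * p))))) powr (1 / p')
          = ?D powr (1 / p') * real n powr (- (a * (1 - p / p')))"
      proof -
        have "(4 * A * h powr a) powr (p' - p) = (4 * A) powr (p' - p) * h powr (a * (p' - p))"
          by (simp only: powr_mult powr_powr)
        also have "h powr (a * (p' - p)) = T powr (a * (p' - p)) * real n powr (- (a * (p' - p)))"
          by (simp add: h_def powr_divide powr_minus_divide)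
        finally have "(4 * A * h powr a) powr (p' - p) * ((4 * A) powr p * (2 powr p * (2 * T powr (a * p))))
            = ?D * real n powr (- (a * (p' - p)))" by (simp only: mult_ac)
        moreover have "(real n powr (- (a * (p' - p)))) powr (1 / p') = real n powr (- (a * (1 - p / p')))"
        proof -
          have "- (a * (p' - p)) * (1 / p') = - (a * (1 - p / p'))" using p by (simp add: field_simps)
          then show ?thesis by (simp only: powr_powr)
        qed
        ultimately show ?thesis by (simp only: powr_mult)
      qed
      finally show "variation_norm p' T (\<lambda>t. Z n t \<omega> - Y t \<omega>) \<le> ennreal (?D powr (1 / p') * real n powr (- (a * (1 - p / p'))))" .
    qed
  qed
qed

end

lemma bounded_derivative_imp_lipschitz:
  fixes f :: "'a::real_normed_vector \<Rightarrow> 'b::real_normed_vector" and f' :: "'a \<Rightarrow> 'a \<Rightarrow>\<^sub>L 'b"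
  assumes "\<And>x. (f has_derivative blinfun_apply (f' x)) (at x)" "C0b f'"
  obtains L where "0 < L" "\<And>x y. norm (f x - f y) \<le> L * norm (x - y)"
proof -
  obtain B where B: "\<And>x. norm (f' x) \<le> B" using assms(2) unfolding C0b_def bounded_iff by auto
  have "norm (f x - f y) \<le> (\<bar>B\<bar> + 1) * norm (x - y)" for x y
  proof (rule differentiable_bound[of UNIV])
    show "(f has_derivative blinfun_apply (f' z)) (at z within UNIV)" for z using assms(1) by simp
    show "onorm (blinfun_apply (f' z)) \<le> \<bar>B\<bar> + 1" for z using B[of z] by (simp add: norm_blinfun.rep_eq[symmetric])
  qed auto
  then show thesis using that[of "\<bar>B\<bar> + 1"] by auto
qed

text \<open>Bounded derivatives make the coefficients Lipschitz. The exponent \<open>a = max (1/p) (2/p - \<beta>)\<close> is the smallest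
  one that satisfies both requirements, \<open>a p \<ge> 1\<close> and \<open>a \<ge> 2/p - \<beta>\<close>.\<close>

theorem corollary3p5:
  fixes M :: "'w measure" and F :: "real \<Rightarrow> 'w measure"
    and T p p' q \<beta> :: real
    and W :: "real \<Rightarrow> 'w \<Rightarrow> real ^ 'd"
    and y0 :: "real ^ 'k"
    and b :: "real \<times> (real ^ 'k) \<Rightarrow> real ^ 'k"
    and \<sigma> :: "real \<times> (real ^ 'k) \<Rightarrow> (real ^ 'd) \<Rightarrow>\<^sub>L (real ^ 'k)"
    and Y :: "real \<Rightarrow> 'w \<Rightarrow> real ^ 'k"
    and Yn :: "nat \<Rightarrow> real \<Rightarrow> 'w \<Rightarrow> real ^ 'k"
  assumes "0 < T"
    and "brownian_motion M F T W"
    and "2 < p" "p < 3"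
    and "C2b b"
    and "C3b \<sigma>"
    and "is_sde_solution M F T W y0 b \<sigma> Y"
    and "\<And>n. 1 \<le> n \<Longrightarrow> is_euler_approximation M T W y0 b \<sigma> n (Yn n)"
    and "p < p'" "p' < 3"
    and "1 < q" "q < 2"
    and "1 - 1 / p < \<beta>" "\<beta> < 2 / p"
    and "1 / p' + 1 / q > 1"
  shows "\<exists>C :: 'w \<Rightarrow> real. C \<in> borel_measurable M \<and>
    (AE \<omega> in M. \<forall>n\<ge>1. variation_norm p' T (\<lambda>t. Yn n t \<omega> - Y t \<omega>)
      \<le> ennreal (C \<omega> * (real n powr (- (1 - 1 / q))
                       + real n powr (- ((2 / p - \<beta>) * (1 - p / p'))))))"
proof -
  interpret brownian_motion M F T W by (rule assms(2))
  obtain X where X: "is_ito_integral M F T W (\<lambda>s \<omega>. \<sigma> (s, Y s \<omega>)) X"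
      "AE \<omega> in M. \<forall>t\<in>{0..T}. Y t \<omega> = y0 + (LINT s:{0..t}|lborel. b (s, Y s \<omega>)) + X t \<omega>"
    and Y: "adapted F T Y" "AE_continuous M T Y"
    using assms(7) unfolding is_sde_solution_def by blast
  obtain Lb where Lb: "0 < Lb" "\<And>x y. norm (b x - b y) \<le> Lb * norm (x - y)"
    using assms(5) bounded_derivative_imp_lipschitz unfolding C2b_def C1b_def by metis
  obtain Ls where Ls: "0 < Ls" "\<And>x y. norm (\<sigma> x - \<sigma> y) \<le> Ls * norm (x - y)"
    using assms(6) bounded_derivative_imp_lipschitz unfolding C3b_def C2b_def by metis
  have cont: "continuous_on UNIV b" "continuous_on UNIV \<sigma>" and bd: "bounded (range b)" "bounded (range \<sigma>)"
    using assms(5,6) unfolding C3b_def C2b_def C0b_def by auto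
  obtain Kb where Kb: "\<And>z. norm (b z) \<le> Kb" using bd(1) unfolding bounded_iff by auto
  obtain Ks where Ks: "\<And>z. norm (\<sigma> z) \<le> Ks" using bd(2) unfolding bounded_iff by auto
  have pair: "norm ((s, x) - (t, y)) \<le> \<bar>s - t\<bar> + norm (x - y)" for s t :: real and x y :: "real^'k"
    using norm_Pair_le[of "s - t" "x - y"] by simp
  interpret sde_euler M F T W y0 b \<sigma> X Y Yn "max Kb Ks" "max Lb Ls"
  proof
    show "norm (b (s, x) - b (t, y)) \<le> max Lb Ls * (\<bar>s - t\<bar> + norm (x - y))" for s x t y
      using Lb by (intro order_trans[OF Lb(2)] mult_mono pair) auto
    show "norm (\<sigma> (s, x) - \<sigma> (t, y)) \<le> max Lb Ls * (\<bar>s - t\<bar> + norm (x - y))" for s x t y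
      using Ls by (intro order_trans[OF Ls(2)] mult_mono pair) auto
    show "norm (b z) \<le> max Kb Ks" "norm (\<sigma> z) \<le> max Kb Ks" for z
      using Kb[of z] Ks[of z] by auto
  qed (use assms Lb X Y cont in auto)
  define a where "a = max (1 / p) (2 / p - \<beta>)"
  have "3 / p - 1 < 1 / 2" using assms(3) by (simp add: field_simps)
  then have a: "0 < a" "a < 1 / 2" using assms(3,13) by (auto simp: a_def field_simps)
  have "1 / p * p \<le> a * p" using assms(3) by (intro mult_right_mono) (auto simp: a_def)
  then have ap: "1 \<le> a * p" using assms(3) by simp
  have "0 < p" using assms(3) by simp
  from euler_variation_rate[OF a this ap assms(9)]
  obtain S where S: "S \<in> borel_measurable M"
    "AE \<omega> in M. \<forall>s\<ge>S \<omega>. \<forall>n\<ge>1. variation_norm p' T (\<lambda>t. Yn n t \<omega> - Y t \<omega>) \<le> ennreal (s * real n powr (- (a * (1 - p / p'))))"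
    unfolding random_bound_def by blast
  show ?thesis
  proof (intro exI[of _ "\<lambda>\<omega>. \<bar>S \<omega>\<bar>"] conjI)
    show "(\<lambda>\<omega>. \<bar>S \<omega>\<bar>) \<in> borel_measurable M" using S(1) by measurable
    show "AE \<omega> in M. \<forall>n\<ge>1. variation_norm p' T (\<lambda>t. Yn n t \<omega> - Y t \<omega>)
      \<le> ennreal (\<bar>S \<omega>\<bar> * (real n powr (- (1 - 1 / q)) + real n powr (- ((2 / p - \<beta>) * (1 - p / p')))))"
      using S(2)
    proof eventually_elim
      case (elim \<omega>)
      show ?case
      proof (intro allI impI)
        fix n :: nat assume n: "1 \<le> n"
        have "variation_norm p' T (\<lambda>t. Yn n t \<omega> - Y t \<omega>) \<le> ennreal (S \<omega> * real n powr (- (a * (1 - p / p'))))"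
          using elim n order_refl[of "S \<omega>"] by blast
        also have "\<dots> \<le> ennreal (\<bar>S \<omega>\<bar> * (real n powr (- (1 - 1 / q)) + real n powr (- ((2 / p - \<beta>) * (1 - p / p')))))"
        proof (intro ennreal_leI mult_mono)
          have "0 \<le> 1 - p / p'" using assms(3,9) by simp
          then have "(2 / p - \<beta>) * (1 - p / p') \<le> a * (1 - p / p')" by (intro mult_right_mono) (auto simp: a_def)
          then have "real n powr (- (a * (1 - p / p'))) \<le> real n powr (- ((2 / p - \<beta>) * (1 - p / p')))"
            using n by (intro powr_mono) auto
          then show "real n powr (- (a * (1 - p / p'))) \<le> real n powr (- (1 - 1 / q)) + real n powr (- ((2 / p - \<beta>) * (1 - p / p')))"
            by (simp add: add_increasing)
        qed auto
        finally show "variation_norm p' T (\<lambda>t. Yn n t \<omega> - Y t \<omega>)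
          \<le> ennreal (\<bar>S \<omega>\<bar> * (real n powr (- (1 - 1 / q)) + real n powr (- ((2 / p - \<beta>) * (1 - p / p')))))" .
      qed
    qed
  qed
qed

end
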